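(* Let $k$ be an infinite field and let $R=k[x,y;u,v]$ be bigraded by $\deg x=\deg y=(1,0)$, $\deg u=\deg v=(0,1)$. Let $\phi:\mathbb{P}^1\times\mathbb{P}^1\dashrightarrow\mathbb{P}^2$ be a dominant rational map given by bihomogeneous polynomials $f_0,f_1,f_2\in R$ of bidegree $(1,2)$ without common factor in $R\setminus k$. Set $I=(f_0,f_1,f_2)\subset R$ and let $\mathcal{B}$ be the base scheme of $\phi$. The following are equivalent: (i) $\phi$ is birational; (ii) $\deg(\mathcal{B})=3$, and hence $I$ is generically a complete intersection; (iii) $\dim_k\operatorname{Syz}(I)_{(0,1)}=1$; (iv) $\dim_k\operatorname{Syz}(I)_{(1,1)}=3$.
   Context: The base scheme $\mathcal{B}$ is the (zero-dimensional, possibly empty) subscheme of $\mathbb{P}^1\times\mathbb{P}^1$ defined by $f_0,f_1,f_2$; $\deg(\mathcal{B})=\dim_k H^0(\mathcal{B},\mathcal{O}_{\mathcal{B}})$, which equals $\dim_k(R/I)_{(\mu,\nu)}$ for all sufficiently large $\mu,\nu$. $I$ is generically a complete intersection if its localization at the prime of every point of $\mathcal{B}$ is generated by two elements. $\operatorname{Syz}(I)\subseteq R^3$ is the module of triples $(g_0,g_1,g_2)$ with $\sum g_if_i=0$, and $\operatorname{Syz}(I)_{(p,q)}$ is the $k$-vector space of such triples with all $g_i$ bihomogeneous of bidegree $(p,q)$. Part (ii) means: the condition is $\deg(\mathcal{B})=3$, and under this condition $I$ is generically a complete intersection. *)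

theory Defs
  imports
    "HOL-Computational_Algebra.Polynomial"
    "HOL-Computational_Algebra.Fraction_Field"
    "HOL-Library.Product_Plus"
    "HOL-Library.Function_Algebras"
begin

text \<open>
  The bigraded ring \<open>R = k[x,y;u,v]\<close>, encoded as \<open>k[u][v][x][y]\<close>: the innermost variable is \<open>u\<close>, the outermost one is \<open>y\<close>.
\<close>

type_synonym 'k bipoly = "'k poly poly poly poly"

definition bconst :: "'k::field \<Rightarrow> 'k bipoly" where
  "bconst c = [:[:[:[:c:]:]:]:]"

definition var_x :: "'k::field bipoly" where "var_x = [:[:0, 1:]:]"
definition var_y :: "'k::field bipoly" where "var_y = [:0, 1:]"
definition var_u :: "'k::field bipoly" where "var_u = [:[:[:[:0, 1:]:]:]:]"
definition var_v :: "'k::field bipoly" where "var_v = [:[:[:0, 1:]:]:]"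

text \<open>The coefficient of \<open>x\<^sup>a y\<^sup>b u\<^sup>c v\<^sup>d\<close>.\<close>

definition bicoeff :: "'k::field bipoly \<Rightarrow> nat \<Rightarrow> nat \<Rightarrow> nat \<Rightarrow> nat \<Rightarrow> 'k" where
  "bicoeff f a b c d = coeff (coeff (coeff (coeff f b) a) d) c"

definition bihomogeneous :: "nat \<Rightarrow> nat \<Rightarrow> 'k::field bipoly \<Rightarrow> bool" where
  "bihomogeneous p q f \<longleftrightarrow>
     (\<forall>a b c d. bicoeff f a b c d \<noteq> 0 \<longrightarrow> a + b = p \<and> c + d = q)"

definition bicomponent :: "nat \<Rightarrow> nat \<Rightarrow> 'k::field bipoly \<Rightarrow> 'k bipoly" where
  "bicomponent p q f =
     (\<Sum>a\<le>p. \<Sum>c\<le>q. bconst (bicoeff f a (p - a) c (q - c))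
        * var_x ^ a * var_y ^ (p - a) * var_u ^ c * var_v ^ (q - c))"

text \<open>The coordinate ring of the plane, encoded as \<open>k[z\<^sub>0][z\<^sub>1][z\<^sub>2]\<close>.\<close>

type_synonym 'k tripoly = "'k poly poly poly"

definition tconst :: "'k::field \<Rightarrow> 'k tripoly" where
  "tconst c = [:[:[:c:]:]:]"

definition var_z0 :: "'k::field tripoly" where "var_z0 = [:[:[:0, 1:]:]:]"
definition var_z1 :: "'k::field tripoly" where "var_z1 = [:[:0, 1:]:]"
definition var_z2 :: "'k::field tripoly" where "var_z2 = [:0, 1:]"

definition homogeneous :: "nat \<Rightarrow> 'k::field tripoly \<Rightarrow> bool" where
  "homogeneous e F \<longleftrightarrow>
     (\<forall>i j l. coeff (coeff (coeff F l) j) i \<noteq> 0 \<longrightarrow> i + j + l = e)"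

text \<open>
  \<open>eval_with h p r\<close> evaluates \<open>p\<close> at \<open>r\<close> after mapping its coefficients along \<open>h\<close>.
\<close>

definition eval_with :: "('a::zero \<Rightarrow> 'r::comm_ring_1) \<Rightarrow> 'a poly \<Rightarrow> 'r \<Rightarrow> 'r" where
  "eval_with h p r = poly (map_poly h p) r"

text \<open>\<open>F(r\<^sub>0, r\<^sub>1, r\<^sub>2)\<close> for a form \<open>F\<close> on the plane and \<open>r\<^sub>0, r\<^sub>1, r\<^sub>2 \<in> R\<close>.\<close>

definition tsubst :: "'k::field bipoly \<Rightarrow> 'k bipoly \<Rightarrow> 'k bipoly \<Rightarrow> 'k tripoly \<Rightarrow> 'k bipoly" where
  "tsubst r0 r1 r2 F =
     eval_with (\<lambda>G. eval_with (\<lambda>H. eval_with bconst H r0) G r1) F r2"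

text \<open>\<open>f(x\<^sub>1, y\<^sub>1; u\<^sub>1, v\<^sub>1)\<close> for \<open>f \<in> R\<close> and \<open>x\<^sub>1, y\<^sub>1, u\<^sub>1, v\<^sub>1 \<in> k[z\<^sub>0,z\<^sub>1,z\<^sub>2]\<close>.\<close>

definition bsubst ::
  "'k::field tripoly \<Rightarrow> 'k tripoly \<Rightarrow> 'k tripoly \<Rightarrow> 'k tripoly \<Rightarrow> 'k bipoly \<Rightarrow> 'k tripoly" where
  "bsubst x1 y1 u1 v1 f =
     eval_with (\<lambda>g. eval_with (\<lambda>h. eval_with (\<lambda>l. eval_with tconst l u1) h v1) g x1) f y1"

text \<open>
  The closure of the image of \<open>(f\<^sub>0 : f\<^sub>1 : f\<^sub>2)\<close> is cut out by the forms \<open>F\<close> whose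
  pullback \<open>F(f\<^sub>0,f\<^sub>1,f\<^sub>2)\<close> vanishes; the map is dominant if this closure is the whole plane.
\<close>

definition dominant_map :: "'k::field bipoly \<Rightarrow> 'k bipoly \<Rightarrow> 'k bipoly \<Rightarrow> bool" where
  "dominant_map f0 f1 f2 \<longleftrightarrow>
     (\<forall>e F. homogeneous e F \<and> tsubst f0 f1 f2 F = 0 \<longrightarrow> F = 0)"

text \<open>
  Two tuples of homogeneous coordinates over a domain define the same point over its fraction
  field (in particular, neither tuple vanishes identically).
\<close>

definition same_proj :: "'r::idom list \<Rightarrow> 'r list \<Rightarrow> bool" where
  "same_proj rs ss \<longleftrightarrow>
     length rs = length ss \<and> (\<exists>r\<in>set rs. r \<noteq> 0) \<and> (\<exists>s\<in>set ss. s \<noteq> 0) \<and>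
     (\<forall>i<length rs. \<forall>j<length rs. rs ! i * ss ! j = rs ! j * ss ! i)"

text \<open>
  \<open>\<phi> = (f\<^sub>0 : f\<^sub>1 : f\<^sub>2)\<close> is birational if it has an inverse rational map
  \<open>\<psi> = ((p\<^sub>0 : p\<^sub>1), (q\<^sub>0 : q\<^sub>1))\<close> defined over \<open>k\<close>: both composites are defined and equal to
  the identity as rational maps.
\<close>

definition birational_map :: "'k::field bipoly \<Rightarrow> 'k bipoly \<Rightarrow> 'k bipoly \<Rightarrow> bool" where
  "birational_map f0 f1 f2 \<longleftrightarrow>
     (\<exists>d e p0 p1 q0 q1.
        homogeneous d p0 \<and> homogeneous d p1 \<and> homogeneous e q0 \<and> homogeneous e q1 \<and>
        same_proj [tsubst f0 f1 f2 p0, tsubst f0 f1 f2 p1] [var_x, var_y] \<and>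
        same_proj [tsubst f0 f1 f2 q0, tsubst f0 f1 f2 q1] [var_u, var_v] \<and>
        same_proj [bsubst p0 p1 q0 q1 f0, bsubst p0 p1 q0 q1 f1, bsubst p0 p1 q0 q1 f2]
          [var_z0, var_z1, var_z2])"

definition ideal3 :: "'k::field bipoly \<Rightarrow> 'k bipoly \<Rightarrow> 'k bipoly \<Rightarrow> 'k bipoly set" where
  "ideal3 f0 f1 f2 = {g0 * f0 + g1 * f1 + g2 * f2 | g0 g1 g2. True}"

definition scale3 ::
  "'k::field \<Rightarrow> 'k bipoly \<times> 'k bipoly \<times> 'k bipoly \<Rightarrow> 'k bipoly \<times> 'k bipoly \<times> 'k bipoly" where
  "scale3 c = (\<lambda>(g0, g1, g2). (bconst c * g0, bconst c * g1, bconst c * g2))"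

definition syz ::
  "'k::field bipoly \<Rightarrow> 'k bipoly \<Rightarrow> 'k bipoly \<Rightarrow> ('k bipoly \<times> 'k bipoly \<times> 'k bipoly) set" where
  "syz f0 f1 f2 = {(g0, g1, g2). g0 * f0 + g1 * f1 + g2 * f2 = 0}"

definition syz_part :: "'k::field bipoly \<Rightarrow> 'k bipoly \<Rightarrow> 'k bipoly \<Rightarrow> nat \<Rightarrow> nat
    \<Rightarrow> ('k bipoly \<times> 'k bipoly \<times> 'k bipoly) set" where
  "syz_part f0 f1 f2 p q =
     {(g0, g1, g2) \<in> syz f0 f1 f2.
        bihomogeneous p q g0 \<and> bihomogeneous p q g1 \<and> bihomogeneous p q g2}"

definition syz_dim :: "'k::field bipoly \<Rightarrow> 'k bipoly \<Rightarrow> 'k bipoly \<Rightarrow> nat \<Rightarrow> nat \<Rightarrow> nat" where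
  "syz_dim f0 f1 f2 p q = vector_space.dim scale3 (syz_part f0 f1 f2 p q)"

text \<open>\<open>S\<^sup>-\<^sup>1 M\<close> for an ideal \<open>M\<close> of \<open>R\<close> and a multiplicative set \<open>S\<close> with \<open>0 \<notin> S\<close>.\<close>

definition localize :: "'k::field bipoly set \<Rightarrow> 'k bipoly set \<Rightarrow> 'k bipoly fract set" where
  "localize S M = {Fract a s | a s. a \<in> M \<and> s \<in> S}"

definition prime_ideal :: "'k::field bipoly set \<Rightarrow> bool" where
  "prime_ideal P \<longleftrightarrow>
     0 \<in> P \<and> (\<forall>a\<in>P. \<forall>b\<in>P. a + b \<in> P) \<and> (\<forall>a\<in>P. \<forall>r. r * a \<in> P) \<and>
     1 \<notin> P \<and> (\<forall>a b. a * b \<in> P \<longrightarrow> a \<in> P \<or> b \<in> P)"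

text \<open>
  Points of the base scheme, as bihomogeneous primes of \<open>R\<close> containing \<open>I\<close> and containing
  neither of the irrelevant ideals \<open>(x,y)\<close> and \<open>(u,v)\<close>.
\<close>

definition base_point ::
  "'k::field bipoly \<Rightarrow> 'k bipoly \<Rightarrow> 'k bipoly \<Rightarrow> 'k bipoly set \<Rightarrow> bool" where
  "base_point f0 f1 f2 P \<longleftrightarrow>
     prime_ideal P \<and> (\<forall>f\<in>P. \<forall>p q. bicomponent p q f \<in> P) \<and>
     ideal3 f0 f1 f2 \<subseteq> P \<and> \<not> {var_x, var_y} \<subseteq> P \<and> \<not> {var_u, var_v} \<subseteq> P"

definition generically_ci :: "'k::field bipoly \<Rightarrow> 'k bipoly \<Rightarrow> 'k bipoly \<Rightarrow> bool" where
  "generically_ci f0 f1 f2 \<longleftrightarrow>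
     (\<forall>P. base_point f0 f1 f2 P \<longrightarrow>
        (\<exists>g h. g \<in> localize (- P) UNIV \<and> h \<in> localize (- P) UNIV \<and>
           localize (- P) (ideal3 f0 f1 f2) =
             {r * g + s * h | r s. r \<in> localize (- P) UNIV \<and> s \<in> localize (- P) UNIV}))"

text \<open>
  \<open>B\<close> is a set of vectors of \<open>V\<close> whose classes form a basis of the quotient space \<open>V / W\<close>.
\<close>

definition quotient_basis ::
  "('k::field \<Rightarrow> 'v::ab_group_add \<Rightarrow> 'v) \<Rightarrow> 'v set \<Rightarrow> 'v set \<Rightarrow> 'v set \<Rightarrow> bool" where
  "quotient_basis scale V W B \<longleftrightarrow>
     B \<subseteq> V \<and> \<not> module.dependent scale B \<and> module.span scale B \<inter> W = {0} \<and>
     V = {b + w | b w. b \<in> module.span scale B \<and> w \<in> W}"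

text \<open>
  The dimension of \<open>V / W\<close> for subspaces \<open>W \<subseteq> V\<close>; like the library's \<open>dim\<close>, it is \<open>0\<close> if the
  dimension is infinite.
\<close>

definition quotient_dim ::
  "('k::field \<Rightarrow> 'v::ab_group_add \<Rightarrow> 'v) \<Rightarrow> 'v set \<Rightarrow> 'v set \<Rightarrow> nat" where
  "quotient_dim scale V W = card (SOME B. quotient_basis scale V W B)"

text \<open>
  The product of two projective lines is covered by the four affine charts on which
  \<open>xu\<close>, \<open>xv\<close>, \<open>yu\<close> and \<open>yv\<close> do not vanish.
\<close>

definition chart :: "bool \<times> bool \<Rightarrow> 'k::field bipoly" where
  "chart = (\<lambda>(i, j). (if i then var_y else var_x) * (if j then var_v else var_u))"

text \<open>The part of bidegree \<open>(0,0)\<close> of \<open>M\<^sub>c\<close>, for an ideal \<open>M\<close> and a bihomogeneous \<open>c \<noteq> 0\<close>.\<close>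

definition deg0_loc :: "'k::field bipoly \<Rightarrow> 'k bipoly set \<Rightarrow> 'k bipoly fract set" where
  "deg0_loc c M =
     {Fract a (c ^ n) | a n. a \<in> M \<and> (\<exists>p q. bihomogeneous p q a \<and> bihomogeneous p q (c ^ n))}"

text \<open>
  On the chart of \<open>c\<close>, the base scheme \<open>B\<close> is the spectrum of
  \<open>((R/I)\<^sub>c)\<^sub>0 = (R\<^sub>c)\<^sub>0 / (I\<^sub>c)\<^sub>0\<close>. So \<open>H\<^sup>0(B, O\<^sub>B)\<close> is the space of tuples of elements of
  \<open>(R\<^sub>c)\<^sub>0\<close>, one for each chart, which agree modulo the ideal on overlaps
  (\<open>base_sections\<close>), modulo those tuples which lie in the ideal on every chart
  (\<open>base_null_sections\<close>).
\<close>

definition base_sections ::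
  "'k::field bipoly \<Rightarrow> 'k bipoly \<Rightarrow> 'k bipoly \<Rightarrow> (bool \<times> bool \<Rightarrow> 'k bipoly fract) set" where
  "base_sections f0 f1 f2 =
     {s. (\<forall>i. s i \<in> deg0_loc (chart i) UNIV) \<and>
         (\<forall>i j. s i - s j \<in> deg0_loc (chart i * chart j) (ideal3 f0 f1 f2))}"

definition base_null_sections ::
  "'k::field bipoly \<Rightarrow> 'k bipoly \<Rightarrow> 'k bipoly \<Rightarrow> (bool \<times> bool \<Rightarrow> 'k bipoly fract) set" where
  "base_null_sections f0 f1 f2 = {s. \<forall>i. s i \<in> deg0_loc (chart i) (ideal3 f0 f1 f2)}"

definition section_scale ::
  "'k::field \<Rightarrow> (bool \<times> bool \<Rightarrow> 'k bipoly fract) \<Rightarrow> (bool \<times> bool \<Rightarrow> 'k bipoly fract)" where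
  "section_scale c s = (\<lambda>i. Fract (bconst c) 1 * s i)"

definition base_degree :: "'k::field bipoly \<Rightarrow> 'k bipoly \<Rightarrow> 'k bipoly \<Rightarrow> nat" where
  "base_degree f0 f1 f2 =
     quotient_dim section_scale (base_sections f0 f1 f2) (base_null_sections f0 f1 f2)"

lemma bconst_add: "bconst (a + b) = bconst a + bconst b"
  by (simp add: bconst_def)

lemma bconst_mult: "bconst (a * b) = bconst a * bconst b"
  by (simp add: bconst_def)

lemma bconst_1: "bconst 1 = 1"
  by (simp add: bconst_def one_pCons)

lemma vector_space_scale3: "vector_space scale3"
  by unfold_locales
    (auto simp: scale3_def bconst_add bconst_mult bconst_1 algebra_simps split: prod.splits)

lemma vector_space_section_scale:
  "vector_space (section_scale :: 'k::field \<Rightarrow> _)"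
proof
  fix a b :: 'k and s t :: "bool \<times> bool \<Rightarrow> 'k bipoly fract"
  show "section_scale a (s + t) = section_scale a s + section_scale a t"
    by (rule ext) (simp add: section_scale_def algebra_simps)
  have "Fract (bconst (a + b)) 1 = Fract (bconst a) 1 + Fract (bconst b) 1"
    by (simp add: bconst_add)
  then show "section_scale (a + b) s = section_scale a s + section_scale b s"
    by (intro ext) (simp only: section_scale_def plus_fun_apply distrib_right)
  have "Fract (bconst (a * b)) 1 = Fract (bconst a) 1 * Fract (bconst b) 1"
    by (simp add: bconst_mult)
  then show "section_scale a (section_scale b s) = section_scale (a * b) s"
    by (intro ext) (simp only: section_scale_def mult.assoc)
  show "section_scale 1 s = s"
    by (rule ext) (simp add: section_scale_def bconst_1 flip: One_fract_def)
qed

end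

theory Submission imports Defs begin

text \<open>
  Write \<open>f = x a + y b\<close> with vectors \<open>a, b\<close> of binary quadrics in \<open>u, v\<close>, and \<open>a \<times> b = D g\<close> with \<open>g\<close>
  primitive of degree \<open>m\<close>, so that \<open>deg D = 4 - m\<close>. All four conditions say \<open>m = 1\<close>.

  The syzygies of bidegree \<open>(0,q)\<close> are the multiples of \<open>g\<close>. The map from the base scheme to the
  second line identifies it with the zero scheme of \<open>D\<close>: the absence of a common factor makes the
  matrix \<open>(a, b)\<close> of rank exactly one modulo \<open>D\<close>, and so the base scheme is a local complete
  intersection of degree \<open>4 - m\<close>. Restriction to the base scheme and pairing with \<open>w\<close>, where
  \<open>w \<bullet> g = 1\<close>, also identifies the syzygies of bidegree \<open>(1,1)\<close> with the functions on it.

  The fibre over \<open>(u : v)\<close> is mapped to the line \<open>g(u, v) \<bullet> z = 0\<close>. If \<open>m = 1\<close>, this equation can be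
  solved for \<open>(u : v)\<close>, and Cramer's rule gives \<open>(x : y)\<close>. Conversely let \<open>(q\<^sub>0 : q\<^sub>1)\<close> be the second
  component of an inverse. For a fixed point \<open>z\<close> the vector \<open>z - (g \<bullet> z) w\<close> lies on the line, so
  \<open>q\<^sub>0(z) v - q\<^sub>1(z) u\<close> vanishes modulo \<open>g \<bullet> z\<close>, which therefore has degree at most one.
\<close>

section \<open>Ring homomorphisms and bihomogeneous elements\<close>

text \<open>Since \<open>k\<close> need not be algebraically closed, points of the base scheme give
  way to polynomial identities: primitive always means a Bezout identity over \<open>k[t]\<close>,
  such as \<open>dot3 w g = 1\<close>, which survives substitution, reduction modulo
  \<open>D\<close> and, up to a power of \<open>lam\<close>, homogenization. The price of working
  over \<open>k[t]\<close> is the point \<open>lam = 0\<close>. Coordinates are chosen so that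
  \<open>a \<times> b\<close> does not vanish there: then no zero of \<open>D\<close> is lost, the
  degrees of \<open>D\<close> and \<open>g\<close> in t add up to exactly 4 = 2 + 2, and
  coefficients at the degree bound, being values at \<open>lam = 0\<close>, replace arguments at
  infinity. Memberships in the ideal proved up to powers of \<open>lam\<close> extend over
  \<open>lam = 0\<close>, where \<open>D\<close> and some constant combination of the entries of
  \<open>g\<close> are nonzero. A second choice, of \<xi>, keeps the base scheme away from the point
  (\<xi> : 1) of the first line, so that it is the graph of one polynomial point (\<open>X\<close> :
  \<open>Y\<close>) over the zeros of \<open>D\<close>. The infinite field supplies both choices,
  and also the point \<open>z\<close> of the converse direction.\<close>

definition rhom :: "('a::comm_ring_1 \<Rightarrow> 'b::comm_ring_1) \<Rightarrow> bool" where
  "rhom h \<longleftrightarrow> h 0 = 0 \<and> h 1 = 1 \<and> (\<forall>a b. h (a + b) = h a + h b) \<and> (\<forall>a b. h (a * b) = h a * h b)"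

lemma rhomD:
  assumes "rhom h"
  shows "h 0 = 0" "h 1 = 1" "h (a + b) = h a + h b" "h (a * b) = h a * h b"
    "h (- a) = - h a" "h (a - b) = h a - h b" "h (a ^ n) = h a ^ n" "h (sum F S) = (\<Sum>i\<in>S. h (F i))"
proof -
  show *: "h 0 = 0" "h 1 = 1" "\<And>a b. h (a + b) = h a + h b" "\<And>a b. h (a * b) = h a * h b"
    using assms by (auto simp: rhom_def)
  show **: "h (- a) = - h a" for a using *(3)[of a "- a"] *(1) by (simp add: eq_neg_iff_add_eq_0 add.commute)
  show "h (a - b) = h a - h b" using *(3)[of a "- b"] **[of b] by simp
  show "h (a ^ n) = h a ^ n" by (induction n) (auto simp: *)
  show "h (sum F S) = (\<Sum>i\<in>S. h (F i))" by (induction S rule: infinite_finite_induct) (auto simp: *)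
qed

lemma eval_with_0 [simp]: "eval_with h 0 r = 0"
  by (simp add: eval_with_def)

lemma eval_with_pCons: "h 0 = 0 \<Longrightarrow> eval_with h (pCons a p) r = h a + r * eval_with h p r"
  by (simp add: eval_with_def map_poly_pCons)

text \<open>\<open>tsubst\<close>, \<open>bsubst\<close> and all other evaluations are nests of
  \<open>eval_with\<close>, one per variable, so repeated use of this lemma makes each of them a
  ring homomorphism.\<close>

lemma rhom_eval_with:
  assumes "rhom h"
  shows "rhom (\<lambda>p. eval_with h p r)"
proof -
  note h = rhomD[OF assms] and e = eval_with_pCons[of h, OF rhomD(1)[OF assms]]
  have add: "eval_with h (p + q) r = eval_with h p r + eval_with h q r" for p q
    by (induction p q rule: poly_induct2) (auto simp: e h algebra_simps)
  have sm: "eval_with h (smult a q) r = h a * eval_with h q r" for a q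
    by (induction q) (auto simp: e h algebra_simps)
  have "eval_with h (p * q) r = eval_with h p r * eval_with h q r" for p q
  proof (induction p)
    case (pCons a p)
    have "eval_with h (pCons a p * q) r = eval_with h (smult a q + pCons 0 (p * q)) r" by simp
    also have "\<dots> = h a * eval_with h q r + r * eval_with h (p * q) r"
      unfolding add sm e h by simp
    finally show ?case by (simp add: e pCons algebra_simps)
  qed simp
  with add show ?thesis by (auto simp: rhom_def one_pCons e h)
qed

lemma eval_with_comp:
  assumes "rhom \<phi>" "h 0 = 0"
  shows "\<phi> (eval_with h p r) = eval_with (\<lambda>x. \<phi> (h x)) p (\<phi> r)"
  by (induction p) (auto simp: eval_with_pCons assms rhomD[OF assms(1)])

text \<open>The target ring and the map \<open>h\<close> on constants stay free: the same nest
  serves for substitution of ternary forms (\<open>tconst\<close>) and for restriction to a curve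
  over \<open>k[t]\<close>.\<close>

definition bev :: "('k::field \<Rightarrow> 'r::comm_ring_1) \<Rightarrow> 'r \<Rightarrow> 'r \<Rightarrow> 'r \<Rightarrow> 'r \<Rightarrow> 'k bipoly \<Rightarrow> 'r" where
  "bev h x y u v = (\<lambda>f. eval_with (\<lambda>g. eval_with (\<lambda>q. eval_with (\<lambda>l. eval_with h l u) q v) g x) f y)"

definition tev :: "('k::field \<Rightarrow> 'r::comm_ring_1) \<Rightarrow> 'r \<Rightarrow> 'r \<Rightarrow> 'r \<Rightarrow> 'k tripoly \<Rightarrow> 'r" where
  "tev h r0 r1 r2 = (\<lambda>F. eval_with (\<lambda>G. eval_with (\<lambda>H. eval_with h H r0) G r1) F r2)"

lemma tsubst_tev: "tsubst r0 r1 r2 = tev bconst r0 r1 r2"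
  by (rule ext) (simp add: tsubst_def tev_def)

lemma bsubst_bev: "bsubst x y u v = bev tconst x y u v"
  by (rule ext) (simp add: bsubst_def bev_def)

lemma rhom_bev: "rhom h \<Longrightarrow> rhom (bev h x y u v)"
  unfolding bev_def by (intro rhom_eval_with)

lemma rhom_tev: "rhom h \<Longrightarrow> rhom (tev h x y u)"
  unfolding tev_def by (intro rhom_eval_with)

lemma bev_vars:
  assumes "rhom h"
  shows "bev h x y u v (bconst c) = h c" "bev h x y u v var_x = x" "bev h x y u v var_y = y"
    "bev h x y u v var_u = u" "bev h x y u v var_v = v"
  unfolding bev_def bconst_def var_x_def var_y_def var_u_def var_v_def
  by (simp_all add: eval_with_pCons rhomD[OF assms] one_pCons)

lemma tev_vars:
  assumes "rhom h"
  shows "tev h x y u (tconst c) = h c" "tev h x y u var_z0 = x" "tev h x y u var_z1 = y"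
    "tev h x y u var_z2 = u"
  unfolding tev_def tconst_def var_z0_def var_z1_def var_z2_def
  by (simp_all add: eval_with_pCons rhomD[OF assms] one_pCons)

lemma tev_comp:
  assumes "rhom \<phi>" "rhom h"
  shows "\<phi> (tev h x y u F) = tev (\<lambda>c. \<phi> (h c)) (\<phi> x) (\<phi> y) (\<phi> u) F"
  unfolding tev_def by (simp add: eval_with_comp[OF assms(1)] rhomD(1)[OF assms(2)])

lemma rhom_bconst: "rhom bconst"
  by (simp add: rhom_def bconst_add bconst_mult bconst_1) (simp add: bconst_def)

lemma rhom_tconst: "rhom tconst"
  by (simp add: rhom_def tconst_def one_pCons)

lemma rhom_const_poly: "rhom (\<lambda>c. [:c:])"
  by (simp add: rhom_def one_pCons)

lemmas bconst_simps = rhomD[OF rhom_bconst]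

section \<open>Bihomogeneous polynomials through their coefficients\<close>

lemma bipoly_eqI: "(\<And>a b c d. bicoeff F a b c d = bicoeff G a b c d) \<Longrightarrow> F = G"
  unfolding bicoeff_def by (intro poly_eqI) blast

lemma bicoeff_add: "bicoeff (F + G) a b c d = bicoeff F a b c d + bicoeff G a b c d"
  by (simp add: bicoeff_def)

lemma bicoeff_0: "bicoeff 0 a b c d = 0"
  by (simp add: bicoeff_def)

lemma bicoeff_sum: "bicoeff (sum F S) a b c d = (\<Sum>i\<in>S. bicoeff (F i) a b c d)"
  by (induction S rule: infinite_finite_induct) (simp_all add: bicoeff_add bicoeff_0)

lemma var_eq_monom: "pCons 0 1 = monom 1 (Suc 0)"
  by (metis monom_0 monom_Suc One_nat_def one_pCons)

lemma bimonom:
  "bconst k * var_x ^ a * var_y ^ b * var_u ^ c * var_v ^ d = monom (monom (monom (monom k c) d) a) b"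
  unfolding bconst_def var_x_def var_y_def var_u_def var_v_def
  by (simp add: var_eq_monom monom_0[symmetric] monom_power mult_monom)

lemma bicoeff_bimonom:
  "bicoeff (bconst k * var_x ^ a * var_y ^ b * var_u ^ c * var_v ^ d) a' b' c' d'
    = (if a = a' \<and> b = b' \<and> c = c' \<and> d = d' then k else 0)"
  unfolding bimonom bicoeff_def by simp

lemma bihomogeneous_0: "bihomogeneous p q 0"
  by (simp add: bihomogeneous_def bicoeff_0)

lemma bihomogeneous_add: "bihomogeneous p q F \<Longrightarrow> bihomogeneous p q G \<Longrightarrow> bihomogeneous p q (F + G)"
  unfolding bihomogeneous_def bicoeff_add by (metis add_0)

lemma bihomogeneous_sum: "(\<And>i. i \<in> S \<Longrightarrow> bihomogeneous p q (F i)) \<Longrightarrow> bihomogeneous p q (sum F S)"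
  by (induction S rule: infinite_finite_induct) (auto intro: bihomogeneous_0 bihomogeneous_add)

lemma bihomogeneous_bimonom:
  "a + b = p \<Longrightarrow> c + d = q \<Longrightarrow> bihomogeneous p q (bconst k * var_x ^ a * var_y ^ b * var_u ^ c * var_v ^ d)"
  unfolding bihomogeneous_def bicoeff_bimonom by auto

lemma bihomogeneous_expand:
  assumes "bihomogeneous p q F"
  shows "F = (\<Sum>a\<le>p. \<Sum>c\<le>q. bconst (bicoeff F a (p - a) c (q - c))
        * var_x ^ a * var_y ^ (p - a) * var_u ^ c * var_v ^ (q - c))" (is "_ = ?G")
proof (rule bipoly_eqI)
  fix a b c d
  have "bicoeff ?G a b c d = (\<Sum>a'\<le>p. \<Sum>c'\<le>q. if a' = a \<and> p - a' = b \<and> c' = c \<and> q - c' = d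
      then bicoeff F a' (p - a') c' (q - c') else 0)"
    by (simp add: bicoeff_sum bicoeff_bimonom)
  also have "\<dots> = (\<Sum>a'\<le>p. \<Sum>c'\<le>q. if c' = c then if a' = a then if a + b = p \<and> c + d = q
      then bicoeff F a b c d else 0 else 0 else 0)"
    by (intro sum.cong refl) auto
  also have "\<dots> = bicoeff F a b c d"
    using assms by (cases "a + b = p \<and> c + d = q") (auto simp: bihomogeneous_def cong: if_cong)
  finally show "bicoeff F a b c d = bicoeff ?G a b c d" by simp
qed

lemma bihomogeneous_mult:
  assumes "bihomogeneous p q F" "bihomogeneous p' q' G"
  shows "bihomogeneous (p + p') (q + q') (F * G)"
proof -
  have *: "(bconst k * var_x ^ a * var_y ^ b * var_u ^ c * var_v ^ d) *
    (bconst k' * var_x ^ a' * var_y ^ b' * var_u ^ c' * var_v ^ d') =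
    bconst (k * k') * var_x ^ (a + a') * var_y ^ (b + b') * var_u ^ (c + c') * var_v ^ (d + d')"
    for k k' :: 'a and a b c d a' b' c' d'
    by (simp add: bconst_mult power_add algebra_simps)
  show ?thesis
    by (subst bihomogeneous_expand[OF assms(1)], subst bihomogeneous_expand[OF assms(2)])
      (auto simp: sum_product * intro!: bihomogeneous_sum bihomogeneous_bimonom)
qed

lemma bihomogeneous_basic:
  "bihomogeneous 0 0 (bconst k)" "bihomogeneous 0 0 1" "bihomogeneous 1 0 var_x" "bihomogeneous 1 0 var_y"
  "bihomogeneous 0 1 var_u" "bihomogeneous 0 1 var_v"
  using bihomogeneous_bimonom[of 0 0 0 0 0 0 k] bihomogeneous_bimonom[of 0 0 0 0 0 0 1]
    bihomogeneous_bimonom[of 1 0 1 0 0 0 1] bihomogeneous_bimonom[of 0 1 1 0 0 0 1]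
    bihomogeneous_bimonom[of 0 0 0 1 0 1 1] bihomogeneous_bimonom[of 0 0 0 0 1 1 1]
  by (simp_all add: bconst_1)

lemma bihomogeneous_power: "bihomogeneous p q F \<Longrightarrow> bihomogeneous (n * p) (n * q) (F ^ n)"
  by (induction n) (auto simp: bihomogeneous_basic intro: bihomogeneous_mult)

lemma bihomogeneous_const_mult: "bihomogeneous p q F \<Longrightarrow> bihomogeneous p q (bconst k * F)"
  using bihomogeneous_mult[OF bihomogeneous_basic(1)] by fastforce

lemma bihomogeneous_diff: "bihomogeneous p q F \<Longrightarrow> bihomogeneous p q G \<Longrightarrow> bihomogeneous p q (F - G)"
  using bihomogeneous_add[of p q F "bconst (-1) * G"] bihomogeneous_const_mult[of p q G "-1"]
  by (simp add: bconst_simps)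

lemma bihomogeneous_eq:
  assumes "bihomogeneous p q F" "bihomogeneous p' q' F" "F \<noteq> 0"
  shows "p = p' \<and> q = q'"
proof -
  obtain a b c d where "bicoeff F a b c d \<noteq> 0"
    using assms(3) bipoly_eqI[of F 0] by (auto simp: bicoeff_0)
  then show ?thesis using assms by (auto simp: bihomogeneous_def)
qed

lemma var_nz [simp]: "var_x \<noteq> 0" "var_y \<noteq> 0" "var_u \<noteq> 0" "var_v \<noteq> 0"
  by (simp_all add: var_x_def var_y_def var_u_def var_v_def)

section \<open>Vectors and binary forms\<close>

type_synonym 'a v3 = "'a \<times> 'a \<times> 'a"

definition dot3 :: "'a::comm_ring_1 v3 \<Rightarrow> 'a v3 \<Rightarrow> 'a" where
  "dot3 = (\<lambda>(a0, a1, a2) (b0, b1, b2). a0 * b0 + a1 * b1 + a2 * b2)"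

definition cross3 :: "'a::comm_ring_1 v3 \<Rightarrow> 'a v3 \<Rightarrow> 'a v3" where
  "cross3 = (\<lambda>(a0, a1, a2) (b0, b1, b2). (a1 * b2 - a2 * b1, a2 * b0 - a0 * b2, a0 * b1 - a1 * b0))"

definition smul3 :: "'a::comm_ring_1 \<Rightarrow> 'a v3 \<Rightarrow> 'a v3" where
  "smul3 c = (\<lambda>(a0, a1, a2). (c * a0, c * a1, c * a2))"

definition map3 :: "('a \<Rightarrow> 'b) \<Rightarrow> 'a v3 \<Rightarrow> 'b v3" where
  "map3 h = (\<lambda>(a0, a1, a2). (h a0, h a1, h a2))"

definition all3 :: "('a \<Rightarrow> bool) \<Rightarrow> 'a v3 \<Rightarrow> bool" where
  "all3 P = (\<lambda>(a0, a1, a2). P a0 \<and> P a1 \<and> P a2)"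

lemmas v3_defs = dot3_def cross3_def smul3_def map3_def all3_def

lemma dot3_commute: "dot3 a b = dot3 b a"
  by (cases a; cases b) (simp add: v3_defs algebra_simps)

lemma dot3_linear:
  "dot3 a (b + c) = dot3 a b + dot3 a c" "dot3 (b + c) a = dot3 b a + dot3 c a"
  "dot3 a (b - c) = dot3 a b - dot3 a c" "dot3 (b - c) a = dot3 b a - dot3 c a"
  "dot3 a (smul3 s b) = s * dot3 a b" "dot3 (smul3 s b) a = s * dot3 b a"
  "dot3 a (- b) = - dot3 a b" "dot3 (- b) a = - dot3 b a"
  "dot3 a 0 = 0" "dot3 0 a = 0"
  by (cases a; cases b; cases c; simp add: v3_defs algebra_simps zero_prod_def)+

lemma cross3_linear:
  "cross3 a (b + c) = cross3 a b + cross3 a c" "cross3 (b + c) a = cross3 b a + cross3 c a"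
  "cross3 a (b - c) = cross3 a b - cross3 a c" "cross3 (b - c) a = cross3 b a - cross3 c a"
  "cross3 a (smul3 s b) = smul3 s (cross3 a b)" "cross3 (smul3 s b) a = smul3 s (cross3 b a)"
  "cross3 a (- b) = - cross3 a b" "cross3 (- b) a = - cross3 b a"
  "cross3 a 0 = 0" "cross3 0 a = 0"
  by (cases a; cases b; cases c; simp add: v3_defs algebra_simps zero_prod_def)+

lemma smul3_linear:
  "smul3 s (b + c) = smul3 s b + smul3 s c" "smul3 (s + t) b = smul3 s b + smul3 t b"
  "smul3 s (b - c) = smul3 s b - smul3 s c" "smul3 (s - t) b = smul3 s b - smul3 t b"
  "smul3 s (smul3 t b) = smul3 (s * t) b" "smul3 1 b = b" "smul3 s 0 = 0" "smul3 0 b = 0"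
  "smul3 s (- b) = - smul3 s b" "smul3 (- s) b = - smul3 s b"
  by (cases b; cases c; simp add: v3_defs algebra_simps zero_prod_def)+

lemma cross3_self: "cross3 a a = 0"
  by (cases a) (simp add: v3_defs algebra_simps zero_prod_def)

lemma cross3_anti: "cross3 b a = - cross3 a b"
  by (cases a; cases b) (simp add: v3_defs algebra_simps)

lemma dot3_cross3:
  "dot3 a (cross3 a b) = 0" "dot3 b (cross3 a b) = 0"
  by (cases a; cases b; simp add: v3_defs algebra_simps)+

lemma dot3_cross3_cyc: "dot3 a (cross3 b c) = dot3 b (cross3 c a)"
  by (cases a; cases b; cases c) (simp add: v3_defs algebra_simps)

lemma cross3_cross3: "cross3 a (cross3 b c) = smul3 (dot3 a c) b - smul3 (dot3 a b) c"
  by (cases a; cases b; cases c) (simp add: v3_defs algebra_simps)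

text \<open>Cramer's rule for the triple \<open>a\<close>, \<open>b\<close>, \<open>n\<close>. If
  \<open>z\<close> is orthogonal to \<open>a \<times> b\<close>, the last term vanishes and the two
  remaining determinants are the coordinates (x : y) of a preimage of \<open>z\<close> under x a + y
  b.\<close>

lemma cramer3:
  "smul3 (dot3 n (cross3 a b)) z = smul3 (dot3 n (cross3 z b)) a + smul3 (dot3 n (cross3 a z)) b
     + smul3 (dot3 z (cross3 a b)) n"
  by (cases a; cases b; cases n; cases z) (simp add: v3_defs algebra_simps)

lemma smul3_eq_0_iff: "smul3 s (a :: 'a::idom v3) = 0 \<longleftrightarrow> s = 0 \<or> a = 0"
  by (cases a) (auto simp: v3_defs zero_prod_def)

lemma smul3_cancel: "smul3 s (a :: 'a::idom v3) = smul3 s b \<longleftrightarrow> s = 0 \<or> a = b"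
  using smul3_eq_0_iff[of s "a - b"] by (simp add: smul3_linear)

lemma map3_rhom:
  assumes "rhom h"
  shows "dot3 (map3 h a) (map3 h b) = h (dot3 a b)" "cross3 (map3 h a) (map3 h b) = map3 h (cross3 a b)"
    "smul3 (h s) (map3 h b) = map3 h (smul3 s b)" "map3 h (a + b) = map3 h a + map3 h b"
    "map3 h (a - b) = map3 h a - map3 h b" "map3 h 0 = 0"
  by (cases a; cases b; simp add: v3_defs rhomD[OF assms] zero_prod_def)+

text \<open>The witness is a coordinate vector, hence constant: \<open>inverse_exists\<close>
  transports it to every ring involved.\<close>

lemma dot3_nonzero: "a \<noteq> 0 \<Longrightarrow> \<exists>n \<in> {(1,0,0), (0,1,0), (0,0,1)}. dot3 n a \<noteq> 0"
  by (cases a) (auto simp: v3_defs zero_prod_def)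

lemma map3_compose: "map3 f (map3 g a) = map3 (\<lambda>x. f (g x)) a"
  by (cases a) (simp add: map3_def)

lemma map3_id: "map3 (\<lambda>x. x) a = a"
  by (cases a) (simp add: map3_def)

lemma all3_mono: "all3 P a \<Longrightarrow> (\<And>x. P x \<Longrightarrow> Q x) \<Longrightarrow> all3 Q a"
  by (cases a) (simp add: all3_def)

section \<open>Bezout identities over k[t]\<close>

lemma bezout_poly: "\<exists>a b. a * p + b * q dvd p \<and> a * p + b * q dvd (q :: 'k::field poly)"
\<comment> \<open>Euclid's algorithm. \<open>Suc\<close> in the measure separates a nonzero
  constant, also of degree 0, from the remainder 0.\<close>
proof (induction "if q = 0 then 0 else Suc (degree q)" arbitrary: p q rule: less_induct)
  case less
  show ?case
  proof (cases "q = 0")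
    case True
    then show ?thesis by (intro exI[of _ 1] exI[of _ 0]) simp
  next
    case False
    have "p mod q = 0 \<or> degree (p mod q) < degree q" using False degree_mod_less by blast
    then have "(if p mod q = 0 then 0 else Suc (degree (p mod q))) < (if q = 0 then 0 else Suc (degree q))"
      using False by auto
    from less[OF this] obtain a b where ab: "a * q + b * (p mod q) dvd q" "a * q + b * (p mod q) dvd p mod q"
      by blast
    have "a * q + b * (p mod q) = b * p + (a - b * (p div q)) * q"
      by (simp add: algebra_simps minus_div_mult_eq_mod[symmetric])
    moreover have "a * q + b * (p mod q) dvd p"
      using ab by (metis dvd_mod_iff mod_mod_trivial dvd_mod_imp_dvd)
    ultimately show ?thesis using ab by metis
  qed
qed

text \<open>\<open>dot3 w a\<close> is a greatest common divisor of the entries and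
  \<open>a'\<close> the cofactor; in this form \<open>a = 0\<close> is no exception.\<close>

lemma bezout3: "\<exists>w a'. a = smul3 (dot3 w a) (a' :: 'k::field poly v3)"
proof -
  obtain a0 a1 a2 where a: "a = (a0, a1, a2)" by (cases a)
  obtain s t where 1: "s * a0 + t * a1 dvd a0" "s * a0 + t * a1 dvd a1" using bezout_poly by blast
  obtain s' t' where 2: "s' * (s * a0 + t * a1) + t' * a2 dvd s * a0 + t * a1"
    "s' * (s * a0 + t * a1) + t' * a2 dvd a2" using bezout_poly by blast
  define d where "d = dot3 (s' * s, s' * t, t') a"
  have d: "d = s' * (s * a0 + t * a1) + t' * a2" by (simp add: d_def a dot3_def algebra_simps)
  have "d dvd a0" "d dvd a1" "d dvd a2" using 1 2 dvd_trans unfolding d by blast+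
  then obtain b0 b1 b2 where "a0 = d * b0" "a1 = d * b1" "a2 = d * b2" by (auto elim!: dvdE)
  then have "a = smul3 d (b0, b1, b2)" by (simp add: a smul3_def)
  then show ?thesis unfolding d_def by blast
qed

text \<open>Cancelling the divisor from the Bezout identity gives \<open>dot3 w a' = 1\<close>, the
  usable form of primitivity: a vector \<open>v\<close> parallel to \<open>a'\<close> is then the
  multiple of \<open>a'\<close> by \<open>dot3 w v\<close>.\<close>

lemma bezout3_primitive:
  assumes "a \<noteq> (0 :: 'k::field poly v3)"
  obtains d w a' where "a = smul3 d a'" "dot3 w a' = 1" "d = dot3 w a" "d \<noteq> 0"
proof -
  obtain w a' where *: "a = smul3 (dot3 w a) a'" using bezout3 by blast
  have nz: "dot3 w a \<noteq> 0" using assms by (subst (asm) *) (auto simp: smul3_linear)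
  have "dot3 w a * dot3 w a' = dot3 w a" by (subst (2) *) (simp add: dot3_linear)
  then have "dot3 w a' = 1" using nz by simp
  with * nz that show ?thesis by blast
qed

section \<open>Degree bounds and coefficients at the bound\<close>

definition vdeg :: "nat \<Rightarrow> 'k::field poly v3 \<Rightarrow> bool" where
  "vdeg n = all3 (\<lambda>p. degree p \<le> n)"

lemma degree_mult_bound: "degree p \<le> n \<Longrightarrow> degree q \<le> m \<Longrightarrow> degree (p * q :: 'k::field poly) \<le> n + m"
  using degree_mult_le order_trans add_mono by meson

lemma vdeg_smul3: "vdeg n a \<Longrightarrow> degree s \<le> m \<Longrightarrow> vdeg (m + n) (smul3 s a)"
  by (cases a) (auto simp: v3_defs vdeg_def intro!: degree_mult_bound)

lemma vdeg_cross3: "vdeg n a \<Longrightarrow> vdeg m b \<Longrightarrow> vdeg (n + m) (cross3 a b)"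
  by (cases a; cases b) (auto simp: v3_defs vdeg_def intro!: degree_mult_bound degree_diff_le)

lemma degree_dot3: "vdeg n a \<Longrightarrow> vdeg m b \<Longrightarrow> degree (dot3 a b) \<le> n + m"
  by (cases a; cases b) (auto simp: v3_defs vdeg_def intro!: degree_mult_bound degree_add_le)

lemma vdeg_mono: "vdeg n a \<Longrightarrow> n \<le> m \<Longrightarrow> vdeg m a"
  unfolding vdeg_def by (erule all3_mono) simp

lemma vdeg_exists: "\<exists>n. vdeg n a"
  by (cases a) (auto simp: vdeg_def all3_def intro: exI[of _ "degree _ + degree _ + degree _"]
      dest: order.trans intro!: exI[of _ "degree (fst a) + degree (fst (snd a)) + degree (snd (snd a))"])

lemma degree_le_coeff: "degree p \<le> Suc k \<Longrightarrow> coeff p (Suc k) = 0 \<Longrightarrow> degree p \<le> k"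
  by (metis coeff_eq_0 degree_le le_Suc_eq leading_coeff_0_iff degree_0 zero_le less_le_not_le not_less_eq_eq)

lemma vdeg_exact:
  assumes "v \<noteq> 0"
  obtains k where "vdeg k v" "map3 (\<lambda>p. coeff p k) v \<noteq> 0"
proof -
  define k where "k = (LEAST k. vdeg k v)"
  have k: "vdeg k v" unfolding k_def using vdeg_exists by (rule LeastI_ex)
  have "map3 (\<lambda>p. coeff p k) v \<noteq> 0"
  proof
    assume 0: "map3 (\<lambda>p. coeff p k) v = 0"
    show False
    proof (cases k)
      case 0
      then show ?thesis using k assms \<open>map3 _ v = 0\<close>
        by (cases v) (auto simp: vdeg_def v3_defs zero_prod_def elim!: degree_eq_zeroE)
    next
      case (Suc k')
      then have "vdeg k' v" using k 0
        by (cases v) (auto simp: vdeg_def v3_defs zero_prod_def intro: degree_le_coeff)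
      then have "k \<le> k'" unfolding k_def by (rule Least_le)
      then show ?thesis using Suc by simp
    qed
  qed
  with k that show ?thesis by blast
qed

text \<open>With bounds in place of degrees, the coefficient at the bound is the value of the
  homogenized form at \<open>lam = 0\<close>, and values are multiplicative even where they
  vanish.\<close>

lemma coeff_mult_bound:
  assumes "degree p \<le> n" "degree q \<le> m"
  shows "coeff (p * q) (n + m) = coeff p n * coeff (q :: 'k::field poly) m"
proof (cases "degree p = n \<and> degree q = m")
  case True
  then show ?thesis using coeff_mult_degree_sum[of p q] by auto
next
  case False
  then have "degree p + degree q < n + m" using assms by linarith
  then have "coeff (p * q) (n + m) = 0" using degree_mult_le[of p q] by (intro coeff_eq_0) linarith
  moreover have "coeff p n = 0 \<or> coeff q m = 0" using False assms by (auto intro: coeff_eq_0)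
  ultimately show ?thesis by auto
qed

lemma cross3_top:
  assumes "vdeg n a" "vdeg m b"
  shows "map3 (\<lambda>p. coeff p (n + m)) (cross3 a b) = cross3 (map3 (\<lambda>p. coeff p n) a) (map3 (\<lambda>p. coeff p m) b)"
  using assms by (cases a; cases b) (auto simp: v3_defs vdeg_def coeff_mult_bound)

lemma smul3_top:
  assumes "degree s \<le> n" "vdeg m b"
  shows "map3 (\<lambda>p. coeff p (n + m)) (smul3 s b) = smul3 (coeff s n) (map3 (\<lambda>p. coeff p m) b)"
  using assms by (cases b) (auto simp: v3_defs vdeg_def coeff_mult_bound)

lemma dot3_top:
  assumes "vdeg n a" "vdeg m b"
  shows "coeff (dot3 a b) (n + m) = dot3 (map3 (\<lambda>p. coeff p n) a) (map3 (\<lambda>p. coeff p m) b)"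
  using assms by (cases a; cases b) (auto simp: v3_defs vdeg_def coeff_mult_bound)

lemma degree_cancel:
  assumes "degree (s * v) \<le> n" "s \<noteq> (0 :: 'k::field poly)"
  shows "degree v \<le> n - degree s"
  using assms by (cases "v = 0") (auto simp: degree_mult_eq)

lemma vdeg_cancel:
  assumes "vdeg n (smul3 s v)" "s \<noteq> 0"
  shows "v \<noteq> 0 \<Longrightarrow> degree s \<le> n" "vdeg (n - degree s) v"
proof -
  obtain v0 v1 v2 where v: "v = (v0, v1, v2)" by (cases v)
  have *: "degree (s * v0) \<le> n" "degree (s * v1) \<le> n" "degree (s * v2) \<le> n"
    using assms(1) by (auto simp: v vdeg_def v3_defs)
  then show "vdeg (n - degree s) v"
    using assms(2) by (auto simp: v vdeg_def v3_defs intro: degree_cancel)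
  assume "v \<noteq> 0"
  then consider "v0 \<noteq> 0" | "v1 \<noteq> 0" | "v2 \<noteq> 0" by (auto simp: v zero_prod_def)
  then show "degree s \<le> n" using * assms(2) by cases (auto simp: degree_mult_eq)
qed

text \<open>
  Linear forms \<open>mu, lam\<close> with \<open>u = \<alpha> mu + \<beta> lam\<close> and \<open>v = \<gamma> mu + \<delta> lam\<close>. Dehomogenizing at
  \<open>lam = 1\<close> with affine coordinate \<open>t = mu\<close> turns \<open>u, v\<close> into the polynomials \<open>U, V\<close>; the inverse
  operation is \<open>hmg n\<close>, which is meaningful only for polynomials of degree at most \<open>n\<close>.
\<close>

locale coords =
  fixes \<alpha> \<beta> \<gamma> \<delta> :: "'k::field"
  assumes det: "\<alpha> * \<delta> - \<beta> * \<gamma> = 1"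
begin

definition mu :: "'k bipoly" where "mu = bconst \<delta> * var_u - bconst \<beta> * var_v"
definition lam :: "'k bipoly" where "lam = bconst \<alpha> * var_v - bconst \<gamma> * var_u"
definition U :: "'k poly" where "U = [:\<beta>, \<alpha>:]"
definition V :: "'k poly" where "V = [:\<delta>, \<gamma>:]"

definition hmg :: "nat \<Rightarrow> 'k poly \<Rightarrow> 'k bipoly" where
  "hmg n P = (\<Sum>i\<le>n. bconst (coeff P i) * mu ^ i * lam ^ (n - i))"

text \<open>Restriction to the curve ((\<open>X\<close> : \<open>Y\<close>), (\<open>U\<close> :
  \<open>V\<close>)) over \<open>k[t]\<close>. The constant pairs 1, 0 and 0, 1 read off the two
  coefficient vectors of a form of degree 1 in x, y; a pair that solves the base equations modulo
  \<open>D\<close> restricts to the base scheme.\<close>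

definition ev :: "'k poly \<Rightarrow> 'k poly \<Rightarrow> 'k bipoly \<Rightarrow> 'k poly" where
  "ev X Y = bev (\<lambda>c. [:c:]) X Y U V"

lemma rhom_ev: "rhom (ev X Y)"
  unfolding ev_def by (intro rhom_bev rhom_const_poly)

lemmas ev_simps = rhomD[OF rhom_ev]

lemma ev_vars:
  "ev X Y (bconst c) = [:c:]" "ev X Y var_x = X" "ev X Y var_y = Y" "ev X Y var_u = U" "ev X Y var_v = V"
  unfolding ev_def by (simp_all add: bev_vars rhom_const_poly)

lemma UV: "smult \<delta> U - smult \<beta> V = [:0, 1:]" "smult \<alpha> V - smult \<gamma> U = 1"
  using det by (simp_all add: U_def V_def algebra_simps one_pCons)

lemma ev_mu_lam: "ev X Y mu = [:0, 1:]" "ev X Y lam = 1"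
  using UV by (simp_all add: mu_def lam_def ev_simps ev_vars)

lemma u_v: "bconst \<alpha> * mu + bconst \<beta> * lam = var_u" "bconst \<gamma> * mu + bconst \<delta> * lam = var_v"
proof -
  have d: "bconst \<alpha> * bconst \<delta> - bconst \<beta> * bconst \<gamma> = 1"
    using det by (metis bconst_simps(6) bconst_mult bconst_1)
  have "bconst \<alpha> * mu + bconst \<beta> * lam = (bconst \<alpha> * bconst \<delta> - bconst \<beta> * bconst \<gamma>) * var_u"
    by (simp add: mu_def lam_def algebra_simps)
  then show "bconst \<alpha> * mu + bconst \<beta> * lam = var_u" using d by simp
  have "bconst \<gamma> * mu + bconst \<delta> * lam = (bconst \<alpha> * bconst \<delta> - bconst \<beta> * bconst \<gamma>) * var_v"
    by (simp add: mu_def lam_def algebra_simps)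
  then show "bconst \<gamma> * mu + bconst \<delta> * lam = var_v" using d by simp
qed

lemma lam_nz [simp]: "lam \<noteq> 0"
  using ev_mu_lam(2)[of 0 0] ev_simps(1)[of 0 0] by auto

lemma bihomogeneous_mu_lam: "bihomogeneous 0 1 mu" "bihomogeneous 0 1 lam"
  unfolding mu_def lam_def
  by (intro bihomogeneous_diff bihomogeneous_const_mult bihomogeneous_basic)+

lemma hmg_linear:
  "hmg n 0 = 0" "hmg n (P + Q) = hmg n P + hmg n Q" "hmg n (smult c P) = bconst c * hmg n P"
  "hmg n (P - Q) = hmg n P - hmg n Q" "hmg n (- P) = - hmg n P"
  by (simp_all add: hmg_def bconst_simps sum.distrib sum_subtractf sum_negf sum_distrib_left algebra_simps)

lemma hmg_sum: "hmg n (sum F S) = (\<Sum>i\<in>S. hmg n (F i))"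
  by (induction S rule: infinite_finite_induct) (auto simp: hmg_linear)

lemma hmg_monom: "i \<le> n \<Longrightarrow> hmg n (monom c i) = bconst c * mu ^ i * lam ^ (n - i)"
  by (simp add: hmg_def if_distrib[of bconst] bconst_simps if_distribR if_distrib[of "\<lambda>x. x * _"] cong: if_cong)

lemma hmg_mult:
  assumes "degree P \<le> n" "degree Q \<le> m"
  shows "hmg n P * hmg m Q = hmg (n + m) (P * Q)"
proof -
  have "hmg n P * hmg m Q = (\<Sum>i\<le>n. \<Sum>j\<le>m. hmg n (monom (coeff P i) i) * hmg m (monom (coeff Q j) j))"
    by (subst (1) poly_as_sum_of_monoms'[OF assms(1), symmetric],
        subst (1) poly_as_sum_of_monoms'[OF assms(2), symmetric]) (simp add: hmg_sum sum_product)
  also have "\<dots> = (\<Sum>i\<le>n. \<Sum>j\<le>m. hmg (n + m) (monom (coeff P i) i * monom (coeff Q j) j))"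
  proof (intro sum.cong refl)
    fix i j assume "i \<in> {..n}" "j \<in> {..m}"
    then have *: "i \<le> n" "j \<le> m" "lam ^ (n + m - (i + j)) = lam ^ (n - i) * lam ^ (m - j)"
      by (auto simp flip: power_add)
    then show "hmg n (monom (coeff P i) i) * hmg m (monom (coeff Q j) j) =
        hmg (n + m) (monom (coeff P i) i * monom (coeff Q j) j)"
      by (simp add: hmg_monom mult_monom bconst_mult *(3) power_add[of mu] algebra_simps)
  qed
  also have "\<dots> = hmg (n + m) ((\<Sum>i\<le>n. monom (coeff P i) i) * (\<Sum>j\<le>m. monom (coeff Q j) j))"
    by (simp add: hmg_sum sum_product)
  finally show ?thesis using assms by (simp add: poly_as_sum_of_monoms')
qed

lemma hmg_1: "hmg n 1 = lam ^ n"
  using hmg_monom[of 0 n 1] by (simp add: bconst_1)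

lemma hmg_raise: "degree P \<le> n \<Longrightarrow> lam ^ k * hmg n P = hmg (n + k) P"
  using hmg_mult[of P n 1 k] by (simp add: hmg_1 mult.commute)

lemma hmg_UV: "hmg 1 U = var_u" "hmg 1 V = var_v"
  using u_v by (simp_all add: hmg_def U_def V_def add.commute)

lemma degree_UV: "degree U \<le> 1" "degree V \<le> 1"
  by (simp_all add: U_def V_def)

lemma hmg_power: "degree P \<le> n \<Longrightarrow> hmg (n * k) (P ^ k) = hmg n P ^ k"
proof (induction k)
  case 0
  then show ?case by (simp add: hmg_1)
next
  case (Suc k)
  have "degree (P ^ k) \<le> n * k" using degree_power_le[of P k] Suc.prems
    by (meson dual_order.trans mult_le_mono1)
  then show ?case using hmg_mult[of P n "P ^ k" "n * k"] Suc by simp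
qed

lemma bihomogeneous_hmg: "bihomogeneous 0 n (hmg n P)"
  unfolding hmg_def
proof (rule bihomogeneous_sum)
  fix i assume "i \<in> {..n}"
  then show "bihomogeneous 0 n (bconst (coeff P i) * mu ^ i * lam ^ (n - i))"
    using bihomogeneous_mult[OF bihomogeneous_const_mult[OF bihomogeneous_power[OF bihomogeneous_mu_lam(1), of i]]
      bihomogeneous_power[OF bihomogeneous_mu_lam(2), of "n - i"]] by simp
qed

lemma ev_hmg: "degree P \<le> n \<Longrightarrow> ev X Y (hmg n P) = P"
proof -
  assume n: "degree P \<le> n"
  have "ev X Y (hmg n P) = (\<Sum>i\<le>n. monom (coeff P i) i)"
    unfolding hmg_def by (simp add: ev_simps ev_vars ev_mu_lam monom_altdef)
  with n show ?thesis by (simp add: poly_as_sum_of_monoms')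
qed

lemma hmg_eq_iff: "degree P \<le> n \<Longrightarrow> degree Q \<le> n \<Longrightarrow> hmg n P = hmg n Q \<longleftrightarrow> P = Q"
  using ev_hmg by metis

lemma hmg_eq_0_iff: "degree P \<le> n \<Longrightarrow> hmg n P = 0 \<longleftrightarrow> P = 0"
  using hmg_eq_iff[of P n 0] by (simp add: hmg_linear)

text \<open>\<open>U\<close> and \<open>V\<close> homogenize to u and v, so putting them for u and v
  in the coefficient of each monomial in x, y dehomogenizes it, whatever the coordinates.\<close>

lemma bihomogeneous_hmg_expand:
  assumes "bihomogeneous p q F"
  obtains P where "\<And>a. degree (P a) \<le> q" "F = (\<Sum>a\<le>p. var_x ^ a * var_y ^ (p - a) * hmg q (P a))"
proof -
  define P where "P a = (\<Sum>c\<le>q. smult (bicoeff F a (p - a) c (q - c)) (U ^ c * V ^ (q - c)))" for a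
  have d: "degree (U ^ c * V ^ (q - c)) \<le> q" if "c \<le> q" for c
  proof -
    have "degree (U ^ c * V ^ (q - c)) \<le> degree (U ^ c) + degree (V ^ (q - c))" by (rule degree_mult_le)
    also have "\<dots> \<le> degree U * c + degree V * (q - c)" by (intro add_mono degree_power_le)
    also have "\<dots> \<le> 1 * c + 1 * (q - c)" by (intro add_mono mult_le_mono1 degree_UV)
    finally show ?thesis using that by simp
  qed
  have "degree (P a) \<le> q" for a
    unfolding P_def by (intro degree_sum_le) (auto intro: d)
  moreover have h: "hmg q (U ^ c * V ^ (q - c)) = var_u ^ c * var_v ^ (q - c)" if "c \<le> q" for c
  proof -
    have 1: "degree (U ^ c) \<le> c" for c using degree_power_le[of U c] degree_UV
      by (metis dual_order.trans mult_le_mono1 mult_1)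
    have 2: "degree (V ^ c) \<le> c" for c using degree_power_le[of V c] degree_UV
      by (metis dual_order.trans mult_le_mono1 mult_1)
    show ?thesis
      using hmg_mult[OF 1[of c] 2[of "q - c"]] hmg_power[of U 1 c] hmg_power[of V 1 "q - c"] that degree_UV
      by (simp add: hmg_UV[simplified])
  qed
  have "F = (\<Sum>a\<le>p. var_x ^ a * var_y ^ (p - a) * hmg q (P a))"
    by (subst bihomogeneous_expand[OF assms])
      (auto simp: P_def hmg_sum hmg_linear h sum_distrib_left algebra_simps intro!: sum.cong)
  ultimately show ?thesis using that by blast
qed

lemma bihomogeneous_0_hmg:
  assumes "bihomogeneous 0 q F"
  shows "degree (ev X Y F) \<le> q" "hmg q (ev X Y F) = F"
proof -
  obtain P where P: "\<And>a. degree (P a) \<le> q" "F = (\<Sum>a\<le>0. var_x ^ a * var_y ^ (0 - a) * hmg q (P a))"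
    using bihomogeneous_hmg_expand[OF assms] by blast
  then have "F = hmg q (P 0)" by simp
  with P(1)[of 0] show "degree (ev X Y F) \<le> q" "hmg q (ev X Y F) = F" by (simp_all add: ev_hmg)
qed

lemma bihomogeneous_1_hmg:
  assumes "bihomogeneous 1 q F"
  obtains P Q where "degree P \<le> q" "degree Q \<le> q" "F = var_x * hmg q P + var_y * hmg q Q"
proof -
  obtain P where P: "\<And>a. degree (P a) \<le> q" "F = (\<Sum>a\<le>1. var_x ^ a * var_y ^ (1 - a) * hmg q (P a))"
    using bihomogeneous_hmg_expand[OF assms] by blast
  then have "F = var_x * hmg q (P 1) + var_y * hmg q (P 0)" by simp
  with P(1) that show ?thesis by blast
qed

abbreviation hmg3 :: "nat \<Rightarrow> 'k poly v3 \<Rightarrow> 'k bipoly v3" where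
  "hmg3 n \<equiv> map3 (hmg n)"

lemma hmg3_linear:
  "hmg3 n 0 = 0" "hmg3 n (a + b) = hmg3 n a + hmg3 n b" "hmg3 n (a - b) = hmg3 n a - hmg3 n b"
  by (cases a; cases b; simp add: map3_def hmg_linear zero_prod_def)+

lemma hmg3_mult:
  assumes "vdeg n a"
  shows "degree s \<le> m \<Longrightarrow> smul3 (hmg m s) (hmg3 n a) = hmg3 (m + n) (smul3 s a)"
    "vdeg m b \<Longrightarrow> dot3 (hmg3 n a) (hmg3 m b) = hmg (n + m) (dot3 a b)"
    "vdeg m b \<Longrightarrow> cross3 (hmg3 n a) (hmg3 m b) = hmg3 (n + m) (cross3 a b)"
  using assms by (cases a; cases b; simp add: v3_defs vdeg_def hmg_mult hmg_linear)+

end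

section \<open>Forms of bidegree (1,2) in good coordinates\<close>

text \<open>
  A factor of \<open>D\<close> which divides two different combinations \<open>\<xi> a + b\<close> divides \<open>a\<close> and \<open>b\<close>, so each
  factor of \<open>D\<close> excludes at most one \<open>\<xi>\<close>.
\<close>

lemma finite_not_primitive:
  fixes a b :: "'k::field poly v3"
  assumes "dot3 p a + dot3 q b = 1" and "D \<noteq> 0"
  shows "finite {\<xi>. \<not> (\<exists>s \<kappa>. dot3 s (smul3 [:\<xi>:] a + b) + \<kappa> * D = 1)}" (is "finite (?bad D)")
  using assms(2)
proof (induction "degree D" arbitrary: D rule: less_induct)
  case less
  show ?case
  proof (cases "?bad D = {}")
    case False
    then obtain \<xi>0 where bad: "\<xi>0 \<in> ?bad D" by blast
    define e0 where "e0 = smul3 [:\<xi>0:] a + b"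
    obtain s0 e' where e': "e0 = smul3 (dot3 s0 e0) e'" using bezout3 by blast
    obtain s t where d: "s * dot3 s0 e0 + t * D dvd dot3 s0 e0" "s * dot3 s0 e0 + t * D dvd D"
      using bezout_poly by blast
    define d where "d = s * dot3 s0 e0 + t * D"
    obtain c where c: "dot3 s0 e0 = d * c" using d(1) unfolding d_def by (elim dvdE)
    obtain D' where D': "D = d * D'" using d(2) unfolding d_def by (elim dvdE)
    have "\<not> d dvd 1"
    proof
      assume "d dvd 1"
      then obtain i where "1 = d * i" by (elim dvdE)
      then have "dot3 (smul3 (i * s) s0) e0 + (i * t) * D = 1"
        by (simp add: d_def dot3_linear algebra_simps)
      with bad show False unfolding e0_def by blast
    qed
    moreover have dz: "d \<noteq> 0" "D' \<noteq> 0" using D' less.prems by auto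
    ultimately have "degree d \<noteq> 0" by (metis is_unit_iff_degree)
    then have "degree D' < degree D" using D' dz by (simp add: degree_mult_eq)
    with less.hyps dz have fin: "finite (?bad D')" by blast
    \<comment> \<open>The common factor \<open>d\<close> of \<open>e0\<close> and \<open>D\<close>
      is charged to \<open>\<xi>0\<close> and removed; any other value that is bad for
      \<open>D\<close> must already be bad for the cofactor \<open>D'\<close>.\<close>
    have "?bad D \<subseteq> insert \<xi>0 (?bad D')"
    proof
      fix \<xi> assume x: "\<xi> \<in> ?bad D"
      show "\<xi> \<in> insert \<xi>0 (?bad D')"
      proof (rule ccontr)
        assume "\<xi> \<notin> insert \<xi>0 (?bad D')"
        then obtain s1 k1 where 1: "dot3 s1 (smul3 [:\<xi>:] a + b) + k1 * D' = 1" and ne: "\<xi> \<noteq> \<xi>0" by blast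
        define \<eta> where "\<eta> = [:inverse (\<xi> - \<xi>0):]"
        have \<eta>: "\<eta> * ([:\<xi>:] - [:\<xi>0:]) = 1" using ne by (simp add: \<eta>_def one_pCons)
        define e1 where "e1 = smul3 [:\<xi>:] a + b"
        have a: "a = smul3 \<eta> (e1 - e0)"
        proof -
          have "smul3 \<eta> ((smul3 x a + b) - (smul3 x0 a + b)) = smul3 (\<eta> * (x - x0)) a" for x x0
            by (cases a; cases b) (simp add: v3_defs algebra_simps)
          then have "smul3 \<eta> (e1 - e0) = smul3 (\<eta> * ([:\<xi>:] - [:\<xi>0:])) a"
            unfolding e1_def e0_def .
          then show ?thesis by (simp only: \<eta> smul3_linear(6))
        qed
        have b: "b = e0 - smul3 [:\<xi>0:] a" unfolding e0_def by simp
        have e0: "dot3 x e0 = d * (c * dot3 x e')" for x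
          by (subst e') (simp add: dot3_linear c algebra_simps)
        have "1 = dot3 p a + dot3 q (e0 - smul3 [:\<xi>0:] a)" using assms(1) b by simp
        also have "\<dots> = dot3 (p - smul3 [:\<xi>0:] q) a + dot3 q e0" by (simp add: dot3_linear algebra_simps)
        also have "\<dots> = dot3 (smul3 \<eta> (p - smul3 [:\<xi>0:] q)) e1
            + (dot3 q e0 - dot3 (smul3 \<eta> (p - smul3 [:\<xi>0:] q)) e0)"
          by (subst a) (simp add: dot3_linear algebra_simps)
        finally have 2: "1 = dot3 (smul3 \<eta> (p - smul3 [:\<xi>0:] q)) e1
            + d * (c * dot3 q e' - c * dot3 (smul3 \<eta> (p - smul3 [:\<xi>0:] q)) e')"
          unfolding e0 by (simp only: right_diff_distrib)
        define s2 where "s2 = smul3 \<eta> (p - smul3 [:\<xi>0:] q)"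
        define k2 where "k2 = c * dot3 q e' - c * dot3 (smul3 \<eta> (p - smul3 [:\<xi>0:] q)) e'"
        \<comment> \<open>Modulo the entries of \<open>e1\<close>, both \<open>k1 * D'\<close> and
          \<open>d * k2\<close> are 1, hence so is their product, a multiple of
          \<open>D\<close>.\<close>
        have "1 = dot3 s1 e1 + k1 * D' * (dot3 s2 e1 + d * k2)"
          using 1 2[folded s2_def, folded k2_def[folded s2_def]] unfolding e1_def[symmetric] by simp
        also have "\<dots> = dot3 (s1 + smul3 (k1 * D') s2) e1 + (k1 * k2) * D"
          unfolding D' by (simp add: dot3_linear algebra_simps)
        finally have "dot3 (s1 + smul3 (k1 * D') s2) (smul3 [:\<xi>:] a + b) + (k1 * k2) * D = 1"
          unfolding e1_def by (rule sym)
        then show False using x by blast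
      qed
    qed
    with fin show ?thesis by (meson finite_insert finite_subset)
  next
    case True
    then show ?thesis by simp
  qed
qed

text \<open>
  Here \<open>\<phi> = x a + y b\<close>, the matrix \<open>(a, b)\<close> has rank two at the point \<open>lam = 0\<close>, and
  \<open>e = \<xi> a + b\<close> is primitive modulo \<open>D\<close>. In terms of \<open>x' = x - \<xi> y\<close> the last two assumptions give
  \<open>\<phi> = (y + r x') e + D x' C\<close> with \<open>C \<times> e = g\<close> primitive, so that the base scheme is the complete
  intersection \<open>y + r x' = D x' = 0\<close>.
\<close>

locale base = coords \<alpha> \<beta> \<gamma> \<delta> for \<alpha> \<beta> \<gamma> \<delta> :: "'k::field" +
  fixes a b g w C :: "'k poly v3" and D r :: "'k poly" and \<xi> :: 'k
  assumes deg_ab: "vdeg 2 a" "vdeg 2 b"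
    and top: "cross3 (map3 (\<lambda>p. coeff p 2) a) (map3 (\<lambda>p. coeff p 2) b) \<noteq> 0"
    and cross_ab: "cross3 a b = smul3 D g"
    and wg: "dot3 w g = 1"
    and a_eq: "a = smul3 r (smul3 [:\<xi>:] a + b) + smul3 D C"
    and cross_C: "cross3 C (smul3 [:\<xi>:] a + b) = g"

lemma (in coords) base_exists:
  assumes inf: "infinite (UNIV :: 'k set)" and deg: "vdeg 2 a" "vdeg 2 b"
    and top: "cross3 (map3 (\<lambda>p. coeff p 2) a) (map3 (\<lambda>p. coeff p 2) b) \<noteq> 0"
    and prim: "dot3 p a + dot3 q b = 1"
  shows "\<exists>g w C D r \<xi>. base \<alpha> \<beta> \<gamma> \<delta> a b g w C D r \<xi>"
proof -
  have "cross3 a b \<noteq> 0"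
    using top cross3_top[OF deg] by (auto simp: v3_defs zero_prod_def split: prod.splits)
  then obtain D w g where g: "cross3 a b = smul3 D g" "dot3 w g = 1" "D \<noteq> 0"
    by (rule bezout3_primitive)
  obtain \<xi> where "\<xi> \<notin> {\<xi>. \<not> (\<exists>s \<kappa>. dot3 s (smul3 [:\<xi>:] a + b) + \<kappa> * D = 1)}"
    using ex_new_if_finite[OF inf finite_not_primitive[OF prim g(3)]] by blast
  then obtain s \<kappa> where s: "dot3 s (smul3 [:\<xi>:] a + b) + \<kappa> * D = 1" by blast
  define e where "e = smul3 [:\<xi>:] a + b"
  \<comment> \<open>In \<open>a = smul3 (dot3 s e + \<kappa> * D) a\<close> the term
    \<open>smul3 (dot3 s e) a\<close> is (s \<bullet> a) e + s \<times> (a \<times> e), and a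
    \<times> e = D g. Collecting the multiples of \<open>e\<close> and of \<open>D\<close> gives
    \<open>r\<close> and \<open>C\<close>.\<close>
  define r where "r = dot3 s a"
  define C where "C = smul3 \<kappa> a + cross3 s g"
  have ae: "cross3 a e = smul3 D g" by (simp add: e_def cross3_linear cross3_self g(1) smul3_linear)
  have "a = smul3 (dot3 s e + \<kappa> * D) a" using s by (simp add: e_def smul3_linear)
  also have "\<dots> = smul3 r e + (smul3 (\<kappa> * D) a + cross3 s (cross3 a e))"
    by (simp add: cross3_cross3 r_def smul3_linear algebra_simps)
  also have "\<dots> = smul3 r e + smul3 D C"
    unfolding ae C_def by (simp add: cross3_linear smul3_linear mult.commute)
  finally have a: "a = smul3 r e + smul3 D C" .
  have "smul3 D (cross3 C e) = cross3 (a - smul3 r e) e"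
    by (subst a) (simp add: cross3_linear smul3_linear cross3_self)
  also have "\<dots> = smul3 D g" by (simp add: cross3_linear cross3_self smul3_linear ae)
  finally have "cross3 C e = g" using g(3) by (simp add: smul3_cancel)
  with a have "base \<alpha> \<beta> \<gamma> \<delta> a b g w C D r \<xi>"
    using deg top g unfolding e_def by unfold_locales auto
  then show ?thesis by blast
qed

section \<open>Coefficient vectors of three coprime forms\<close>

definition (in coords) form1 :: "nat \<Rightarrow> 'k poly v3 \<Rightarrow> 'k poly v3 \<Rightarrow> 'k bipoly v3" where
  "form1 q a b = smul3 var_x (hmg3 q a) + smul3 var_y (hmg3 q b)"

abbreviation (in coords) "form12 \<equiv> form1 2"

lemma bihomogeneous_const:
  assumes "bihomogeneous p q F" "F \<noteq> 0" "F \<in> range bconst"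
  shows "p = 0 \<and> q = 0"
  using assms bihomogeneous_eq[OF assms(1) _ assms(2), of 0 0] bihomogeneous_basic(1) by auto

lemma var_not_const: "var_x \<notin> range bconst" "var_y \<notin> range bconst"
  using bihomogeneous_const[OF bihomogeneous_basic(3)] bihomogeneous_const[OF bihomogeneous_basic(4)] by auto

definition coprime3 :: "'k::field bipoly v3 \<Rightarrow> bool" where
  "coprime3 f \<longleftrightarrow> (\<forall>d f'. f = smul3 d f' \<longrightarrow> d \<in> range bconst)"

context coords
begin

lemma form12_smul3:
  assumes "vdeg n a" "vdeg n b" "degree d \<le> m" "m + n = 2"
  shows "form12 (smul3 d a) (smul3 d b) = smul3 (hmg m d) (smul3 var_x (hmg3 n a) + smul3 var_y (hmg3 n b))"
  unfolding form1_def assms(4)[symmetric] hmg3_mult(1)[OF assms(1,3), symmetric]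
    hmg3_mult(1)[OF assms(2,3), symmetric]
  by (simp add: smul3_linear mult.commute)

text \<open>A common divisor \<open>d\<close> of all six entries homogenizes to a common factor of
  the three forms. It has bidegree (0, \<open>degree d\<close>), so it can be constant only if
  \<open>degree d = 0\<close>.\<close>

lemma form12_primitive:
  assumes f: "coprime3 (form12 a b)" and deg: "vdeg 2 a" "vdeg 2 b"
  shows "\<exists>p q. dot3 p a + dot3 q b = 1"
proof -
  obtain w a' where a: "a = smul3 (dot3 w a) a'" using bezout3 by blast
  obtain w' b' where b: "b = smul3 (dot3 w' b) b'" using bezout3 by blast
  obtain s t where d: "s * dot3 w a + t * dot3 w' b dvd dot3 w a" "s * dot3 w a + t * dot3 w' b dvd dot3 w' b"
    using bezout_poly by blast
  define d where "d = s * dot3 w a + t * dot3 w' b"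
  obtain c c' where c: "dot3 w a = d * c" "dot3 w' b = d * c'" using d unfolding d_def by (elim dvdE)
  define a2 b2 where "a2 = smul3 c a'" and "b2 = smul3 c' b'"
  have ab: "a = smul3 d a2" "b = smul3 d b2" using a b by (simp_all add: c a2_def b2_def smul3_linear)
  have nz: "a \<noteq> 0 \<or> b \<noteq> 0"
  proof (rule ccontr)
    assume "\<not> (a \<noteq> 0 \<or> b \<noteq> 0)"
    then have "form12 a b = smul3 var_x 0" by (simp add: form1_def hmg3_linear smul3_linear)
    with f show False using var_not_const unfolding coprime3_def by blast
  qed
  then have d0: "d \<noteq> 0" using ab by (auto simp: smul3_linear)
  have le: "degree d \<le> 2" using nz
  proof
    assume "a \<noteq> 0"
    then have "a2 \<noteq> 0" using ab by (auto simp: smul3_linear)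
    with vdeg_cancel(1)[OF _ d0, of 2 a2] show ?thesis using ab deg by simp
  next
    assume "b \<noteq> 0"
    then have "b2 \<noteq> 0" using ab by (auto simp: smul3_linear)
    with vdeg_cancel(1)[OF _ d0, of 2 b2] show ?thesis using ab deg by simp
  qed
  have "form12 a b = smul3 (hmg (degree d) d) (smul3 var_x (hmg3 (2 - degree d) a2) + smul3 var_y (hmg3 (2 - degree d) b2))"
    using form12_smul3[of "2 - degree d" a2 b2 d "degree d"] ab deg le vdeg_cancel(2)[OF _ d0] by simp
  then have "hmg (degree d) d \<in> range bconst" using f unfolding coprime3_def by blast
  moreover have "hmg (degree d) d \<noteq> 0" using d0 by (simp add: hmg_eq_0_iff)
  ultimately have "degree d = 0" using bihomogeneous_const[OF bihomogeneous_hmg] by blast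
  then obtain i where "d * i = 1" using d0 by (metis dvdE is_unit_iff_degree)
  then have "dot3 (smul3 (i * s) w) a + dot3 (smul3 (i * t) w') b = 1"
    by (simp add: d_def dot3_linear algebra_simps)
  then show ?thesis by blast
qed

text \<open>If \<open>a\<close> and \<open>b\<close> are parallel, both are multiples of one
  primitive vector \<open>a'\<close>, and the form is \<open>G\<close> times the homogenized
  \<open>a'\<close>. The factor \<open>G\<close> has degree 1 in x, y and cannot be
  constant.\<close>

lemma form12_cross_nonzero:
  assumes f: "coprime3 (form12 a b)" and deg: "vdeg 2 a" "vdeg 2 b"
  shows "cross3 a b \<noteq> 0"
proof
  assume 0: "cross3 a b = 0"
  have "a \<noteq> 0"
  proof
    assume "a = 0"
    then have "form12 a b = smul3 var_y (hmg3 2 b)" by (simp add: form1_def hmg3_linear smul3_linear)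
    with f show False using var_not_const unfolding coprime3_def by blast
  qed
  then obtain d w a' where a': "a = smul3 d a'" "dot3 w a' = 1" "d \<noteq> 0" by (rule bezout3_primitive)
  have "cross3 a' b = 0" using 0 a' by (simp add: cross3_linear smul3_eq_0_iff)
  then have "cross3 w (cross3 a' b) = 0" by (simp add: cross3_linear)
  then have b: "b = smul3 (dot3 w b) a'" by (simp add: cross3_cross3 a'(2) smul3_linear)
  have "a' \<noteq> 0" using a' by (auto simp: dot3_linear)
  \<comment> \<open>The exact degree of \<open>a'\<close> bounds both cofactors by 2 - k, so that
    the factorization over \<open>k[t]\<close> lifts to forms.\<close>
  then obtain k where k: "vdeg k a'" "map3 (\<lambda>p. coeff p k) a' \<noteq> 0" by (rule vdeg_exact)
  have kk: "k + degree s \<le> 2" if "vdeg 2 (smul3 s a')" "s \<noteq> 0" for s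
  proof -
    have "vdeg (2 - degree s) a'" "degree s \<le> 2" using vdeg_cancel[OF that] \<open>a' \<noteq> 0\<close> by auto
    moreover have "k \<le> 2 - degree s"
    proof (rule ccontr)
      assume "\<not> ?thesis"
      then have "map3 (\<lambda>p. coeff p k) a' = 0" using \<open>vdeg (2 - degree s) a'\<close>
        by (cases a') (auto simp: v3_defs vdeg_def zero_prod_def intro!: coeff_eq_0)
      with k show False by simp
    qed
    ultimately show ?thesis by simp
  qed
  have k2: "degree d \<le> 2 - k" "k \<le> 2" using kk[of d] a' deg by auto
  have k3: "degree (dot3 w b) \<le> 2 - k" using kk[of "dot3 w b"] b deg k2 by (cases "dot3 w b = 0") auto
  define G where "G = var_x * hmg (2 - k) d + var_y * hmg (2 - k) (dot3 w b)"
  have *: "hmg3 2 (smul3 s a') = smul3 (hmg (2 - k) s) (hmg3 k a')" if "degree s \<le> 2 - k" for s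
    using hmg3_mult(1)[OF k(1) that] k2 by simp
  have "hmg3 2 b = smul3 (hmg (2 - k) (dot3 w b)) (hmg3 k a')" using *[OF k3] b by simp
  then have "form12 a b = smul3 G (hmg3 k a')"
    unfolding form1_def G_def using *[OF k2(1)] a' by (simp add: smul3_linear)
  then have "G \<in> range bconst" using f unfolding coprime3_def by blast
  moreover have "bihomogeneous 1 (2 - k) G"
    unfolding G_def using bihomogeneous_mult[OF bihomogeneous_basic(3) bihomogeneous_hmg]
      bihomogeneous_mult[OF bihomogeneous_basic(4) bihomogeneous_hmg]
    by (intro bihomogeneous_add) simp_all
  moreover have "G \<noteq> 0"
  proof
    assume "G = 0"
    then have "ev 1 0 G = 0" by (simp add: ev_simps)
    then show False using a'(3) k2(1) by (simp add: G_def ev_simps ev_vars ev_hmg)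
  qed
  ultimately show False using bihomogeneous_const by force
qed

lemma form1_exists:
  assumes "all3 (bihomogeneous 1 q) f"
  shows "\<exists>a b. vdeg q a \<and> vdeg q b \<and> f = form1 q a b"
proof -
  obtain f0 f1 f2 where f: "f = (f0, f1, f2)" by (cases f)
  have *: "\<exists>P Q. degree P \<le> q \<and> degree Q \<le> q \<and> F = var_x * hmg q P + var_y * hmg q Q"
    if "bihomogeneous 1 q F" for F using bihomogeneous_1_hmg[OF that] by metis
  obtain P0 Q0 where 0: "degree P0 \<le> q" "degree Q0 \<le> q" "f0 = var_x * hmg q P0 + var_y * hmg q Q0"
    using *[of f0] assms by (auto simp: f all3_def)
  obtain P1 Q1 where 1: "degree P1 \<le> q" "degree Q1 \<le> q" "f1 = var_x * hmg q P1 + var_y * hmg q Q1"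
    using *[of f1] assms by (auto simp: f all3_def)
  obtain P2 Q2 where 2: "degree P2 \<le> q" "degree Q2 \<le> q" "f2 = var_x * hmg q P2 + var_y * hmg q Q2"
    using *[of f2] assms by (auto simp: f all3_def)
  from 0 1 2 show ?thesis
    by (intro exI[of _ "(P0, P1, P2)"] exI[of _ "(Q0, Q1, Q2)"]) (simp add: f form1_def vdeg_def v3_defs)
qed

lemma ev_form1:
  assumes "vdeg q a" "vdeg q b"
  shows "map3 (ev X Y) (form1 q a b) = smul3 X a + smul3 Y b"
  using assms by (cases a; cases b) (simp add: form1_def v3_defs vdeg_def ev_simps ev_vars ev_hmg)

end

lemma poly_map3:
  "map3 (\<lambda>p. poly p z) (cross3 a b) = cross3 (map3 (\<lambda>p. poly p z) a) (map3 (\<lambda>p. poly p z) b)"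
  by (cases a; cases b) (simp add: v3_defs)

text \<open>With these parameters \<open>lam\<close> is \<zeta> v - u, so \<open>lam = 0\<close> is
  the point (\<zeta> : 1), and the bad values are among the roots of one nonzero entry of
  \<open>a \<times> b\<close>. Finiteness rather than existence is stated because
  \<open>generically_ci_form12\<close> picks two good values.\<close>

lemma finite_bad_coords:
  fixes f :: "'k::field bipoly v3"
  assumes inf: "infinite (UNIV :: 'k set)" and hom: "all3 (bihomogeneous 1 2) f" and cop: "coprime3 f"
  shows "finite {\<zeta>. \<not> (\<exists>a b g w C D r \<xi>. base \<zeta> (-1) 1 0 a b g w C D r \<xi> \<and> f = coords.form1 \<zeta> (-1) 1 0 2 a b)}"
    (is "finite ?bad")
proof -
  \<comment> \<open>Here t = u / v, so evaluation at \<zeta> is evaluation at (\<zeta> : 1).\<close>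
  interpret S: coords 1 0 0 "1::'k" by unfold_locales simp
  obtain a b where ab: "vdeg 2 a" "vdeg 2 b" "f = S.form12 a b" using S.form1_exists[OF hom] by blast
  have nz: "cross3 a b \<noteq> 0" using S.form12_cross_nonzero ab cop by blast
  then obtain n where n: "dot3 n (cross3 a b) \<noteq> 0" using dot3_nonzero by blast
  have "?bad \<subseteq> {\<zeta>. poly (dot3 n (cross3 a b)) \<zeta> = 0}"
  proof (rule subsetI, rule ccontr)
    fix \<zeta> assume bad: "\<zeta> \<in> ?bad" and "\<zeta> \<notin> {\<zeta>. poly (dot3 n (cross3 a b)) \<zeta> = 0}"
    then have z: "map3 (\<lambda>p. poly p \<zeta>) (cross3 a b) \<noteq> 0"
      by (auto simp: v3_defs zero_prod_def split: prod.splits)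
    interpret Z: coords \<zeta> "-1" 1 0 by unfold_locales simp
    obtain a' b' where ab': "vdeg 2 a'" "vdeg 2 b'" "f = Z.form12 a' b'" using Z.form1_exists[OF hom] by blast
    \<comment> \<open>In the new coordinates u and v become \<zeta> t - 1 and t, so the coefficient
      of t^2 is the old value at (\<zeta> : 1).\<close>
    have h: "coeff (Z.ev X Y (S.hmg 2 P)) 2 = poly P \<zeta>" if "degree P \<le> 2" for P X Y
    proof -
      have "Z.ev X Y (S.hmg 2 P) = [:coeff P 0:] * Z.V ^ 2 + [:coeff P 1:] * Z.U * Z.V + [:coeff P 2:] * Z.U ^ 2"
        by (simp add: S.hmg_def S.mu_def S.lam_def Z.ev_simps Z.ev_vars numeral_2_eq_2 bconst_simps)
      also have "coeff \<dots> 2 = coeff P 0 + coeff P 1 * \<zeta> + coeff P 2 * \<zeta> ^ 2"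
        by (simp add: Z.U_def Z.V_def power2_eq_square numeral_2_eq_2 algebra_simps)
      also have "\<dots> = poly (\<Sum>i\<le>2. monom (coeff P i) i) \<zeta>"
        by (simp add: poly_sum poly_monom numeral_2_eq_2)
      also have "\<dots> = poly P \<zeta>" using that by (simp add: poly_as_sum_of_monoms')
      finally show ?thesis .
    qed
    have "a' = map3 (Z.ev 1 0) f" "b' = map3 (Z.ev 0 1) f"
      unfolding ab'(3) by (simp_all add: Z.ev_form1 ab' smul3_linear)
    then have tops: "map3 (\<lambda>p. coeff p 2) a' = map3 (\<lambda>p. poly p \<zeta>) a" "map3 (\<lambda>p. coeff p 2) b' = map3 (\<lambda>p. poly p \<zeta>) b"
      unfolding ab(3) S.form1_def using ab(1,2)
      by (cases a; cases b; simp add: v3_defs vdeg_def Z.ev_simps Z.ev_vars h)+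
    have "cross3 (map3 (\<lambda>p. coeff p 2) a') (map3 (\<lambda>p. coeff p 2) b') \<noteq> 0"
      using z unfolding tops poly_map3 .
    moreover obtain p q where "dot3 p a' + dot3 q b' = 1" using Z.form12_primitive ab' cop by blast
    ultimately show False using Z.base_exists[OF inf ab'(1,2)] ab'(3) bad by blast
  qed
  moreover have "finite {\<zeta>. poly (dot3 n (cross3 a b)) \<zeta> = 0}" using n by (rule poly_roots_finite)
  ultimately show ?thesis by (rule finite_subset)
qed

section \<open>The ideal of the base scheme\<close>

definition idl :: "'k::field bipoly v3 \<Rightarrow> 'k bipoly set" where
  "idl f = range (\<lambda>h. dot3 h f)"

lemma idl_ideal3: "idl (f0, f1, f2) = ideal3 f0 f1 f2"
  unfolding idl_def ideal3_def image_def by (auto simp: dot3_def)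

lemma idl_closed:
  "0 \<in> idl f" "A \<in> idl f \<Longrightarrow> B \<in> idl f \<Longrightarrow> A + B \<in> idl f" "A \<in> idl f \<Longrightarrow> s * A \<in> idl f"
  "A \<in> idl f \<Longrightarrow> A * s \<in> idl f" "A \<in> idl f \<Longrightarrow> B \<in> idl f \<Longrightarrow> A - B \<in> idl f"
proof -
  show "0 \<in> idl f" unfolding idl_def by (rule range_eqI[of _ _ 0]) (simp add: dot3_linear)
  show *: "s * A \<in> idl f" if "A \<in> idl f" for s A
    using that unfolding idl_def by (auto simp flip: dot3_linear(6))
  then show "A \<in> idl f \<Longrightarrow> A * s \<in> idl f" by (metis mult.commute)
  show "A \<in> idl f \<Longrightarrow> B \<in> idl f \<Longrightarrow> A + B \<in> idl f"
    unfolding idl_def by (auto simp flip: dot3_linear(2))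
  show "A \<in> idl f \<Longrightarrow> B \<in> idl f \<Longrightarrow> A - B \<in> idl f"
    unfolding idl_def by (auto simp flip: dot3_linear(4))
qed

lemma idl_sum: "(\<And>i. i \<in> S \<Longrightarrow> F i \<in> idl f) \<Longrightarrow> sum F S \<in> idl f"
  by (induction S rule: infinite_finite_induct) (auto intro: idl_closed)

text \<open>Cyclic invariance of the triple product isolates \<open>f\<close>. This is how the
  minors of (a, b) enter the ideal.\<close>

lemma idl_cross: "dot3 p (cross3 f h) \<in> idl f"
  unfolding idl_def by (rule range_eqI[of _ _ "cross3 h p"]) (simp add: dot3_commute[of _ f] dot3_cross3_cyc[of p f h])

lemma idl_cong_mult:
  assumes "A - B \<in> idl f" "A' - B' \<in> idl f"
  shows "A * A' - B * B' \<in> idl f"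
proof -
  have "A * A' - B * B' = A * (A' - B') + (A - B) * B'" by (simp add: algebra_simps)
  then show ?thesis using assms by (auto intro: idl_closed)
qed

lemma idl_cong_power: "A - B \<in> idl f \<Longrightarrow> A ^ n - B ^ n \<in> idl f"
  by (induction n) (auto intro: idl_closed idl_cong_mult)

lemma idl_cong_mem: "A - B \<in> idl f \<Longrightarrow> B \<in> idl f \<Longrightarrow> A \<in> idl f"
  using idl_closed(2)[of "A - B" f B] by simp

lemma power_sum_ideal:
  fixes z :: "'a::comm_ring_1"
  assumes "z = A * s + l"
  shows "\<exists>s'. z ^ M = A * s' + l ^ M"
proof (induction M)
  case 0
  then show ?case by (intro exI[of _ 0]) simp
next
  case (Suc M)
  then obtain s' where "z ^ M = A * s' + l ^ M" by blast
  then have "z ^ Suc M = A * (s * z ^ M + l * s') + l ^ Suc M"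
    using assms by (simp add: algebra_simps)
  then show ?case by blast
qed

text \<open>\<open>degree P = n\<close> says that the form does not vanish at
  \<open>lam = 0\<close>. Subtracting a multiple of it from \<open>hmg 1 Z ^ n\<close> kills the
  coefficient at the bound, and what is left is divisible by \<open>lam\<close>.\<close>

lemma (in coords) hmg_lam_comaximal:
  assumes "degree P = n" "P \<noteq> 0" "degree Z \<le> 1"
  shows "\<exists>s s'. hmg 1 Z ^ n = hmg n P * s + lam * s'"
proof -
  define c where "c = coeff (Z ^ n) n / lead_coeff P"
  define Q where "Q = Z ^ n - smult c P"
  have Zn: "degree (Z ^ n) \<le> n" using degree_power_le[of Z n] assms(3)
    by (metis dual_order.trans mult_le_mono1 mult_1)
  have "degree Q \<le> n" unfolding Q_def using Zn assms(1) by (intro degree_diff_le) auto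
  moreover have "coeff Q n = 0" using assms by (auto simp: Q_def c_def)
  ultimately have "\<exists>s'. hmg n Q = lam * s'"
  proof (cases n)
    case 0
    then have "Q = 0" using \<open>degree Q \<le> n\<close> \<open>coeff Q n = 0\<close> by (auto elim!: degree_eq_zeroE)
    then show ?thesis by (intro exI[of _ 0]) (simp add: hmg_linear)
  next
    case (Suc k)
    then have "degree Q \<le> k" using \<open>degree Q \<le> n\<close> \<open>coeff Q n = 0\<close> degree_le_coeff by blast
    then show ?thesis using hmg_raise[of Q k 1] Suc by (intro exI[of _ "hmg k Q"]) simp
  qed
  then obtain s' where s': "hmg n Q = lam * s'" by blast
  have "hmg 1 Z ^ n = hmg n (Z ^ n)" using hmg_power[OF assms(3), of n] by simp
  also have "\<dots> = hmg n (smult c P + Q)" by (simp add: Q_def)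
  also have "\<dots> = hmg n P * bconst c + lam * s'" by (simp add: hmg_linear s' mult.commute)
  finally show ?thesis by blast
qed

context base
begin

abbreviation "e \<equiv> smul3 [:\<xi>:] a + b"
abbreviation "f \<equiv> form12 a b"
abbreviation "n \<equiv> degree D"
abbreviation "m \<equiv> 4 - degree D"
text \<open>Solving y + r x' = 0 with x' = 1 gives y = - r and x = 1 - \<xi> r: the first
  coordinates of the base scheme as functions of t modulo \<open>D\<close>.\<close>

definition "X = 1 - smult \<xi> r"
definition "Y = - r"
definition x' :: "'k bipoly" where "x' = var_x - bconst \<xi> * var_y"

lemma cross_ab_nz: "cross3 a b \<noteq> 0"
  using top cross3_top[OF deg_ab] by (auto simp: v3_defs zero_prod_def split: prod.splits)

lemma D_nz: "D \<noteq> 0" and g_nz: "g \<noteq> 0"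
  using cross_ab_nz unfolding cross_ab by (auto simp: smul3_eq_0_iff)

lemma vdeg_cross_ab: "vdeg 4 (smul3 D g)"
  using vdeg_cross3[OF deg_ab] by (simp add: cross_ab)

lemma n_le: "n \<le> 4" and vdeg_g: "vdeg m g"
  using vdeg_cancel[OF vdeg_cross_ab D_nz] g_nz by auto

text \<open>The value of \<open>a \<times> b\<close> at \<open>lam = 0\<close> is the product of
  those of \<open>D\<close> and \<open>g\<close>; as it is nonzero, \<open>g\<close> attains the
  degree \<open>m\<close>.\<close>

lemma top_g: "map3 (\<lambda>p. coeff p m) g \<noteq> 0"
proof -
  have "map3 (\<lambda>p. coeff p (n + m)) (smul3 D g) \<noteq> 0"
    using top cross3_top[OF deg_ab] n_le by (simp add: cross_ab)
  then show ?thesis using smul3_top[OF order.refl vdeg_g] D_nz by (auto simp: smul3_linear)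
qed

lemma b_eq: "b = e - smul3 [:\<xi>:] a" by simp

lemma cross_Ca: "cross3 C a = smul3 r g"
proof -
  have "cross3 C (smul3 r v + smul3 D C) = smul3 r (cross3 C v)" for v
    by (simp add: cross3_linear cross3_self smul3_linear)
  from this[of e] show ?thesis using a_eq cross_C by metis
qed

lemma cross_Cb: "cross3 C b = smul3 X g"
proof -
  have "cross3 C b = cross3 C e - smul3 [:\<xi>:] (cross3 C a)"
    by (simp add: cross3_linear)
  also have "\<dots> = g - smul3 [:\<xi>:] (smul3 r g)" by (simp only: cross_C cross_Ca)
  finally show ?thesis by (simp add: X_def smul3_linear)
qed

text \<open>At (\<open>X\<close> : \<open>Y\<close>) the factor y + r x' is 0 and x' is 1, so of (y
  + r x') e + D x' C only D C remains.\<close>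

lemma ev_f: "map3 (ev X Y) f = smul3 D C"
proof -
  have "map3 (ev X Y) f = smul3 X a + smul3 Y b" using deg_ab by (rule ev_form1)
  also have "\<dots> = a - smul3 r e"
    by (simp add: X_def Y_def smul3_linear algebra_simps)
  also have "\<dots> = smul3 D C" using a_eq by (simp add: algebra_simps)
  finally show ?thesis .
qed

lemma ev_idl: "F \<in> idl f \<Longrightarrow> D dvd ev X Y F"
proof -
  assume "F \<in> idl f"
  then obtain h where "F = dot3 h f" unfolding idl_def by blast
  then have "ev X Y F = dot3 (map3 (ev X Y) h) (smul3 D C)"
    by (simp add: map3_rhom(1)[OF rhom_ev, symmetric] ev_f)
  then show ?thesis by (simp add: dot3_linear)
qed

text \<open>Crossing x a + y b with \<open>b\<close> or \<open>- a\<close> leaves x or y times D g.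
  The vector \<open>p\<close> is free for two uses: \<open>w\<close> turns \<open>dot3 p g\<close>
  into 1, and a suitable constant vector makes it nonzero at \<open>lam = 0\<close>.\<close>

lemma minors_mem:
  assumes "vdeg k p"
  shows "var_x * (hmg (k + m) (dot3 p g) * hmg n D) \<in> idl f" "var_y * (hmg (k + m) (dot3 p g) * hmg n D) \<in> idl f"
proof -
  have ab: "cross3 (hmg3 2 a) (hmg3 2 b) = hmg3 4 (smul3 D g)"
    using hmg3_mult(3)[OF deg_ab] by (simp add: cross_ab)
  have *: "dot3 (hmg3 k p) (hmg3 4 (smul3 D g)) = hmg (k + m) (dot3 p g) * hmg n D"
    using hmg3_mult(2)[OF assms vdeg_cross_ab] hmg_mult[OF degree_dot3[OF assms vdeg_g] order.refl, of D] n_le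
    by (simp add: dot3_linear mult.commute)
  have "cross3 f (hmg3 2 b) = smul3 var_x (hmg3 4 (smul3 D g))"
    unfolding form1_def by (simp add: cross3_linear cross3_self ab smul3_linear)
  then show "var_x * (hmg (k + m) (dot3 p g) * hmg n D) \<in> idl f"
    using idl_cross[of "hmg3 k p" f "hmg3 2 b"] by (simp add: dot3_linear *)
  have "cross3 f (- hmg3 2 a) = smul3 var_y (hmg3 4 (smul3 D g))"
    unfolding form1_def
    by (simp add: cross3_linear cross3_self cross3_anti[of "hmg3 2 b" "hmg3 2 a"] ab smul3_linear)
  then show "var_y * (hmg (k + m) (dot3 p g) * hmg n D) \<in> idl f"
    using idl_cross[of "hmg3 k p" f "- hmg3 2 a"] by (simp add: dot3_linear *)
qed

lemma lam_D_mem: "\<exists>N. \<forall>c\<in>{var_x, var_y}. lam ^ N * (c * hmg n D) \<in> idl f"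
proof -
  obtain k where "vdeg k w" using vdeg_exists by blast
  from minors_mem[OF this] show ?thesis
    by (intro exI[of _ "k + m"]) (auto simp: wg hmg_1 mult.left_commute)
qed

text \<open>Since \<open>C \<times> a = r g\<close>, \<open>C \<times> b = X g\<close> and \<open>w \<bullet> g = 1\<close>.\<close>

lemma second_generator:
  assumes "vdeg k w" "vdeg k C"
  shows "degree r \<le> 2 * k + 2" "degree X \<le> 2 * k + 2"
    "var_x * hmg (2 * k + 2) r + var_y * hmg (2 * k + 2) X \<in> idl f"
proof -
  note Ca = vdeg_cross3[OF assms(2) deg_ab(1)] and Cb = vdeg_cross3[OF assms(2) deg_ab(2)]
  have dots: "dot3 w (cross3 C a) = r" "dot3 w (cross3 C b) = X"
    by (simp_all only: cross_Ca cross_Cb dot3_linear wg mult_1_right)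
  show "degree r \<le> 2 * k + 2" "degree X \<le> 2 * k + 2"
    using degree_dot3[OF assms(1) Ca] degree_dot3[OF assms(1) Cb] by (simp_all add: dots mult_2)
  have "dot3 (hmg3 k w) (cross3 (hmg3 k C) (hmg3 2 a)) = hmg (2 * k + 2) r"
    "dot3 (hmg3 k w) (cross3 (hmg3 k C) (hmg3 2 b)) = hmg (2 * k + 2) X"
    unfolding hmg3_mult(3)[OF assms(2) deg_ab(1)] hmg3_mult(3)[OF assms(2) deg_ab(2)]
      hmg3_mult(2)[OF assms(1) Ca] hmg3_mult(2)[OF assms(1) Cb] dots by (simp_all add: mult_2)
  then have "dot3 (hmg3 k w) (cross3 (hmg3 k C) f) = var_x * hmg (2 * k + 2) r + var_y * hmg (2 * k + 2) X"
    unfolding form1_def by (simp add: cross3_linear dot3_linear)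
  moreover have "dot3 (hmg3 k w) (cross3 (hmg3 k C) f) = dot3 (- hmg3 k w) (cross3 f (hmg3 k C))"
    by (simp add: dot3_linear cross3_anti[of f])
  ultimately show "var_x * hmg (2 * k + 2) r + var_y * hmg (2 * k + 2) X \<in> idl f"
    using idl_cross by metis
qed

text \<open>Both differences are multiples of the second generator x r + y X, which is y + r x'
  rewritten. Up to powers of \<open>lam\<close>, x and y may thus be replaced by X x' and Y
  x'.\<close>

lemma x_y_cong:
  obtains N where "degree X \<le> N" "degree Y \<le> N"
    "lam ^ N * var_x - hmg N X * x' \<in> idl f" "lam ^ N * var_y - hmg N Y * x' \<in> idl f"
proof -
  obtain k1 k2 where "vdeg k1 w" "vdeg k2 C" using vdeg_exists by blast
  then have k: "vdeg (max k1 k2) w" "vdeg (max k1 k2) C" by (auto elim: vdeg_mono)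
  define N where "N = 2 * max k1 k2 + 2"
  note sg = second_generator[OF k, folded N_def]
  have h: "hmg N X = lam ^ N - bconst \<xi> * hmg N r" "hmg N Y = - hmg N r"
    by (simp_all add: X_def Y_def hmg_linear hmg_1)
  have "lam ^ N * var_y - hmg N Y * x' = var_x * hmg N r + var_y * hmg N X"
    "lam ^ N * var_x - hmg N X * x' = bconst \<xi> * (var_x * hmg N r + var_y * hmg N X)"
    unfolding h x'_def by (simp_all add: algebra_simps)
  with sg that show ?thesis by (metis Y_def degree_minus idl_closed(3))
qed

text \<open>Converse of \<open>ev_idl\<close> away from \<open>lam = 0\<close>. Replacing x and y by
  X x' and Y x' turns \<open>F\<close> into x'^p times a multiple of \<open>D\<close>, up to powers
  of \<open>lam\<close>. The factor \<open>c\<close> is there because \<open>lam_D_mem\<close> puts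
  \<open>D\<close> into the ideal only after multiplication by x or y.\<close>

lemma lam_mem:
  assumes F: "bihomogeneous p q F" and dvd: "D dvd ev X Y F"
  shows "\<exists>N. \<forall>c\<in>{var_x, var_y}. lam ^ N * (c * F) \<in> idl f"
proof -
  obtain P where P: "\<And>i. degree (P i) \<le> q" "F = (\<Sum>i\<le>p. var_x ^ i * var_y ^ (p - i) * hmg q (P i))"
    using bihomogeneous_hmg_expand[OF F] by blast
  obtain N where N: "degree X \<le> N" "degree Y \<le> N"
    "lam ^ N * var_x - hmg N X * x' \<in> idl f" "lam ^ N * var_y - hmg N Y * x' \<in> idl f" by (rule x_y_cong)
  define Q where "Q = hmg (N * p + q) (ev X Y F)"
  have dp: "degree (A ^ i) \<le> N * i" if "degree A \<le> N" for A :: "'k poly" and i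
    using degree_power_le[of A i] that by (meson dual_order.trans mult_le_mono1)
  have dterm: "degree (X ^ i * Y ^ (p - i) * P i) \<le> N * p + q" if "i \<le> p" for i
  proof -
    have "degree (X ^ i * Y ^ (p - i) * P i) \<le> N * i + N * (p - i) + q"
      by (intro degree_mult_bound dp N P)
    then show ?thesis using that by (simp add: add_mult_distrib2[symmetric])
  qed
  have evF: "ev X Y F = (\<Sum>i\<le>p. X ^ i * Y ^ (p - i) * P i)"
    by (simp add: P(2) ev_simps ev_vars ev_hmg P(1))
  have dF: "degree (ev X Y F) \<le> N * p + q"
    unfolding evF using dterm by (intro degree_sum_le) auto
  have "lam ^ (N * p) * F - x' ^ p * Q = (\<Sum>i\<le>p. ((lam ^ N * var_x) ^ i * (lam ^ N * var_y) ^ (p - i)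
      - (hmg N X * x') ^ i * (hmg N Y * x') ^ (p - i)) * hmg q (P i))"
  proof -
    have "lam ^ (N * p) * F = (\<Sum>i\<le>p. (lam ^ N * var_x) ^ i * (lam ^ N * var_y) ^ (p - i) * hmg q (P i))"
      unfolding P(2) sum_distrib_left
    proof (intro sum.cong refl)
      fix i assume "i \<in> {..p}"
      then have "lam ^ (N * p) = (lam ^ N) ^ i * (lam ^ N) ^ (p - i)"
        by (simp add: power_mult power_add[symmetric])
      then show "lam ^ (N * p) * (var_x ^ i * var_y ^ (p - i) * hmg q (P i)) =
        (lam ^ N * var_x) ^ i * (lam ^ N * var_y) ^ (p - i) * hmg q (P i)"
        by (simp add: power_mult_distrib algebra_simps)
    qed
    moreover have "x' ^ p * Q = (\<Sum>i\<le>p. (hmg N X * x') ^ i * (hmg N Y * x') ^ (p - i) * hmg q (P i))"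
      unfolding Q_def evF hmg_sum sum_distrib_left
    proof (intro sum.cong refl)
      fix i assume i: "i \<in> {..p}"
      have "hmg (N * i + N * (p - i) + q) (X ^ i * Y ^ (p - i) * P i)
          = hmg N X ^ i * hmg N Y ^ (p - i) * hmg q (P i)"
        using N P by (simp add: hmg_mult[symmetric] dp degree_mult_bound hmg_power)
      moreover have "N * i + N * (p - i) + q = N * p + q" using i by (simp add: add_mult_distrib2[symmetric])
      moreover have "x' ^ p = x' ^ i * x' ^ (p - i)" using i by (simp add: power_add[symmetric])
      ultimately show "x' ^ p * hmg (N * p + q) (X ^ i * Y ^ (p - i) * P i) =
          (hmg N X * x') ^ i * (hmg N Y * x') ^ (p - i) * hmg q (P i)"
        by (simp add: power_mult_distrib algebra_simps)
    qed
    ultimately show ?thesis by (simp add: sum_subtractf left_diff_distrib)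
  qed
  also have "\<dots> \<in> idl f"
    by (intro idl_sum idl_closed(4), rule idl_cong_mult; rule idl_cong_power; rule N)
  finally have 1: "lam ^ (N * p) * F - x' ^ p * Q \<in> idl f" .
  obtain K where K: "ev X Y F = D * K" using dvd by (elim dvdE)
  obtain M where M: "\<And>c. c \<in> {var_x, var_y} \<Longrightarrow> lam ^ M * (c * hmg n D) \<in> idl f" using lam_D_mem by blast
  \<comment> \<open>\<open>Q\<close> homogenizes \<open>D * K\<close> at the bound N p + q, the
    product of the two forms at \<open>n + degree K\<close>; powers of \<open>lam\<close> make up
    the difference.\<close>
  have Q: "lam ^ degree K * Q * lam ^ n = lam ^ (N * p + q) * (hmg n D * hmg (degree K) K)"
  proof -
    have "lam ^ degree K * Q * lam ^ n = lam ^ (n + degree K) * Q" by (simp add: power_add mult_ac)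
    also have "\<dots> = hmg (N * p + q + (n + degree K)) (ev X Y F)"
      unfolding Q_def using dF by (rule hmg_raise)
    also have "\<dots> = lam ^ (N * p + q) * hmg (n + degree K) (D * K)"
      unfolding K by (subst hmg_raise) (auto simp: degree_mult_bound add.commute)
    finally show ?thesis by (simp add: hmg_mult)
  qed
  show ?thesis
  proof (intro exI ballI)
    fix c :: "'k bipoly" assume c: "c \<in> {var_x, var_y}"
    have "(lam ^ degree K * lam ^ n * lam ^ M * c) * (lam ^ (N * p) * F)
        - (lam ^ degree K * lam ^ n * lam ^ M * c) * (x' ^ p * Q) \<in> idl f"
      using idl_closed(3)[OF 1] by (simp add: right_diff_distrib)
    moreover have "(lam ^ degree K * lam ^ n * lam ^ M * c) * (x' ^ p * Q)
        = lam ^ (N * p + q) * x' ^ p * hmg (degree K) K * (lam ^ M * (c * hmg n D))"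
      using Q by (simp add: mult_ac)
    then have "(lam ^ degree K * lam ^ n * lam ^ M * c) * (x' ^ p * Q) \<in> idl f"
      by (simp only: idl_closed(3)[OF M[OF c]])
    ultimately have "(lam ^ degree K * lam ^ n * lam ^ M * c) * (lam ^ (N * p) * F) \<in> idl f"
      by (rule idl_cong_mem)
    then show "lam ^ (degree K + n + M + N * p) * (c * F) \<in> idl f"
      by (simp add: power_add mult_ac)
  qed
qed

text \<open>It remains to cross \<open>lam = 0\<close>. Neither \<open>D\<close> nor a suitable
  constant combination \<open>G\<close> of the entries of \<open>g\<close> vanishes there, and c D G
  lies in the ideal. So a power of \<open>z\<close> splits first into multiples of \<open>G\<close>
  and of a power of \<open>lam\<close>, which brings in c D, and then into multiples of
  \<open>D\<close> and of a power of \<open>lam\<close>, which brings in c F.\<close>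

lemma chart_mem:
  assumes F: "bihomogeneous p q F" and dvd: "D dvd ev X Y F"
    and c: "c \<in> {var_x, var_y}" and z: "z \<in> {var_u, var_v}"
  shows "\<exists>N. (c * z) ^ N * F \<in> idl f"
proof -
  have "\<exists>Z. z = hmg 1 Z \<and> degree Z \<le> 1" using z hmg_UV[symmetric] degree_UV by blast
  then obtain Z where Z: "z = hmg 1 Z" "degree Z \<le> 1" by blast
  obtain M where M: "lam ^ M * (c * F) \<in> idl f" using lam_mem[OF F dvd] c by blast
  obtain K where K: "lam ^ K * (c * hmg n D) \<in> idl f" using lam_D_mem c by blast
  obtain o3 where o3: "dot3 o3 (map3 (\<lambda>p. coeff p m) g) \<noteq> 0"
    using dot3_nonzero[OF top_g] by blast
  obtain G where G: "degree G = m" "G \<noteq> 0" "hmg m G * (c * hmg n D) \<in> idl f"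
  proof -
    define p where "p = map3 (\<lambda>c. [:c:]) o3"
    have p: "vdeg 0 p" "coeff (dot3 p g) m \<noteq> 0"
      using o3 unfolding p_def by (cases g; cases o3; simp add: v3_defs vdeg_def)+
    have "degree (dot3 p g) = m" using degree_dot3[OF p(1) vdeg_g] le_degree[OF p(2)] by simp
    moreover have "dot3 p g \<noteq> 0" using p(2) by auto
    moreover have "hmg m (dot3 p g) * (c * hmg n D) \<in> idl f"
      using minors_mem[OF p(1)] c by (auto simp: mult.left_commute)
    ultimately show ?thesis using that by blast
  qed
  obtain s s1 where 1: "z ^ n = hmg n D * s + lam * s1"
    using hmg_lam_comaximal[OF refl D_nz Z(2)] Z(1) by blast
  obtain t t1 where 2: "z ^ m = hmg m G * t + lam * t1"
    using hmg_lam_comaximal[OF G(1,2) Z(2)] Z(1) by blast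
  obtain s' where s': "z ^ (n * M) = hmg n D * s' + (lam * s1) ^ M"
    using power_sum_ideal[OF 1] by (metis power_mult)
  obtain t' where t': "z ^ (m * K) = hmg m G * t' + (lam * t1) ^ K"
    using power_sum_ideal[OF 2] by (metis power_mult)
  have "z ^ (m * K) * (c * hmg n D) = t' * (hmg m G * (c * hmg n D)) + t1 ^ K * (lam ^ K * (c * hmg n D))"
    unfolding t' by (simp add: power_mult_distrib algebra_simps)
  then have 3: "z ^ (m * K) * (c * hmg n D) \<in> idl f"
    using G(3) K by (auto intro: idl_closed)
  have "z ^ (m * K + n * M) * (c * F) = s' * F * (z ^ (m * K) * (c * hmg n D))
      + z ^ (m * K) * s1 ^ M * (lam ^ M * (c * F))"
    unfolding power_add s' by (simp add: power_mult_distrib algebra_simps)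
  then have 4: "z ^ (m * K + n * M) * (c * F) \<in> idl f"
    using 3 M by (auto intro: idl_closed)
  have "(c * z) ^ Suc (m * K + n * M) * F = c ^ (m * K + n * M) * z * (z ^ (m * K + n * M) * (c * F))"
    by (simp add: power_mult_distrib algebra_simps)
  then show ?thesis using idl_closed(3)[OF 4] by metis
qed

text \<open>Homogenized form of x a + y b = D x' C + (y + r x') e. The generator \<open>h1\<close>
  carries spare powers of \<open>lam\<close> because x' D is known to lie in the ideal only up to
  such powers.\<close>

lemma two_generators:
  obtains h1 h2 N where "h1 \<in> idl f" "h2 \<in> idl f"
    "\<And>F. F \<in> idl f \<Longrightarrow> \<exists>s t. lam ^ N * F = s * h1 + t * h2"
proof -
  obtain k1 k2 k3 where "vdeg k1 w" "vdeg k2 C" "vdeg k3 e" using vdeg_exists by meson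
  then obtain k where k: "vdeg k w" "vdeg k C" "vdeg k e"
    by (metis max.cobounded1 max.cobounded2 vdeg_mono)
  define N where "N = 2 * k + 2"
  note sg = second_generator[OF k(1,2), folded N_def]
  obtain M where M: "lam ^ M * (var_x * hmg n D) \<in> idl f" "lam ^ M * (var_y * hmg n D) \<in> idl f"
    using lam_D_mem by blast
  define h1 where "h1 = x' * hmg (N + M + n) D"
  define h2 where "h2 = var_x * hmg N r + var_y * hmg N X"
  have "h1 = lam ^ N * (lam ^ M * (var_x * hmg n D)) - lam ^ N * bconst \<xi> * (lam ^ M * (var_y * hmg n D))"
    unfolding h1_def x'_def using hmg_raise[of D n "N + M"]
    by (simp add: algebra_simps power_add)
  then have h1: "h1 \<in> idl f" using M by (auto intro: idl_closed)
  \<comment> \<open>\<open>T\<close> balances the degrees in u, v: 2 for \<open>f\<close>, and N + M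
    + n + k for the right-hand side. The subtraction is safe since \<open>N\<close> is at least
    2.\<close>
  define T where "T = N + M + n + k - 2"
  have r: "smul3 (hmg (N + M + n) s) (hmg3 k v) = hmg3 (N + M + n + k) (smul3 s v)"
    if "vdeg k v" "degree s \<le> N + M + n" for s v
    using that by (intro hmg3_mult(1)) auto
  have T: "T + 2 = N + M + n + k" using sg by (simp add: T_def N_def)
  have ra: "smul3 (lam ^ T) (hmg3 2 v) = hmg3 (N + M + n + k) v" if "vdeg 2 v" for v
    using hmg3_mult(1)[OF that, of 1 T] T by (simp add: hmg_1 smul3_linear)
  have dr: "degree r \<le> N + M + n" "degree X \<le> N + M + n" using sg by auto
  have bv: "v - smul3 [:\<xi>:] (smul3 r v + smul3 D C) = smul3 X v - smul3 ([:\<xi>:] * D) C" for v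
    by (simp add: X_def smul3_linear algebra_simps)
  have be: "b = smul3 X e - smul3 ([:\<xi>:] * D) C"
    using bv[of e] a_eq b_eq by metis
  have Hv: "hmg3 (N + M + n + k) (smul3 r v + smul3 D C)
      = smul3 (hmg (N + M + n) r) (hmg3 k v) + smul3 (hmg (N + M + n) D) (hmg3 k C)"
    "hmg3 (N + M + n + k) (smul3 X v - smul3 ([:\<xi>:] * D) C)
      = smul3 (hmg (N + M + n) X) (hmg3 k v) - smul3 (bconst \<xi> * hmg (N + M + n) D) (hmg3 k C)"
    if "vdeg k v" for v
    by (simp_all add: hmg3_linear r[symmetric] k dr that hmg_linear)
  have Ha: "hmg3 (N + M + n + k) a = smul3 (hmg (N + M + n) r) (hmg3 k e) + smul3 (hmg (N + M + n) D) (hmg3 k C)"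
    using Hv(1)[OF k(3)] a_eq by simp
  have Hb: "hmg3 (N + M + n + k) b
      = smul3 (hmg (N + M + n) X) (hmg3 k e) - smul3 (bconst \<xi> * hmg (N + M + n) D) (hmg3 k C)"
    using Hv(2)[OF k(3)] unfolding be[symmetric] .
  have "smul3 (lam ^ T) f = smul3 var_x (hmg3 (N + M + n + k) a) + smul3 var_y (hmg3 (N + M + n + k) b)"
    unfolding form1_def ra[OF deg_ab(1), symmetric] ra[OF deg_ab(2), symmetric]
    by (simp add: smul3_linear mult.commute)
  also have "\<dots> = smul3 h1 (hmg3 k C) + smul3 (lam ^ (M + n) * h2) (hmg3 k e)"
  proof -
    have "smul3 x (smul3 s v + smul3 t v') + smul3 y (smul3 s' v - smul3 (c * t) v')
      = smul3 ((x - c * y) * t) v' + smul3 (x * s + y * s') v" for x y s s' t c and v v' :: "'k bipoly v3"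
      by (cases v; cases v') (simp add: v3_defs algebra_simps)
    moreover have "var_x * hmg (N + M + n) r + var_y * hmg (N + M + n) X = lam ^ (M + n) * h2"
      unfolding h2_def using hmg_raise[OF sg(1), of "M + n"] hmg_raise[OF sg(2), of "M + n"]
      by (simp add: algebra_simps)
    ultimately show ?thesis unfolding Ha Hb h1_def x'_def by simp
  qed
  finally have Tf: "smul3 (lam ^ T) f = smul3 h1 (hmg3 k C) + smul3 (lam ^ (M + n) * h2) (hmg3 k e)" .
  have "\<exists>s t. lam ^ T * F = s * h1 + t * h2" if "F \<in> idl f" for F
  proof -
    obtain h where "F = dot3 h f" using \<open>F \<in> idl f\<close> unfolding idl_def by blast
    then have "lam ^ T * F = dot3 h (smul3 (lam ^ T) f)" by (simp add: dot3_linear)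
    also have "\<dots> = dot3 h (hmg3 k C) * h1 + (lam ^ (M + n) * dot3 h (hmg3 k e)) * h2"
      unfolding Tf by (simp add: dot3_linear mult_ac)
    finally show ?thesis by blast
  qed
  with h1 sg(3) that show ?thesis unfolding h2_def by blast
qed

text \<open>\<open>lam\<close> is a unit in the localization and absorbs the power in
  \<open>two_generators\<close>.\<close>

lemma localize_two_generators:
  assumes P: "prime_ideal P" and lam: "lam \<notin> P"
  shows "\<exists>g h. g \<in> localize (- P) UNIV \<and> h \<in> localize (- P) UNIV \<and>
           localize (- P) (idl f) = {r * g + s * h | r s. r \<in> localize (- P) UNIV \<and> s \<in> localize (- P) UNIV}"
proof -
  obtain h1 h2 N where h: "h1 \<in> idl f" "h2 \<in> idl f"
    "\<And>F. F \<in> idl f \<Longrightarrow> \<exists>s t. lam ^ N * F = s * h1 + t * h2" using two_generators by metis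
  have P1: "1 \<notin> P" "0 \<in> P" and Pm: "\<And>s t. s \<notin> P \<Longrightarrow> t \<notin> P \<Longrightarrow> s * t \<notin> P"
    using P unfolding prime_ideal_def by blast+
  have lamN: "lam ^ N \<notin> P" by (induction N) (auto simp: P1 Pm lam)
  define g where "g = Fract h1 1"
  define h where "h = Fract h2 1"
  have loc: "Fract p 1 \<in> localize (- P) UNIV" for p unfolding localize_def using P1 by blast
  have "localize (- P) (idl f) \<subseteq> {r * g + s * h | r s. r \<in> localize (- P) UNIV \<and> s \<in> localize (- P) UNIV}"
  proof
    fix x assume "x \<in> localize (- P) (idl f)"
    then obtain F t where x: "x = Fract F t" "F \<in> idl f" "t \<notin> P" unfolding localize_def by blast
    then obtain s s' where s: "lam ^ N * F = s * h1 + s' * h2" using h(3) by blast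
    have t: "lam ^ N * t \<notin> P" "t \<noteq> 0" "lam ^ N * t \<noteq> 0" using Pm lamN x P1 by auto
    have "x = Fract (lam ^ N * F) (lam ^ N * t)" using t x by (simp add: mult_fract_cancel)
    also have "\<dots> = Fract s (lam ^ N * t) * g + Fract s' (lam ^ N * t) * h"
      unfolding s g_def h_def using t by (simp add: eq_fract algebra_simps)
    finally show "x \<in> {r * g + s * h | r s. r \<in> localize (- P) UNIV \<and> s \<in> localize (- P) UNIV}"
      using t unfolding localize_def by blast
  qed
  moreover have "{r * g + s * h | r s. r \<in> localize (- P) UNIV \<and> s \<in> localize (- P) UNIV} \<subseteq> localize (- P) (idl f)"
  proof
    fix x assume "x \<in> {r * g + s * h | r s. r \<in> localize (- P) UNIV \<and> s \<in> localize (- P) UNIV}"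
    then obtain p s p' s' where x: "x = Fract p s * g + Fract p' s' * h" "s \<notin> P" "s' \<notin> P"
      unfolding localize_def by blast
    then have nz: "s \<noteq> 0" "s' \<noteq> 0" using P1 by auto
    have "x = Fract (p * h1 * s' + p' * h2 * s) (s * s')"
      unfolding x(1) g_def h_def using nz by simp
    moreover have "p * h1 * s' + p' * h2 * s \<in> idl f" using h by (auto intro: idl_closed)
    ultimately show "x \<in> localize (- P) (idl f)" unfolding localize_def using Pm x by blast
  qed
  ultimately show ?thesis using loc unfolding g_def h_def by blast
qed

end

section \<open>Dimension counting\<close>

lemma vector_space_smult: "vector_space (smult :: 'k::field \<Rightarrow> _)"
  by unfold_locales (simp_all add: smult_add_left smult_add_right)

text \<open>Polynomials of degree below \<open>n\<close>, that is residues modulo a polynomial of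
  degree \<open>n\<close>, are the model space of all three dimension counts; \<open>p = 0\<close>
  is listed separately for the case \<open>n = 0\<close>.\<close>

lemma poly_monom_basis:
  fixes n :: nat
  defines "B \<equiv> (monom (1::'k::field)) ` {..<n}"
  shows "module.span smult B = {p. p = 0 \<or> degree p < n}" "\<not> module.dependent smult B" "card B = n"
proof -
  interpret P: vector_space "smult :: 'k \<Rightarrow> _" by (rule vector_space_smult)
  have inj: "inj_on (monom (1::'k)) {..<n}" by (auto simp: inj_on_def monom_eq_iff')
  then show "card B = n" unfolding B_def by (simp add: card_image)
  have fin: "finite B" unfolding B_def by simp
  show "P.independent B"
    unfolding P.dependent_finite[OF fin]
  proof (intro notI, elim exE conjE bexE)
    fix u v assume v: "v \<in> B" "u v \<noteq> 0" and s: "(\<Sum>v\<in>B. smult (u v) v) = 0"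
    from v obtain i where i: "i < n" "v = monom 1 i" unfolding B_def by auto
    have "0 = coeff (\<Sum>j<n. monom (u (monom 1 j)) j) i"
      using s unfolding B_def by (simp add: sum.reindex[OF inj] smult_monom)
    also have "\<dots> = u v" using i by (simp add: coeff_sum)
    finally show False using v by simp
  qed
  show "P.span B = {p. p = 0 \<or> degree p < n}"
  proof
    have "P.subspace {p :: 'k poly. p = 0 \<or> degree p < n}"
      by (rule P.subspaceI) (auto intro: degree_add_less le_less_trans[OF degree_smult_le])
    then show "P.span B \<subseteq> {p. p = 0 \<or> degree p < n}"
      by (rule P.span_minimal[rotated]) (auto simp: B_def degree_monom_eq)
    show "{p. p = 0 \<or> degree p < n} \<subseteq> P.span B"
    proof
      fix p :: "'k poly" assume "p \<in> {p. p = 0 \<or> degree p < n}"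
      then show "p \<in> P.span B"
      proof (cases "p = 0")
        case False
        with \<open>p \<in> _\<close> have "degree p < n" by simp
        then have "p = (\<Sum>i\<le>n - 1. monom (coeff p i) i)" by (simp add: poly_as_sum_of_monoms')
        also have "\<dots> = (\<Sum>i\<le>n - 1. smult (coeff p i) (monom 1 i))" by (simp add: smult_monom)
        also have "\<dots> \<in> P.span B"
          using \<open>degree p < n\<close> by (intro P.span_sum P.span_scale P.span_base) (auto simp: B_def)
        finally show ?thesis .
      qed (simp add: P.span_zero)
    qed
  qed
qed

text \<open>\<open>T\<close> is linear on \<open>V\<close> only, so both parts go through bases:
  \<open>S\<close> lifts the monomials to preimages in \<open>V\<close>, and \<open>T'\<close>
  extends \<open>T\<close> linearly from \<open>B\<close>. The second claim concerns every quotient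
  basis because \<open>quotient_dim\<close> chooses one.\<close>

lemma quotient_basis_poly:
  fixes scale :: "'k::field \<Rightarrow> 'v::ab_group_add \<Rightarrow> 'v" and T :: "'v \<Rightarrow> 'k poly"
  assumes vs: "vector_space scale"
    and V: "module.subspace scale V"
    and add: "\<And>x y. x \<in> V \<Longrightarrow> y \<in> V \<Longrightarrow> T (x + y) = T x + T y"
    and sc: "\<And>c x. x \<in> V \<Longrightarrow> T (scale c x) = smult c (T x)"
    and ker: "W = {x \<in> V. T x = 0}"
    and img: "T ` V = {p. p = 0 \<or> degree p < n}"
  shows "\<exists>B. quotient_basis scale V W B" "quotient_basis scale V W B \<Longrightarrow> card B = n"
proof -
  interpret vs: vector_space scale by (rule vs)
  interpret P: vector_space "smult :: 'k \<Rightarrow> _" by (rule vector_space_smult)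
  interpret VP: vector_space_pair scale "smult :: 'k \<Rightarrow> _" by unfold_locales
  interpret PV: vector_space_pair "smult :: 'k \<Rightarrow> _" scale by unfold_locales
  define M where "M = (monom (1::'k)) ` {..<n}"
  note M = poly_monom_basis[where 'k = 'k and n = n, folded M_def]
  have zero: "0 \<in> V" using V by (rule vs.subspace_0)
  have T0: "T 0 = 0" using sc[OF zero, of 0] by simp
  have diff: "T (x - y) = T x - T y" if "x \<in> V" "y \<in> V" for x y
    using add[of x "- y"] sc[of y "-1"] that vs.subspace_neg[OF V] by simp
  show "\<exists>B. quotient_basis scale V W B"
  proof -
    have "\<forall>m\<in>M. \<exists>x\<in>V. T x = m"
    proof
      fix m assume "m \<in> M"
      then have "m \<in> T ` V" using M(1) P.span_base img by blast
      then show "\<exists>x\<in>V. T x = m" by blast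
    qed
    then obtain s where s: "\<And>m. m \<in> M \<Longrightarrow> s m \<in> V \<and> T (s m) = m" by metis
    define S where "S = PV.construct M s"
    have lin: "Vector_Spaces.linear smult scale S" unfolding S_def using M(2) by (rule PV.linear_construct)
    have S: "S p \<in> V \<and> T (S p) = p" if "p \<in> P.span M" for p
      using that
    proof (induction rule: P.span_induct_alt)
      case base
      then show ?case by (simp add: PV.linear_0[OF lin] zero T0)
    next
      case (step c x y)
      have "S x = s x" unfolding S_def using M(2) step(1) by (rule PV.construct_basis)
      then show ?case using s[OF step(1)] step
        by (auto simp: PV.linear_add[OF lin] PV.linear_scale[OF lin] add sc
            intro!: vs.subspace_add[OF V] vs.subspace_scale[OF V])
          (metis V add sc vs.subspace_scale)
    qed
    have inj: "inj_on S (P.span M)" by (rule inj_on_inverseI[of _ T]) (use S in blast)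
    have span: "vs.span (S ` M) = S ` P.span M" by (rule PV.linear_span_image[OF lin])
    have "quotient_basis scale V W (S ` M)"
      unfolding quotient_basis_def span
    proof (intro conjI)
      show "S ` M \<subseteq> V" using S P.span_base by blast
      show "vs.independent (S ` M)" using PV.linear_independent_injective_image[OF lin M(2) inj] .
      show "S ` P.span M \<inter> W = {0}"
      proof
        show "S ` P.span M \<inter> W \<subseteq> {0}" using S ker PV.linear_0[OF lin] by force
        show "{0} \<subseteq> S ` P.span M \<inter> W"
          using P.span_zero PV.linear_0[OF lin] zero T0 by (auto simp: ker image_iff intro!: bexI[of _ 0])
      qed
      show "V = {b + w |b w. b \<in> S ` P.span M \<and> w \<in> W}"
      proof
        show "V \<subseteq> {b + w |b w. b \<in> S ` P.span M \<and> w \<in> W}"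
        proof
          fix x assume x: "x \<in> V"
          then have Tx: "T x \<in> P.span M" using img M(1) by blast
          have "x = S (T x) + (x - S (T x))" by simp
          moreover have "x - S (T x) \<in> W"
            using S[OF Tx] x by (simp add: ker diff vs.subspace_diff[OF V])
          ultimately show "x \<in> {b + w |b w. b \<in> S ` P.span M \<and> w \<in> W}" using Tx by blast
        qed
        show "{b + w |b w. b \<in> S ` P.span M \<and> w \<in> W} \<subseteq> V"
          using S vs.subspace_add[OF V] ker by blast
      qed
    qed
    then show ?thesis by blast
  qed
  assume qb: "quotient_basis scale V W B"
  then have B: "B \<subseteq> V" "vs.independent B" "vs.span B \<inter> W = {0}" "V = {b + w |b w. b \<in> vs.span B \<and> w \<in> W}"
    unfolding quotient_basis_def by auto
  have spV: "vs.span B \<subseteq> V" using B(1) V by (rule vs.span_minimal)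
  define T' where "T' = VP.construct B T"
  have lin: "Vector_Spaces.linear scale smult T'" unfolding T'_def using B(2) by (rule VP.linear_construct)
  have "T' x = T x \<and> x \<in> V" if "x \<in> vs.span B" for x
    using that
  proof (induction rule: vs.span_induct_alt)
    case base
    then show ?case by (simp add: VP.linear_0[OF lin] T0 zero)
  next
    case (step c x y)
    have "T' x = T x" unfolding T'_def using B(2) step(1) by (rule VP.construct_basis)
    moreover have "x \<in> V" "y \<in> V" "scale c x \<in> V"
      using step B(1) vs.subspace_scale[OF V] by auto
    ultimately show ?case using step
      by (simp add: VP.linear_add[OF lin] VP.linear_scale[OF lin] add sc vs.subspace_add[OF V])
  qed
  then have T': "T' x = T x" if "x \<in> vs.span B" for x using that by blast
  have inj: "inj_on T' (vs.span B)"
  proof (rule inj_onI)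
    fix x y assume xy: "x \<in> vs.span B" "y \<in> vs.span B" "T' x = T' y"
    then have "x - y \<in> vs.span B" by (intro vs.span_diff)
    moreover have "T (x - y) = 0" using xy diff spV T' by (metis right_minus_eq subsetD)
    ultimately have "x - y \<in> vs.span B \<inter> W" using spV ker by blast
    then show "x = y" using B(3) by simp
  qed
  have "P.independent (T' ` B)" using VP.linear_independent_injective_image[OF lin B(2) inj] .
  moreover have "P.span (T' ` B) = P.span M"
  proof -
    have "P.span (T' ` B) = T' ` vs.span B" by (rule VP.linear_span_image[OF lin])
    also have "\<dots> = T ` vs.span B" using T' by (intro image_cong) auto
    also have "\<dots> = T ` V"
    proof
      show "T ` vs.span B \<subseteq> T ` V" using spV by blast
      show "T ` V \<subseteq> T ` vs.span B"
      proof
        fix p assume "p \<in> T ` V"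
        then obtain b w where "b \<in> vs.span B" "w \<in> W" "p = T (b + w)" using B(4) by blast
        moreover then have "T (b + w) = T b" using add spV ker by auto
        ultimately show "p \<in> T ` vs.span B" by blast
      qed
    qed
    also have "\<dots> = P.span M" using img M(1) by simp
    finally show ?thesis .
  qed
  ultimately have "card (T' ` B) = card M"
    using P.dim_eq_card[of M "P.span M"] P.dim_eq_card[of "T' ` B" "P.span M"] M(2) P.span_span by metis
  moreover have "card (T' ` B) = card B"
    using inj_on_subset[OF inj vs.span_superset] by (rule card_image)
  ultimately show "card B = n" using M(3) by simp
qed

lemma quotient_dim_poly:
  fixes scale :: "'k::field \<Rightarrow> 'v::ab_group_add \<Rightarrow> 'v" and T :: "'v \<Rightarrow> 'k poly"
  assumes "vector_space scale" "module.subspace scale V"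
    and "\<And>x y. x \<in> V \<Longrightarrow> y \<in> V \<Longrightarrow> T (x + y) = T x + T y"
    and "\<And>c x. x \<in> V \<Longrightarrow> T (scale c x) = smult c (T x)"
    and "W = {x \<in> V. T x = 0}"
    and "T ` V = {p. p = 0 \<or> degree p < n}"
  shows "quotient_dim scale V W = n"
  unfolding quotient_dim_def
  using quotient_basis_poly(2)[OF assms] someI_ex[OF quotient_basis_poly(1)[OF assms]] by blast

lemma dim_poly:
  fixes scale :: "'k::field \<Rightarrow> 'v::ab_group_add \<Rightarrow> 'v" and T :: "'v \<Rightarrow> 'k poly"
  assumes vs: "vector_space scale" and V: "module.subspace scale V"
    and add: "\<And>x y. x \<in> V \<Longrightarrow> y \<in> V \<Longrightarrow> T (x + y) = T x + T y"
    and sc: "\<And>c x. x \<in> V \<Longrightarrow> T (scale c x) = smult c (T x)"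
    and ker: "\<And>x. x \<in> V \<Longrightarrow> T x = 0 \<Longrightarrow> x = 0"
    and img: "T ` V = {p. p = 0 \<or> degree p < n}"
  shows "vector_space.dim scale V = n"
proof -
  interpret vs: vector_space scale by (rule vs)
  obtain B where B: "B \<subseteq> V" "vs.independent B" "V \<subseteq> vs.span B" "card B = vs.dim V"
    using vs.basis_exists by blast
  have zero: "0 \<in> V" using V by (rule vs.subspace_0)
  have "T 0 = 0" using sc[OF zero, of 0] by simp
  then have W: "{0} = {x \<in> V. T x = 0}" using ker zero by blast
  have sp: "vs.span B = V" using B(3) vs.span_minimal[OF B(1) V] by blast
  have "quotient_basis scale V {0} B"
    unfolding quotient_basis_def sp using B zero by auto
  from quotient_basis_poly(2)[OF vs V add sc W img this] B(4) show ?thesis by simp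
qed

section \<open>Syzygies\<close>

text \<open>Up to the determinant, c \<times> e, e \<times> w, w \<times> c is the basis dual to w,
  c, e.\<close>

lemma dual_expand:
  "smul3 (dot3 w (cross3 c e)) v = smul3 (dot3 v w) (cross3 c e) + smul3 (dot3 v c) (cross3 e w)
     + smul3 (dot3 v e) (cross3 w c)"
  by (cases v; cases w; cases c; cases e) (simp add: v3_defs algebra_simps)

lemma cross3_both_zero:
  fixes v :: "'a::idom v3"
  assumes "cross3 v a = 0" "cross3 v b = 0" "v \<noteq> 0"
  shows "cross3 a b = 0"
proof -
  obtain n where n: "dot3 n v \<noteq> 0" using dot3_nonzero[OF assms(3)] by blast
  have *: "smul3 (dot3 n v) c = smul3 (dot3 n c) v" if "cross3 v c = 0" for c
  proof -
    have "cross3 n (cross3 v c) = 0" by (simp add: that cross3_linear)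
    then show ?thesis by (simp add: cross3_cross3)
  qed
  have "smul3 (dot3 n v) (smul3 (dot3 n v) (cross3 a b)) = cross3 (smul3 (dot3 n v) a) (smul3 (dot3 n v) b)"
    by (simp add: cross3_linear smul3_linear)
  also have "\<dots> = 0" unfolding *[OF assms(1)] *[OF assms(2)] by (simp add: cross3_linear cross3_self smul3_linear)
  finally show ?thesis using n by (simp add: smul3_eq_0_iff)
qed

definition syzp :: "'k::field bipoly v3 \<Rightarrow> nat \<Rightarrow> nat \<Rightarrow> 'k bipoly v3 set" where
  "syzp f p q = {s. dot3 s f = 0 \<and> all3 (bihomogeneous p q) s}"

lemma syz_part_syzp: "syz_part f0 f1 f2 p q = syzp (f0, f1, f2) p q"
  by (auto simp: syz_part_def syz_def syzp_def v3_defs)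

lemma scale3_smul3: "scale3 c s = smul3 (bconst c) s"
  by (cases s) (simp add: scale3_def smul3_def)

lemma subspace_syzp: "module.subspace scale3 (syzp f p q)"
proof -
  interpret vector_space "scale3 :: 'a \<Rightarrow> _" by (rule vector_space_scale3)
  show ?thesis
  proof (rule subspaceI)
    show "0 \<in> syzp f p q" by (cases f) (simp add: syzp_def v3_defs zero_prod_def bihomogeneous_0)
    fix s t c assume st: "s \<in> syzp f p q" 
    then show "scale3 c s \<in> syzp f p q"
      by (cases s) (simp add: scale3_smul3 syzp_def dot3_linear, simp add: v3_defs bihomogeneous_const_mult)
    assume "t \<in> syzp f p q"
    with st show "s + t \<in> syzp f p q"
      by (cases s; cases t) (simp add: syzp_def dot3_linear del: add_Pair, simp add: v3_defs bihomogeneous_add)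
  qed
qed

context base
begin

definition evw :: "'k bipoly v3 \<Rightarrow> 'k poly" where
  "evw s = dot3 w (map3 (ev X Y) s)"

lemma evw_linear: "evw (s + t) = evw s + evw t" "evw (scale3 c s) = smult c (evw s)"
proof -
  show "evw (s + t) = evw s + evw t" by (simp add: evw_def map3_rhom[OF rhom_ev] dot3_linear)
  have "map3 (ev X Y) (scale3 c s) = smul3 [:c:] (map3 (ev X Y) s)"
    by (cases s) (simp add: scale3_smul3 v3_defs ev_simps ev_vars)
  then show "evw (scale3 c s) = smult c (evw s)" by (simp add: evw_def dot3_linear)
qed

text \<open>A vector orthogonal to \<open>a\<close> and \<open>b\<close> is parallel to
  \<open>a \<times> b\<close>, hence to \<open>g\<close>; primitivity of \<open>g\<close> makes the
  multiplier a polynomial.\<close>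

lemma common_syzygy:
  assumes "dot3 c a = 0" "dot3 c b = 0"
  shows "c = smul3 (dot3 w c) g"
proof -
  have "smul3 D (cross3 c g) = cross3 c (cross3 a b)" by (simp add: cross_ab cross3_linear)
  also have "\<dots> = 0" by (simp add: cross3_cross3 assms smul3_linear)
  finally have "cross3 c g = 0" using D_nz by (simp add: smul3_eq_0_iff)
  then have "cross3 w (cross3 c g) = 0" by (simp add: cross3_linear)
  then show ?thesis by (simp add: cross3_cross3 wg smul3_linear)
qed

lemma dot_g: "dot3 g a = 0" "dot3 g b = 0"
proof -
  have "D * dot3 g a = 0" "D * dot3 g b = 0"
    using dot3_cross3(1)[of a b] dot3_cross3(2)[of b a] by (simp_all only: cross_ab dot3_linear dot3_commute[of g])
  then show "dot3 g a = 0" "dot3 g b = 0" using D_nz by simp_all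
qed

lemma m_le: "vdeg k g \<Longrightarrow> m \<le> k"
proof (rule ccontr)
  assume "vdeg k g" "\<not> m \<le> k"
  then have "map3 (\<lambda>p. coeff p m) g = 0"
    by (cases g) (auto simp: v3_defs vdeg_def zero_prod_def intro!: coeff_eq_0)
  with top_g show False by simp
qed

lemma dot3_f_eq_0:
  assumes "dot3 s f = 0"
  shows "dot3 (map3 (ev X' Y') s) (smul3 X' a + smul3 Y' b) = 0"
proof -
  have "dot3 (map3 (ev X' Y') s) (map3 (ev X' Y') f) = 0"
    by (simp add: map3_rhom[OF rhom_ev] assms ev_simps)
  then show ?thesis using ev_form1[OF deg_ab] by simp
qed

lemma all3_hmg:
  assumes "all3 (bihomogeneous 0 q) s"
  obtains c where "vdeg q c" "s = hmg3 q c"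
proof
  show "vdeg q (map3 (ev 0 0) s)"
    using assms by (cases s) (simp add: vdeg_def v3_defs bihomogeneous_0_hmg)
  show "s = hmg3 q (map3 (ev 0 0) s)"
    using assms by (cases s) (simp add: v3_defs bihomogeneous_0_hmg)
qed

text \<open>A nonzero syzygy of this kind is p g with degree of p at most 1 - m, and pairing with
  \<open>w\<close> recovers p. Truncated subtraction gives 0 for m \<ge> 2.\<close>

lemma syz_01_dim: "vector_space.dim scale3 (syzp f 0 1) = 2 - m"
proof (rule dim_poly[where T = evw, OF vector_space_scale3 subspace_syzp])
  show "evw (s + t) = evw s + evw t" for s t by (rule evw_linear)
  show "evw (scale3 c s) = smult c (evw s)" for c s by (rule evw_linear)
  have *: "\<exists>c. vdeg 1 c \<and> s = hmg3 1 c \<and> evw s = dot3 w c \<and> c = smul3 (dot3 w c) g" if s: "s \<in> syzp f 0 1" for s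
  proof -
    have s0: "dot3 s f = 0" "all3 (bihomogeneous 0 1) s" using s by (auto simp: syzp_def)
    obtain c where c: "vdeg 1 c" "s = hmg3 1 c" using all3_hmg[OF s0(2)] .
    have ev: "map3 (ev X' Y') s = c" for X' Y'
      using c by (cases c) (simp add: v3_defs vdeg_def ev_hmg)
    have "dot3 c a = 0" "dot3 c b = 0"
      using dot3_f_eq_0[OF s0(1), of 1 0] dot3_f_eq_0[OF s0(1), of 0 1] by (simp_all add: ev smul3_linear)
    with c common_syzygy show ?thesis unfolding evw_def ev by blast
  qed
  show "s = 0" if "s \<in> syzp f 0 1" "evw s = 0" for s
    using *[OF that(1)] that(2) by (auto simp: smul3_linear hmg3_linear)
  show "evw ` syzp f 0 1 = {p. p = 0 \<or> degree p < 2 - m}"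
  proof
    show "evw ` syzp f 0 1 \<subseteq> {p. p = 0 \<or> degree p < 2 - m}"
    proof clarify
      fix s assume "s \<in> syzp f 0 1" and nz: "\<not> degree (evw s) < 2 - m"
      then obtain c where c: "vdeg 1 c" "evw s = dot3 w c" "c = smul3 (dot3 w c) g" using * by blast
      show "evw s = 0"
      proof (rule ccontr)
        assume "evw s \<noteq> 0"
        then have "degree (evw s) \<le> 1" "vdeg (1 - degree (evw s)) g"
          using vdeg_cancel[of 1 "evw s" g] c g_nz by auto
        with m_le nz show False by force
      qed
    qed
    show "{p. p = 0 \<or> degree p < 2 - m} \<subseteq> evw ` syzp f 0 1"
    proof
      fix p :: "'k poly" assume p: "p \<in> {p. p = 0 \<or> degree p < 2 - m}"
      define c where "c = smul3 p g"
      have c: "vdeg 1 c"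
      proof (cases "p = 0")
        case True
        then show ?thesis by (cases g) (simp add: c_def v3_defs vdeg_def)
      next
        case False
        then have "degree p + m \<le> 1" using p by auto
        then show ?thesis unfolding c_def using vdeg_smul3[OF vdeg_g order.refl, of p] by (auto elim: vdeg_mono)
      qed
      have "dot3 (hmg3 1 c) f = 0"
        unfolding form1_def by (simp add: dot3_linear hmg3_mult(2)[OF c deg_ab(1), simplified]
            hmg3_mult(2)[OF c deg_ab(2), simplified])
          (simp add: c_def dot3_linear dot_g hmg_linear)
      moreover have "all3 (bihomogeneous 0 1) (hmg3 1 c)"
        using bihomogeneous_hmg[of 1] by (cases c) (simp add: v3_defs)
      moreover have "evw (hmg3 1 c) = p"
      proof -
        have "map3 (ev X Y) (hmg3 1 c) = c" using c by (cases c) (simp add: v3_defs vdeg_def ev_hmg)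
        then show ?thesis by (simp add: evw_def c_def dot3_linear wg)
      qed
      ultimately show "p \<in> evw ` syzp f 0 1" unfolding syzp_def by blast
    qed
  qed
qed

text \<open>A syzygy in the kernel turns out to be of Koszul type l \<times> f, and \<open>l\<close>
  would need degree -1. Conversely, if \<open>l\<close> is congruent to \<rho> e modulo
  \<open>D\<close>, then l \<times> f is divisible by \<open>D\<close>, and the quotient is the
  syzygy sought for \<rho>, up to sign.\<close>

lemma syz_11_dim: "vector_space.dim scale3 (syzp f 1 1) = n"
proof (rule dim_poly[where T = "\<lambda>s. evw s mod D", OF vector_space_scale3 subspace_syzp])
  show "evw (s + t) mod D = evw s mod D + evw t mod D" for s t by (simp add: evw_linear poly_mod_add_left)
  show "evw (scale3 c s) mod D = smult c (evw s mod D)" for c s by (simp add: evw_linear mod_smult_left)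
  show "s = 0" if s: "s \<in> syzp f 1 1" and 0: "evw s mod D = 0" for s
  proof -
    have s0: "dot3 s f = 0" "all3 (bihomogeneous 1 1) s" using s by (auto simp: syzp_def)
    obtain c d where cd: "vdeg 1 c" "vdeg 1 d" "s = form1 1 c d" using form1_exists[OF s0(2)] by blast
    have ev: "map3 (ev X' Y') s = smul3 X' c + smul3 Y' d" for X' Y' unfolding cd(3) by (rule ev_form1[OF cd(1,2)])
    have ca: "dot3 c a = 0" and db: "dot3 d b = 0"
      using dot3_f_eq_0[OF s0(1), of 1 0] dot3_f_eq_0[OF s0(1), of 0 1] by (simp_all add: ev smul3_linear)
    have cb: "dot3 c b + dot3 d a = 0"
      using dot3_f_eq_0[OF s0(1), of 1 1] by (simp add: ev smul3_linear dot3_linear ca db add.commute)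
    \<comment> \<open>In terms of x' and y the syzygy is x' c + y \<tau>, and \<sigma> is its value
      at (\<open>X\<close> : \<open>Y\<close>), where x' = 1 and y = - r.\<close>
    define \<sigma> where "\<sigma> = smul3 X c + smul3 Y d"
    define \<tau> where "\<tau> = d + smul3 [:\<xi>:] c"
    have c: "c = \<sigma> + smul3 r \<tau>"
    proof -
      have "c = smul3 (1 - x * r) c - smul3 r d + smul3 r (d + smul3 x c)" for x
        by (simp add: smul3_linear mult.commute)
      from this[of "[:\<xi>:]"] show ?thesis by (simp add: \<sigma>_def \<tau>_def X_def Y_def smul3_linear)
    qed
    have "dot3 \<sigma> (smul3 D C) = 0"
      using map3_rhom(1)[OF rhom_ev, of X Y s f] by (simp add: s0(1) ev_simps ev ev_f \<sigma>_def)
    then have \<sigma>C: "dot3 \<sigma> C = 0" using D_nz by (simp add: dot3_linear)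
    have \<tau>e: "dot3 \<tau> e = 0"
    proof -
      have "dot3 (d + smul3 x c) (smul3 x a + b) = x * (dot3 c b + dot3 d a) + x * x * dot3 c a + dot3 d b" for x
        by (simp add: dot3_linear algebra_simps)
      from this[of "[:\<xi>:]"] show ?thesis unfolding \<tau>_def by (simp only: ca cb db) simp
    qed
    have ce: "dot3 c e + dot3 \<tau> a = 0"
    proof -
      have "dot3 c (smul3 x a + b) + dot3 (d + smul3 x c) a = (dot3 c b + dot3 d a) + 2 * x * dot3 c a" for x
        by (simp add: dot3_linear algebra_simps)
      from this[of "[:\<xi>:]"] show ?thesis unfolding \<tau>_def by (simp only: ca cb) simp
    qed
    have \<tau>a: "dot3 \<tau> a = D * dot3 \<tau> C"
    proof -
      have "dot3 \<tau> a = dot3 \<tau> (smul3 r e + smul3 D C)" using a_eq by simp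
      also have "\<dots> = r * dot3 \<tau> e + D * dot3 \<tau> C" by (simp only: dot3_linear)
      finally show ?thesis by (simp add: \<tau>e)
    qed
    have "dot3 c e = dot3 \<sigma> e"
    proof -
      have "dot3 c v = dot3 \<sigma> v + r * dot3 \<tau> v" for v by (subst c) (simp add: dot3_linear)
      from this[of e] show ?thesis by (simp only: \<tau>e) simp
    qed
    then have \<sigma>e: "dot3 \<sigma> e = - (D * dot3 \<tau> C)" using ce \<tau>a by (simp add: eq_neg_iff_add_eq_0)
    obtain \<kappa> where \<kappa>: "dot3 \<sigma> w = D * \<kappa>"
      using 0 unfolding evw_def ev \<sigma>_def[symmetric] by (metis dot3_commute dvdE mod_eq_0_iff_dvd)
    \<comment> \<open>Expanding \<tau> and \<sigma> in the basis dual to \<open>w\<close>,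
      \<open>C\<close>, \<open>e\<close> dictates the coefficients of \<open>l\<close>: l \<times> e
      must be \<tau>, and D (l \<times> C) must be \<sigma>. The kernel condition enters as the
      polynomial \<kappa>.\<close>
    define l where "l = smul3 (dot3 \<tau> w) C - smul3 \<kappa> e - smul3 (dot3 \<tau> C) w"
    have det1: "dot3 w (cross3 C e) = 1" using wg cross_C by simp
    have exp: "v = smul3 (dot3 v w) (cross3 C e) + smul3 (dot3 v C) (cross3 e w) + smul3 (dot3 v e) (cross3 w C)" for v
      using dual_expand[of w C e v] by (simp only: det1 smul3_linear(6))
    have le: "cross3 l e = \<tau>"
    proof -
      have "cross3 (smul3 s C - smul3 \<kappa> v - smul3 t w) v = smul3 s (cross3 C v) + smul3 t (cross3 v w)" for s t v
        by (simp add: cross3_linear cross3_self smul3_linear cross3_anti[of w v])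
      from this[where s = "dot3 \<tau> w" and t = "dot3 \<tau> C" and v = e] have "cross3 l e = smul3 (dot3 \<tau> w) (cross3 C e) + smul3 (dot3 \<tau> C) (cross3 e w)"
        unfolding l_def .
      also have "\<dots> = \<tau>" by (subst (5) exp) (simp only: \<tau>e smul3_linear add_0_right)
      finally show ?thesis .
    qed
    have lC: "smul3 D (cross3 l C) = \<sigma>"
    proof -
      have "smul3 D (cross3 (smul3 s C - smul3 \<kappa> v - smul3 t w) C) = smul3 (D * \<kappa>) (cross3 C v) + smul3 (- (D * t)) (cross3 w C)" for s t v
        by (simp add: cross3_linear cross3_self smul3_linear cross3_anti[of v C])
      from this[where s = "dot3 \<tau> w" and t = "dot3 \<tau> C" and v = e]
      have "smul3 D (cross3 l C) = smul3 (dot3 \<sigma> w) (cross3 C e) + smul3 (dot3 \<sigma> e) (cross3 w C)"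
        unfolding l_def \<kappa> \<sigma>e .
      also have "\<dots> = \<sigma>" by (subst (5) exp) (simp only: \<sigma>C smul3_linear add_0_right)
      finally show ?thesis .
    qed
    have la: "cross3 l a = c"
    proof -
      have "cross3 l (smul3 r v + smul3 D C) = smul3 r (cross3 l v) + smul3 D (cross3 l C)" for v
        by (simp add: cross3_linear)
      from this[of e] have "cross3 l a = smul3 r \<tau> + \<sigma>" using a_eq le lC by metis
      then show ?thesis using c by (simp add: add.commute)
    qed
    have lb: "cross3 l b = d"
    proof -
      have "cross3 l b = cross3 l e - smul3 [:\<xi>:] (cross3 l a)" by (simp add: cross3_linear)
      also have "\<dots> = \<tau> - smul3 [:\<xi>:] c" by (simp only: le la)
      finally show ?thesis by (simp add: \<tau>_def)
    qed
    \<comment> \<open>l \<times> a and l \<times> b have degree at most 1, below the bound k + 2, so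
      the top coefficient of \<open>l\<close> is parallel to those of \<open>a\<close> and
      \<open>b\<close>; but these two are independent at \<open>lam = 0\<close>.\<close>
    have "l = 0"
    proof (rule ccontr)
      assume "l \<noteq> 0"
      then obtain k where k: "vdeg k l" "map3 (\<lambda>p. coeff p k) l \<noteq> 0" by (rule vdeg_exact)
      have t0: "map3 (\<lambda>p. coeff p (k + 2)) v = 0" if "vdeg 1 v" for v
        using that by (cases v) (auto simp: v3_defs vdeg_def zero_prod_def intro!: coeff_eq_0)
      have "cross3 (map3 (\<lambda>p. coeff p k) l) (map3 (\<lambda>p. coeff p 2) a) = 0"
        "cross3 (map3 (\<lambda>p. coeff p k) l) (map3 (\<lambda>p. coeff p 2) b) = 0"
        by (simp_all only: cross3_top[OF k(1) deg_ab(1), symmetric] cross3_top[OF k(1) deg_ab(2), symmetric]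
            la lb t0[OF cd(1)] t0[OF cd(2)])
      from cross3_both_zero[OF this k(2)] top show False by simp
    qed
    then show ?thesis using la lb unfolding cd(3) form1_def
      by (simp add: cross3_linear hmg3_linear smul3_linear flip: la lb)
  qed
  show "(\<lambda>s. evw s mod D) ` syzp f 1 1 = {p. p = 0 \<or> degree p < n}"
  proof
    show "(\<lambda>s. evw s mod D) ` syzp f 1 1 \<subseteq> {p. p = 0 \<or> degree p < n}"
      using degree_mod_less[OF D_nz] by auto
    show "{p. p = 0 \<or> degree p < n} \<subseteq> (\<lambda>s. evw s mod D) ` syzp f 1 1"
    proof
      fix \<rho> :: "'k poly" assume "\<rho> \<in> {p. p = 0 \<or> degree p < n}"
      then have \<rho>: "\<rho> mod D = \<rho>" and \<rho>n: "\<rho> = 0 \<or> 0 < n" by (auto intro: mod_poly_less)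
      \<comment> \<open>\<open>l\<close> is \<rho> e reduced modulo \<open>D\<close>. As e \<times>
        a and e \<times> b are multiples of D g, both l \<times> a and l \<times> b are divisible by
        \<open>D\<close>; for \<rho> \<noteq> 0 the reduction keeps their degree at most n + 1, so
        the quotients have degree at most 1.\<close>
      define l where "l = map3 (\<lambda>p. (\<rho> * p) mod D) e"
      define t where "t = map3 (\<lambda>p. (\<rho> * p) div D) e"
      have l: "l = smul3 \<rho> e - smul3 D t"
        unfolding l_def t_def by (cases e) (simp add: v3_defs minus_mult_div_eq_mod)
      define c where "c = - (smul3 \<rho> g + cross3 t a)"
      define d where "d = smul3 [:\<xi>:] (smul3 \<rho> g) - cross3 t b"
      have ea: "cross3 e a = - smul3 D g"
        by (simp add: cross3_linear cross3_self smul3_linear cross3_anti[of b a] cross_ab)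
      have eb: "cross3 e b = smul3 [:\<xi>:] (smul3 D g)"
        by (simp add: cross3_linear cross3_self cross_ab)
      have lv: "cross3 (smul3 \<rho> v - smul3 D t) v' = smul3 \<rho> (cross3 v v') - smul3 D (cross3 t v')" for v v'
        by (simp add: cross3_linear)
      have la: "cross3 l a = smul3 D c"
        unfolding l lv ea c_def by (simp add: smul3_linear mult.commute)
      have lb: "cross3 l b = smul3 D d"
        unfolding l lv eb d_def by (simp add: smul3_linear mult_ac)
      have deg: "vdeg 1 c" "vdeg 1 d"
      proof -
        have "vdeg 1 c \<and> vdeg 1 d"
        proof (cases "\<rho> = 0")
          case True
          then have "t = 0" unfolding t_def by (cases e) (simp add: v3_defs zero_prod_def)
          then have "c = 0" "d = 0" using True by (simp_all add: c_def d_def smul3_linear cross3_linear)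
          then show ?thesis by (simp add: vdeg_def all3_def zero_prod_def)
        next
          case False
          then have "0 < n" using \<rho>n by simp
          have dm: "degree (p mod D) \<le> n - 1" for p using degree_mod_less[OF D_nz, of p] by auto
          have "vdeg (n - 1) l"
            using dm unfolding l_def by (cases e) (simp add: v3_defs vdeg_def)
          have "vdeg (n - 1 + 2) (smul3 D c)" "vdeg (n - 1 + 2) (smul3 D d)"
            using vdeg_cross3[OF \<open>vdeg (n - 1) l\<close> deg_ab(1)] vdeg_cross3[OF \<open>vdeg (n - 1) l\<close> deg_ab(2)]
            unfolding la lb by simp_all
          then have "vdeg (n - 1 + 2 - n) c" "vdeg (n - 1 + 2 - n) d"
            using vdeg_cancel(2)[OF _ D_nz] by blast+
          moreover have "n - 1 + 2 - n = 1" using \<open>0 < n\<close> by simp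
          ultimately show ?thesis by simp
        qed
        then show "vdeg 1 c" "vdeg 1 d" by simp_all
      qed
      have "D * dot3 c a = 0" "D * dot3 d b = 0" "D * (dot3 c b + dot3 d a) = 0"
      proof -
        have "D * dot3 c a = dot3 (smul3 D c) a" "D * dot3 d b = dot3 (smul3 D d) b"
          "D * (dot3 c b + dot3 d a) = dot3 (smul3 D c) b + dot3 (smul3 D d) a"
          by (simp_all add: dot3_linear algebra_simps)
        then show "D * dot3 c a = 0" "D * dot3 d b = 0" "D * (dot3 c b + dot3 d a) = 0"
          unfolding la[symmetric] lb[symmetric]
          by (simp_all add: dot3_commute[of "cross3 _ _"] dot3_cross3)
            (cases l; cases a; cases b; simp add: v3_defs algebra_simps)
      qed
      then have z: "dot3 c a = 0" "dot3 d b = 0" "dot3 c b + dot3 d a = 0" using D_nz by simp_all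
      define s where "s = form1 1 c d"
      have "dot3 s f = var_x * var_x * hmg (1 + 2) (dot3 c a) + var_y * var_y * hmg (1 + 2) (dot3 d b)
        + var_x * var_y * hmg (1 + 2) (dot3 c b + dot3 d a)"
        unfolding s_def form1_def dot3_linear hmg_linear
          hmg3_mult(2)[OF deg(1) deg_ab(1)] hmg3_mult(2)[OF deg(1) deg_ab(2)]
          hmg3_mult(2)[OF deg(2) deg_ab(1)] hmg3_mult(2)[OF deg(2) deg_ab(2)]
        by (simp add: algebra_simps)
      also have "\<dots> = 0" by (simp add: z hmg_linear)
      finally have "dot3 s f = 0" .
      moreover have "all3 (bihomogeneous 1 1) s"
      proof -
        have "bihomogeneous 1 1 (var_x * hmg 1 p + var_y * hmg 1 q)" for p q
          using bihomogeneous_mult[OF bihomogeneous_basic(3) bihomogeneous_hmg]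
            bihomogeneous_mult[OF bihomogeneous_basic(4) bihomogeneous_hmg]
          by (intro bihomogeneous_add) force+
        then show ?thesis unfolding s_def form1_def by (cases c; cases d) (simp add: v3_defs)
      qed
      ultimately have s: "s \<in> syzp f 1 1" by (simp add: syzp_def)
      have ev: "map3 (ev X Y) s = smul3 X c + smul3 Y d" unfolding s_def by (rule ev_form1[OF deg])
      have "smul3 D (map3 (ev X Y) s) = cross3 l (smul3 X a + smul3 Y b)"
        unfolding ev by (simp only: cross3_linear la lb smul3_linear mult.commute)
      also have "\<dots> = smul3 D (cross3 l C)"
        using ev_f ev_form1[OF deg_ab, of X Y] by (simp add: cross3_linear)
      finally have "map3 (ev X Y) s = cross3 l C" using D_nz by (simp add: smul3_cancel)
      then have "evw s = dot3 w (cross3 l C)" by (simp add: evw_def)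
      also have "\<dots> = - \<rho> - D * dot3 w (cross3 t C)"
      proof -
        have "dot3 w (cross3 (smul3 \<rho> v - smul3 D t) C) = - (\<rho> * dot3 w (cross3 C v)) - D * dot3 w (cross3 t C)" for v
          by (simp add: cross3_linear dot3_linear cross3_anti[of v C])
        from this[of e] show ?thesis unfolding l cross_C wg by simp
      qed
      \<comment> \<open>The sign comes from e \<times> C = - g.\<close>
      finally have "evw (scale3 (-1) s) mod D = \<rho>"
        using \<rho> by (simp add: evw_linear)
      moreover have "scale3 (-1) s \<in> syzp f 1 1"
      proof -
        interpret vector_space "scale3 :: 'k \<Rightarrow> _" by (rule vector_space_scale3)
        show ?thesis using subspace_scale[OF subspace_syzp s] .
      qed
      ultimately show "\<rho> \<in> (\<lambda>s. evw s mod D) ` syzp f 1 1" by (metis imageI)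
    qed
  qed
qed

end

section \<open>Sections over the base scheme\<close>

lemma chart_eq: "chart (i, j) = (if i then var_y else var_x) * (if j then var_v else var_u)"
  by (simp add: chart_def)

lemma chart_nz: "chart c \<noteq> 0"
  by (cases c) (simp add: chart_eq)

lemma bihomogeneous_chart: "bihomogeneous 1 1 (chart c :: 'k::field bipoly)"
proof -
  have "bihomogeneous (1 + 0) (0 + 1) (p * q)"
    if "p \<in> {var_x, var_y}" "q \<in> {var_u, var_v}" for p q :: "'k bipoly"
    using that bihomogeneous_basic(3-6) by (intro bihomogeneous_mult) auto
  then show ?thesis by (cases c) (simp add: chart_eq)
qed

lemma deg0_locI:
  "A \<in> M \<Longrightarrow> bihomogeneous (k * d) (k * d) A \<Longrightarrow> bihomogeneous d d c \<Longrightarrow> Fract A (c ^ k) \<in> deg0_loc c M"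
  unfolding deg0_loc_def using bihomogeneous_power by blast

lemma deg0_locE:
  assumes "x \<in> deg0_loc c M" "bihomogeneous d d c" "c \<noteq> 0"
  obtains A k where "x = Fract A (c ^ k)" "A \<in> M" "bihomogeneous (k * d) (k * d) A"
proof -
  obtain A k p q where A: "x = Fract A (c ^ k)" "A \<in> M" "bihomogeneous p q A" "bihomogeneous p q (c ^ k)"
    using assms(1) unfolding deg0_loc_def by blast
  have "p = k * d \<and> q = k * d"
    using bihomogeneous_eq[OF A(4) bihomogeneous_power[OF assms(2)]] assms(3) by simp
  with A that show ?thesis by blast
qed

lemma deg0_loc_add:
  assumes "x \<in> deg0_loc c M" "y \<in> deg0_loc c M" "bihomogeneous d d c" "c \<noteq> 0"
    and M: "\<And>a b. a \<in> M \<Longrightarrow> b \<in> M \<Longrightarrow> a + b \<in> M" "\<And>a b. a \<in> M \<Longrightarrow> b * a \<in> M"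
  shows "x + y \<in> deg0_loc c M"
proof -
  obtain A k where A: "x = Fract A (c ^ k)" "A \<in> M" "bihomogeneous (k * d) (k * d) A"
    using deg0_locE assms by metis
  obtain B l where B: "y = Fract B (c ^ l)" "B \<in> M" "bihomogeneous (l * d) (l * d) B"
    using deg0_locE assms by metis
  have "x + y = Fract (c ^ l * A + c ^ k * B) (c ^ (k + l))"
    using assms(4) by (simp add: A B power_add mult.commute)
  moreover have "c ^ l * A + c ^ k * B \<in> M" using M A B by blast
  moreover have "bihomogeneous ((k + l) * d) ((k + l) * d) (c ^ l * A + c ^ k * B)"
  proof (rule bihomogeneous_add)
    show "bihomogeneous ((k + l) * d) ((k + l) * d) (c ^ l * A)"
      using bihomogeneous_mult[OF bihomogeneous_power[OF assms(3), of l] A(3)] by (simp add: add_mult_distrib add.commute)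
    show "bihomogeneous ((k + l) * d) ((k + l) * d) (c ^ k * B)"
      using bihomogeneous_mult[OF bihomogeneous_power[OF assms(3), of k] B(3)] by (simp add: add_mult_distrib)
  qed
  ultimately show ?thesis using deg0_locI assms(3) by metis
qed

lemma deg0_loc_scale:
  assumes "x \<in> deg0_loc c M" "bihomogeneous d d c" "c \<noteq> 0" and M: "\<And>a b. a \<in> M \<Longrightarrow> b * a \<in> M"
  shows "Fract (bconst s) 1 * x \<in> deg0_loc c M"
proof -
  obtain A k where A: "x = Fract A (c ^ k)" "A \<in> M" "bihomogeneous (k * d) (k * d) A"
    using deg0_locE assms by metis
  have "Fract (bconst s) 1 * x = Fract (bconst s * A) (c ^ k)" by (simp add: A)
  with A M show ?thesis by (metis deg0_locI assms(2) bihomogeneous_const_mult)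
qed

lemma bihomogeneous_chart2: "bihomogeneous 2 2 (chart c * chart c')"
  using bihomogeneous_mult[OF bihomogeneous_chart bihomogeneous_chart, of c c'] by (simp add: numeral_2_eq_2)

definition sections :: "'k::field bipoly set \<Rightarrow> (bool \<times> bool \<Rightarrow> 'k bipoly fract) set" where
  "sections M = {s. (\<forall>i. s i \<in> deg0_loc (chart i) UNIV) \<and> (\<forall>i j. s i - s j \<in> deg0_loc (chart i * chart j) M)}"

lemma subspace_sections:
  "module.subspace section_scale (sections (idl f) :: (bool \<times> bool \<Rightarrow> 'k::field bipoly fract) set)"
proof -
  interpret vector_space "section_scale :: 'k \<Rightarrow> _" by (rule vector_space_section_scale)
  have nz: "chart i * chart j \<noteq> (0 :: 'k bipoly)" for i j by (simp add: chart_nz)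
  show ?thesis
  proof (rule subspaceI)
    have "Fract 0 (c ^ 0) \<in> deg0_loc c M" if "0 \<in> M" "bihomogeneous d d c" for c :: "'k bipoly" and M d
      using that by (intro deg0_locI) (auto simp: bihomogeneous_0)
    then have z: "0 \<in> deg0_loc c M" if "0 \<in> M" "bihomogeneous d d c" for c :: "'k bipoly" and M d
      using that by (simp add: fract_collapse)
    then show "0 \<in> sections (idl f)"
      unfolding sections_def using z[OF UNIV_I bihomogeneous_chart] z[OF idl_closed(1) bihomogeneous_chart2]
      by (simp del: split_paired_All)
    fix s t :: "bool \<times> bool \<Rightarrow> 'k bipoly fract" and c assume s: "s \<in> sections (idl f)"
    then have s1: "s i \<in> deg0_loc (chart i) UNIV" and s2: "s i - s j \<in> deg0_loc (chart i * chart j) (idl f)" for i j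
      unfolding sections_def by blast+
    have "section_scale c s i \<in> deg0_loc (chart i) UNIV" for i
      unfolding section_scale_def using s1 bihomogeneous_chart chart_nz by (rule deg0_loc_scale) simp
    moreover have "section_scale c s i - section_scale c s j \<in> deg0_loc (chart i * chart j) (idl f)" for i j
      unfolding section_scale_def right_diff_distrib[symmetric]
      using s2 bihomogeneous_chart2 nz by (rule deg0_loc_scale) (rule idl_closed(3))
    ultimately show "section_scale c s \<in> sections (idl f)" unfolding sections_def by blast
    assume t: "t \<in> sections (idl f)"
    then have t1: "t i \<in> deg0_loc (chart i) UNIV" and t2: "t i - t j \<in> deg0_loc (chart i * chart j) (idl f)" for i j
      unfolding sections_def by blast+
    have "(s + t) i \<in> deg0_loc (chart i) UNIV" for i
      unfolding plus_fun_apply using s1 t1 bihomogeneous_chart chart_nz by (rule deg0_loc_add) simp_all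
    moreover have "(s + t) i - (s + t) j \<in> deg0_loc (chart i * chart j) (idl f)" for i j
    proof -
      have "(s + t) i - (s + t) j = (s i - s j) + (t i - t j)" by simp
      also have "\<dots> \<in> deg0_loc (chart i * chart j) (idl f)"
        using s2 t2 bihomogeneous_chart2 nz by (rule deg0_loc_add) (rule idl_closed(2,3); assumption)+
      finally show ?thesis .
    qed
    ultimately show "s + t \<in> sections (idl f)" unfolding sections_def by blast
  qed
qed

lemma bezout_power:
  fixes p q :: "'a::comm_ring_1"
  assumes "a * p + b * q = 1"
  shows "\<exists>a b. a * p ^ N + b * q ^ N = 1"
proof -
  have 1: "\<exists>a b. a * p + b * q ^ N = 1" if "a * p + b * q = 1" for a b p q :: 'a
  proof -
    have "1 = p * a + q * b" using that by (simp add: mult.commute)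
    then obtain s where "1 ^ N = p * s + (q * b) ^ N" using power_sum_ideal by blast
    then have "s * p + b ^ N * q ^ N = 1" by (simp add: power_mult_distrib mult.commute)
    then show ?thesis by blast
  qed
  then obtain a b where "a * p + b * q ^ N = 1" using assms by blast
  then have "b * q ^ N + a * p = 1" by (simp add: add.commute)
  with 1 obtain a b where "a * q ^ N + b * p ^ N = 1" by blast
  then have "b * p ^ N + a * q ^ N = 1" by (simp add: add.commute)
  then show ?thesis by blast
qed

section \<open>Sections over the base scheme as residues modulo D\<close>

context base
begin

definition ch :: "bool \<times> bool \<Rightarrow> 'k poly" where
  "ch i = ev X Y (chart i)"

text \<open>The four charts cover the curve: X - \<xi> Y = 1 and \<alpha> V - \<gamma> U = 1, and
  comaximality passes to powers. This is the partition of unity used for gluing.\<close>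

lemma ch_unit_ideal: "\<exists>\<epsilon>. (\<Sum>i\<in>UNIV. \<epsilon> i * ch i ^ N) = 1"
proof -
  have "1 * X + [:-\<xi>:] * Y = 1" by (simp add: X_def Y_def)
  then obtain p q where pq: "p * X ^ N + q * Y ^ N = 1" using bezout_power by blast
  have "[:-\<gamma>:] * U + [:\<alpha>:] * V = 1" using UV(2) by simp
  then obtain p' q' where pq': "p' * U ^ N + q' * V ^ N = 1" using bezout_power by blast
  have "(\<Sum>i\<in>UNIV. (case i of (i, j) \<Rightarrow> (if i then q else p) * (if j then q' else p')) * ch i ^ N)
      = (p * X ^ N + q * Y ^ N) * (p' * U ^ N + q' * V ^ N)"
    by (simp add: UNIV_Times_UNIV[symmetric] UNIV_bool sum.cartesian_product[symmetric] ch_def chart_eq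
        ev_simps ev_vars power_mult_distrib algebra_simps del: UNIV_Times_UNIV)
  then show ?thesis unfolding pq pq' by auto
qed

lemma ch_dvd:
  assumes "\<And>i. D dvd ch i ^ k i * \<tau>"
  shows "D dvd \<tau>"
proof -
  define N where "N = (\<Sum>i\<in>UNIV. k i)"
  have "k i \<le> N" for i unfolding N_def by (rule member_le_sum) auto
  then have dN: "D dvd ch i ^ N * \<tau>" for i
    using assms[of i] dvd_mult[of D "ch i ^ k i * \<tau>" "ch i ^ (N - k i)"]
    by (metis (no_types, lifting) le_add_diff_inverse2 mult.assoc power_add)
  have *: "D dvd (\<Sum>i\<in>UNIV. e i * (ch i ^ N * \<tau>))" for e
    by (rule dvd_sum, rule dvd_mult, rule dN)
  obtain \<epsilon> where "(\<Sum>i\<in>UNIV. \<epsilon> i * ch i ^ N) = 1" using ch_unit_ideal by blast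
  then have "(\<Sum>i\<in>UNIV. \<epsilon> i * (ch i ^ N * \<tau>)) = \<tau>"
    by (simp add: mult.assoc[symmetric] sum_distrib_right[symmetric])
  with *[of \<epsilon>] show ?thesis by simp
qed

text \<open>\<open>sec_val s \<tau>\<close>: the section \<open>s\<close> takes the value \<open>\<tau>\<close> modulo \<open>D\<close> under the identification of
  the base scheme with the zero scheme of \<open>D\<close>.\<close>

definition sec_val :: "(bool \<times> bool \<Rightarrow> 'k bipoly fract) \<Rightarrow> 'k poly \<Rightarrow> bool" where
  "sec_val s \<tau> \<longleftrightarrow> (\<forall>i. \<exists>F k. s i = Fract F (chart i ^ k) \<and> bihomogeneous k k F \<and> D dvd ev X Y F - ch i ^ k * \<tau>)"

lemma sec_val_add:
  assumes "sec_val s \<tau>" "sec_val s' \<tau>'"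
  shows "sec_val (s + s') (\<tau> + \<tau>')"
  unfolding sec_val_def
proof
  fix i
  obtain F k where F: "s i = Fract F (chart i ^ k)" "bihomogeneous k k F" "D dvd ev X Y F - ch i ^ k * \<tau>"
    using assms(1) unfolding sec_val_def by blast
  obtain F' k' where F': "s' i = Fract F' (chart i ^ k')" "bihomogeneous k' k' F'" "D dvd ev X Y F' - ch i ^ k' * \<tau>'"
    using assms(2) unfolding sec_val_def by blast
  have bc: "bihomogeneous k k (chart i ^ k)" for k :: nat
    using bihomogeneous_power[OF bihomogeneous_chart, of k i] by simp
  define G where "G = F * chart i ^ k' + F' * chart i ^ k"
  have "(s + s') i = Fract G (chart i ^ (k + k'))"
    by (simp add: G_def F(1) F'(1) chart_nz power_add)
  moreover have "bihomogeneous (k + k') (k + k') G"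
    unfolding G_def using bihomogeneous_mult[OF F(2) bc, of k'] bihomogeneous_mult[OF F'(2) bc, of k]
    by (intro bihomogeneous_add) (simp_all add: add.commute)
  moreover have "ev X Y G - ch i ^ (k + k') * (\<tau> + \<tau>')
      = ch i ^ k' * (ev X Y F - ch i ^ k * \<tau>) + ch i ^ k * (ev X Y F' - ch i ^ k' * \<tau>')"
    by (simp add: G_def ev_simps ch_def power_add algebra_simps)
  then have "D dvd ev X Y G - ch i ^ (k + k') * (\<tau> + \<tau>')" using F(3) F'(3) by simp
  ultimately show "\<exists>F k. (s + s') i = Fract F (chart i ^ k) \<and> bihomogeneous k k F \<and> D dvd ev X Y F - ch i ^ k * (\<tau> + \<tau>')"
    by blast
qed

lemma sec_val_scale:
  assumes "sec_val s \<tau>"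
  shows "sec_val (section_scale c s) (smult c \<tau>)"
  unfolding sec_val_def
proof
  fix i
  obtain F k where F: "s i = Fract F (chart i ^ k)" "bihomogeneous k k F" "D dvd ev X Y F - ch i ^ k * \<tau>"
    using assms(1) unfolding sec_val_def by blast
  have "section_scale c s i = Fract (bconst c * F) (chart i ^ k)" by (simp add: section_scale_def F(1))
  moreover have "ev X Y (bconst c * F) - ch i ^ k * smult c \<tau> = smult c (ev X Y F - ch i ^ k * \<tau>)"
    by (simp add: ev_simps ev_vars smult_diff_right)
  ultimately show "\<exists>F k. section_scale c s i = Fract F (chart i ^ k) \<and> bihomogeneous k k F
      \<and> D dvd ev X Y F - ch i ^ k * smult c \<tau>"
    using F(2,3) by (metis bihomogeneous_const_mult dvd_smult)
qed

definition nulls :: "(bool \<times> bool \<Rightarrow> 'k bipoly fract) set" where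
  "nulls = {s. \<forall>i. s i \<in> deg0_loc (chart i) (idl f)}"

text \<open>Comparing two fractions for the same element gives divisibility only up to powers of the
  chart functions; since this holds on every chart, \<open>ch_dvd\<close> removes them.\<close>

lemma sec_val_null:
  assumes "sec_val s \<tau>" "s \<in> nulls"
  shows "D dvd \<tau>"
proof -
  have "\<exists>k. D dvd ch i ^ k * \<tau>" for i
  proof -
    obtain F k where F: "s i = Fract F (chart i ^ k)" "bihomogeneous k k F" "D dvd ev X Y F - ch i ^ k * \<tau>"
      using assms(1) unfolding sec_val_def by blast
    have "s i \<in> deg0_loc (chart i) (idl f)" using assms(2) unfolding nulls_def by blast
    then obtain A l where A: "s i = Fract A (chart i ^ l)" "A \<in> idl f"
      by (rule deg0_locE[OF _ bihomogeneous_chart chart_nz])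
    have "F * chart i ^ l = A * chart i ^ k" using F(1) A(1) by (simp add: eq_fract chart_nz)
    then have "ev X Y F * ch i ^ l = ev X Y A * ch i ^ k" unfolding ch_def by (metis ev_simps(4,7))
    then have "ch i ^ (k + l) * \<tau> = ev X Y A * ch i ^ k - ch i ^ l * (ev X Y F - ch i ^ k * \<tau>)"
      by (simp add: power_add algebra_simps)
    moreover have "D dvd \<dots>" by (rule dvd_diff[OF dvd_mult2[OF ev_idl[OF A(2)]] dvd_mult[OF F(3)]])
    ultimately show ?thesis by metis
  qed
  then obtain k where "\<And>i. D dvd ch i ^ k i * \<tau>" by metis
  then show ?thesis by (rule ch_dvd)
qed

lemma chart_mem':
  assumes "bihomogeneous p q F" "D dvd ev X Y F"
  shows "\<exists>N. chart i ^ N * F \<in> idl f"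
  using chart_mem[OF assms, of "if fst i then var_y else var_x" "if snd i then var_v else var_u"]
  by (cases i) (simp add: chart_eq)

text \<open>This direction needs the equations of the base scheme: by \<open>chart_mem\<close> a
  form that vanishes modulo \<open>D\<close> on the curve lies in the ideal up to a power of the
  chart function.\<close>

lemma null_sec_val:
  assumes "sec_val s \<tau>" "D dvd \<tau>"
  shows "s \<in> nulls"
  unfolding nulls_def mem_Collect_eq
proof
  fix i
  obtain F k where F: "s i = Fract F (chart i ^ k)" "bihomogeneous k k F" "D dvd ev X Y F - ch i ^ k * \<tau>"
    using assms(1) unfolding sec_val_def by blast
  have "D dvd ev X Y F" using dvd_add[OF F(3) dvd_mult[OF assms(2), of "ch i ^ k"]] by simp
  then obtain N where N: "chart i ^ N * F \<in> idl f" using chart_mem'[OF F(2)] by blast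
  have "s i = Fract (chart i ^ N * F) (chart i ^ (N + k))"
    by (simp add: F(1) power_add chart_nz eq_fract algebra_simps)
  moreover have "bihomogeneous (N + k) (N + k) (chart i ^ N * F)"
    using bihomogeneous_mult[OF bihomogeneous_power[OF bihomogeneous_chart] F(2), of N i] by simp
  ultimately show "s i \<in> deg0_loc (chart i) (idl f)"
    using deg0_locI[OF N _ bihomogeneous_chart, of "N + k" i] by simp
qed

lemma sec_val_unique:
  assumes "sec_val s \<tau>" "sec_val s \<tau>'"
  shows "D dvd \<tau> - \<tau>'"
proof (rule sec_val_null)
  have "sec_val (s + section_scale (-1) s) (\<tau> + smult (-1) \<tau>')"
    by (intro sec_val_add sec_val_scale assms)
  moreover have "s + section_scale (-1) s = 0"
  proof
    fix i
    have "Fract (bconst (-1)) 1 = (-1 :: 'k bipoly fract)"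
      by (simp add: bconst_simps flip: minus_fract One_fract_def)
    then show "(s + section_scale (-1) s) i = 0 i" by (simp add: section_scale_def)
  qed
  ultimately show "sec_val 0 (\<tau> - \<tau>')" by simp
  have "Fract 0 (chart i ^ 0) \<in> deg0_loc (chart i) (idl f)" for i
    by (rule deg0_locI[where d = 1]) (auto simp: idl_closed bihomogeneous_0 bihomogeneous_chart[simplified])
  then show "0 \<in> nulls" by (simp add: nulls_def fract_collapse)
qed

text \<open>Gluing: with a common exponent \<open>K\<close> of the denominators, the local values
  agree modulo \<open>D\<close> after multiplication by a power \<open>M\<close> of the chart
  functions, and a partition of unity for the exponent K + M averages them.\<close>

lemma sec_val_exists:
  assumes s: "s \<in> sections (idl f)"
  shows "\<exists>\<tau>. sec_val s \<tau>"
proof -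
  have "\<exists>F k. s i = Fract F (chart i ^ k) \<and> bihomogeneous k k F" for i
  proof -
    have "s i \<in> deg0_loc (chart i) UNIV" using s unfolding sections_def by blast
    then obtain A k where "s i = Fract A (chart i ^ k)" "A \<in> UNIV" "bihomogeneous (k * 1) (k * 1) A"
      by (rule deg0_locE[OF _ bihomogeneous_chart chart_nz])
    then show ?thesis unfolding mult_1_right by blast
  qed
  then obtain F0 k where F0: "\<And>i. s i = Fract (F0 i) (chart i ^ k i)" "\<And>i. bihomogeneous (k i) (k i) (F0 i)"
    by metis
  define K where "K = (\<Sum>i\<in>UNIV. k i)"
  have kK: "k i \<le> K" for i unfolding K_def by (rule member_le_sum) auto
  define F where "F i = chart i ^ (K - k i) * F0 i" for i
  have bc: "bihomogeneous k k (chart i ^ k)" for k :: nat and i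
    using bihomogeneous_power[OF bihomogeneous_chart, of k i] by simp
  have F: "s i = Fract (F i) (chart i ^ K)" "bihomogeneous K K (F i)" for i
  proof -
    have "chart i ^ K = chart i ^ (K - k i) * (chart i ^ k i :: 'k bipoly)"
      using kK[of i] by (simp flip: power_add)
    then show "s i = Fract (F i) (chart i ^ K)"
      by (simp add: F_def F0(1) chart_nz eq_fract algebra_simps)
    show "bihomogeneous K K (F i)"
      unfolding F_def using bihomogeneous_mult[OF bc F0(2), of "K - k i" i i] kK[of i] by simp
  qed
  have "\<exists>M. D dvd (ch i * ch j) ^ M * (ev X Y (F i) * ch j ^ K - ev X Y (F j) * ch i ^ K)" for i j
  proof -
    have "s i - s j \<in> deg0_loc (chart i * chart j) (idl f)" using s unfolding sections_def by blast
    then obtain A M where A: "s i - s j = Fract A ((chart i * chart j) ^ M)" "A \<in> idl f"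
      by (rule deg0_locE[OF _ bihomogeneous_chart2]) (simp add: chart_nz)
    have "Fract (F i * chart j ^ K - F j * chart i ^ K) (chart i ^ K * chart j ^ K) = Fract A ((chart i * chart j) ^ M)"
      using A(1) by (simp add: F(1) chart_nz)
    then have "(F i * chart j ^ K - F j * chart i ^ K) * (chart i * chart j) ^ M = A * (chart i ^ K * chart j ^ K)"
      by (simp add: eq_fract chart_nz)
    from arg_cong[OF this, of "ev X Y"]
    have "(ch i * ch j) ^ M * (ev X Y (F i) * ch j ^ K - ev X Y (F j) * ch i ^ K) = ev X Y A * (ch i ^ K * ch j ^ K)"
      by (simp only: ev_simps ch_def mult.commute)
    then show ?thesis using ev_idl[OF A(2)] by (metis dvd_mult2)
  qed
  then obtain M0 where M0: "\<And>i j. D dvd (ch i * ch j) ^ M0 i j * (ev X Y (F i) * ch j ^ K - ev X Y (F j) * ch i ^ K)"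
    by metis
  define M where "M = (\<Sum>i\<in>UNIV. \<Sum>j\<in>UNIV. M0 i j)"
  have "M0 i j \<le> M" for i j
  proof -
    have "M0 i j \<le> (\<Sum>j\<in>UNIV. M0 i j)" by (rule member_le_sum) auto
    also have "\<dots> \<le> M" unfolding M_def by (rule member_le_sum) auto
    finally show ?thesis .
  qed
  then have M: "D dvd (ch i * ch j) ^ M * (ev X Y (F i) * ch j ^ K - ev X Y (F j) * ch i ^ K)" for i j
    using M0[of i j] by (meson dvd_trans le_imp_power_dvd mult_dvd_mono dvd_refl)
  obtain \<epsilon> where \<epsilon>: "(\<Sum>j\<in>UNIV. \<epsilon> j * ch j ^ (K + M)) = 1" using ch_unit_ideal by blast
  define \<tau> where "\<tau> = (\<Sum>j\<in>UNIV. \<epsilon> j * (ch j ^ M * ev X Y (F j)))"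
  have "sec_val s \<tau>"
    unfolding sec_val_def
  proof
    fix i
    have "s i = Fract (chart i ^ M * F i) (chart i ^ (K + M))"
      by (simp add: F(1) chart_nz eq_fract power_add algebra_simps)
    moreover have "bihomogeneous (K + M) (K + M) (chart i ^ M * F i)"
      using bihomogeneous_mult[OF bc F(2), of M i i] by (simp add: add.commute)
    moreover have "ev X Y (chart i ^ M * F i) - ch i ^ (K + M) * \<tau>
      = (\<Sum>j\<in>UNIV. \<epsilon> j * ((ch i * ch j) ^ M * (ev X Y (F i) * ch j ^ K - ev X Y (F j) * ch i ^ K)))"
    proof -
      have "ev X Y (chart i ^ M * F i) = (\<Sum>j\<in>UNIV. \<epsilon> j * ch j ^ (K + M)) * (ch i ^ M * ev X Y (F i))"
        unfolding \<epsilon> by (simp add: ev_simps ch_def)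
      then show ?thesis
        unfolding \<tau>_def sum_distrib_left sum_distrib_right sum_subtractf[symmetric]
        by (simp add: sum_subtractf[symmetric] power_add power_mult_distrib algebra_simps)
    qed
    then have "D dvd ev X Y (chart i ^ M * F i) - ch i ^ (K + M) * \<tau>"
      using M by (simp add: dvd_sum)
    ultimately show "\<exists>F k. s i = Fract F (chart i ^ k) \<and> bihomogeneous k k F \<and> D dvd ev X Y F - ch i ^ k * \<tau>"
      by blast
  qed
  then show ?thesis by blast
qed

text \<open>On each chart \<tau> needs a numerator of bidegree (n, n). Reducing Z^n \<tau> modulo
  \<open>D\<close> brings it within the bound \<open>n\<close> whatever the degree of \<tau>, and
  changes nothing on the base scheme.\<close>

lemma section_exists: "\<exists>s\<in>sections (idl f). sec_val s \<tau>"
proof -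
  define x where "x i = (if i then var_y else var_x :: 'k bipoly)" for i
  define Z where "Z j = (if j then V else U)" for j
  define F where "F = (\<lambda>(i, j). x i ^ n * hmg n ((Z j ^ n * \<tau>) mod D))"
  define s where "s i = Fract (F i) (chart i ^ n)" for i
  have bF: "bihomogeneous n n (F i)" for i
  proof -
    have "bihomogeneous 1 0 (x i)" for i by (simp add: x_def bihomogeneous_basic[simplified])
    from bihomogeneous_mult[OF bihomogeneous_power[OF this] bihomogeneous_hmg]
    show ?thesis unfolding F_def by (cases i) force
  qed
  have bc: "bihomogeneous k k (chart i ^ k)" for k :: nat and i
    using bihomogeneous_power[OF bihomogeneous_chart, of k i] by simp
  have dm: "degree (p mod D) \<le> n" for p using degree_mod_less[OF D_nz, of p] by auto
  have ch: "ch (i, j) = ev X Y (x i) * Z j" for i j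
    by (simp add: ch_def chart_eq x_def Z_def ev_simps ev_vars)
  have dF: "D dvd ev X Y (F i) - ch i ^ n * \<tau>" for i
  proof -
    obtain i0 j0 where i: "i = (i0, j0)" by (cases i)
    have "ev X Y (F i) - ch i ^ n * \<tau> = ev X Y (x i0) ^ n * ((Z j0 ^ n * \<tau>) mod D - Z j0 ^ n * \<tau>)"
      by (simp add: i F_def ch ev_simps ev_hmg dm power_mult_distrib algebra_simps)
    moreover have "D dvd (Z j0 ^ n * \<tau>) mod D - Z j0 ^ n * \<tau>" by (simp add: mod_eq_dvd_iff[symmetric])
    ultimately show ?thesis by simp
  qed
  have "sec_val s \<tau>" unfolding sec_val_def s_def using bF dF by blast
  moreover have "s \<in> sections (idl f)"
    unfolding sections_def
  proof (intro CollectI conjI allI)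
    fix i j
    show "s i \<in> deg0_loc (chart i) UNIV"
      unfolding s_def by (intro deg0_locI[where d = 1] UNIV_I bihomogeneous_chart) (simp only: mult_1_right bF)
    define G where "G = F i * chart j ^ n - F j * chart i ^ n"
    have G: "bihomogeneous (n + n) (n + n) G"
      unfolding G_def by (intro bihomogeneous_diff bihomogeneous_mult bF bc)
    have "ev X Y G = ch j ^ n * (ev X Y (F i) - ch i ^ n * \<tau>) - ch i ^ n * (ev X Y (F j) - ch j ^ n * \<tau>)"
      by (simp add: G_def ev_simps ch_def algebra_simps)
    then have "D dvd ev X Y G" using dF by simp
    then obtain N where N: "chart i ^ N * G \<in> idl f" using chart_mem'[OF G] by blast
    have "s i - s j = Fract (chart j ^ N * (chart i ^ N * G)) ((chart i * chart j) ^ (N + n))"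
      by (simp add: s_def chart_nz eq_fract power_add power_mult_distrib G_def algebra_simps)
    moreover have "bihomogeneous (N + (N + (n + n))) (N + (N + (n + n))) (chart j ^ N * (chart i ^ N * G))"
      by (intro bihomogeneous_mult bc G)
    then have "bihomogeneous ((N + n) * 2) ((N + n) * 2) (chart j ^ N * (chart i ^ N * G))"
      by (simp add: mult.commute[of _ 2] mult_2 add_ac)
    ultimately show "s i - s j \<in> deg0_loc (chart i * chart j) (idl f)"
      using deg0_locI[OF idl_closed(3)[OF N] _ bihomogeneous_chart2] by metis
  qed
  ultimately show ?thesis by blast
qed

lemma quotient_dim_sections: "quotient_dim section_scale (sections (idl f)) (sections (idl f) \<inter> nulls) = n"
proof -
  \<comment> \<open>A section determines its value only modulo \<open>D\<close>; the remainder makes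
    the choice immaterial.\<close>
  define T where "T s = (SOME \<tau>. sec_val s \<tau>) mod D" for s
  have T: "T s = \<tau> mod D" if "sec_val s \<tau>" for s \<tau>
    unfolding T_def using sec_val_unique[OF someI[of "sec_val s"], OF that that] by (simp add: mod_eq_dvd_iff)
  show ?thesis
  proof (rule quotient_dim_poly[where T = T, OF vector_space_section_scale subspace_sections])
    fix s t c assume "s \<in> sections (idl f)"
    then obtain \<tau> where \<tau>: "sec_val s \<tau>" using sec_val_exists by blast
    show "T (section_scale c s) = smult c (T s)"
      using T[OF \<tau>] T[OF sec_val_scale[OF \<tau>]] by (simp add: mod_smult_left)
    assume "t \<in> sections (idl f)"
    then obtain \<tau>' where \<tau>': "sec_val t \<tau>'" using sec_val_exists by blast
    show "T (s + t) = T s + T t"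
      using T[OF \<tau>] T[OF \<tau>'] T[OF sec_val_add[OF \<tau> \<tau>']] by (simp add: poly_mod_add_left)
  next
    show "sections (idl f) \<inter> nulls = {s \<in> sections (idl f). T s = 0}"
    proof -
      have "s \<in> nulls \<longleftrightarrow> T s = 0" if s: "s \<in> sections (idl f)" for s
      proof -
        obtain \<tau> where \<tau>: "sec_val s \<tau>" using sec_val_exists[OF s] by blast
        show ?thesis using sec_val_null[OF \<tau>] null_sec_val[OF \<tau>] unfolding T[OF \<tau>] mod_eq_0_iff_dvd by blast
      qed
      then show ?thesis by blast
    qed
    show "T ` sections (idl f) = {p. p = 0 \<or> degree p < n}"
    proof
      show "T ` sections (idl f) \<subseteq> {p. p = 0 \<or> degree p < n}"
        unfolding T_def using degree_mod_less[OF D_nz] by auto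
      show "{p. p = 0 \<or> degree p < n} \<subseteq> T ` sections (idl f)"
      proof
        fix p :: "'k poly" assume "p \<in> {p. p = 0 \<or> degree p < n}"
        then have p: "p mod D = p" by (auto intro: mod_poly_less)
        obtain s where "s \<in> sections (idl f)" "sec_val s p" using section_exists by blast
        with T p show "p \<in> T ` sections (idl f)" by force
      qed
    qed
  qed
qed

end

section \<open>The inverse map\<close>

definition tricoeff :: "'k::field tripoly \<Rightarrow> nat \<Rightarrow> nat \<Rightarrow> nat \<Rightarrow> 'k" where
  "tricoeff F i j l = coeff (coeff (coeff F l) j) i"

lemma tripoly_eqI: "(\<And>i j l. tricoeff F i j l = tricoeff G i j l) \<Longrightarrow> F = G"
  unfolding tricoeff_def by (intro poly_eqI) blast

lemma tricoeff_linear: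
  "tricoeff 0 i j l = 0" "tricoeff (F + G) i j l = tricoeff F i j l + tricoeff G i j l"
  by (simp_all add: tricoeff_def)

lemma tricoeff_sum: "tricoeff (sum F S) i j l = (\<Sum>s\<in>S. tricoeff (F s) i j l)"
  by (induction S rule: infinite_finite_induct) (simp_all add: tricoeff_linear)

lemma trimonom:
  "tconst k * var_z0 ^ i * var_z1 ^ j * var_z2 ^ l = monom (monom (monom k i) j) l"
  unfolding tconst_def var_z0_def var_z1_def var_z2_def
  by (simp add: var_eq_monom monom_0[symmetric] monom_power mult_monom)

lemma tricoeff_trimonom:
  "tricoeff (tconst k * var_z0 ^ i * var_z1 ^ j * var_z2 ^ l) i' j' l' = (if i = i' \<and> j = j' \<and> l = l' then k else 0)"
  unfolding trimonom tricoeff_def by simp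

lemma homogeneous_tricoeff: "homogeneous e F \<longleftrightarrow> (\<forall>i j l. tricoeff F i j l \<noteq> 0 \<longrightarrow> i + j + l = e)"
  by (simp add: homogeneous_def tricoeff_def)

lemma homogeneous_0: "homogeneous e 0"
  by (simp add: homogeneous_tricoeff tricoeff_linear)

lemma homogeneous_add: "homogeneous e F \<Longrightarrow> homogeneous e G \<Longrightarrow> homogeneous e (F + G)"
  unfolding homogeneous_tricoeff tricoeff_linear by (metis add_0)

lemma homogeneous_sum: "(\<And>i. i \<in> S \<Longrightarrow> homogeneous e (F i)) \<Longrightarrow> homogeneous e (sum F S)"
  by (induction S rule: infinite_finite_induct) (auto intro: homogeneous_0 homogeneous_add)

lemma homogeneous_trimonom: "i + j + l = e \<Longrightarrow> homogeneous e (tconst k * var_z0 ^ i * var_z1 ^ j * var_z2 ^ l)"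
  unfolding homogeneous_tricoeff tricoeff_trimonom by auto

lemma homogeneous_expand:
  assumes "homogeneous e F"
  shows "F = (\<Sum>i\<le>e. \<Sum>j\<le>e - i. tconst (tricoeff F i j (e - i - j)) * var_z0 ^ i * var_z1 ^ j * var_z2 ^ (e - i - j))"
    (is "_ = ?G")
proof (rule tripoly_eqI)
  fix i j l
  have "tricoeff ?G i j l = (\<Sum>i'\<le>e. \<Sum>j'\<le>e - i'. if i' = i \<and> j' = j \<and> e - i' - j' = l
      then tricoeff F i' j' (e - i' - j') else 0)"
    by (simp add: tricoeff_sum tricoeff_trimonom del: diff_diff_left)
  also have "\<dots> = (\<Sum>i'\<le>e. \<Sum>j'\<le>e - i'. if j' = j then if i' = i \<and> i + j + l = e
      then tricoeff F i j l else 0 else 0)"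
    by (intro sum.cong refl) (auto split: if_splits)
  also have "\<dots> = (\<Sum>i'\<le>e. if i' = i then if i + j + l = e then tricoeff F i j l else 0 else 0)"
    by (intro sum.cong refl) auto
  also have "\<dots> = tricoeff F i j l"
    using assms by (cases "i + j + l = e") (auto simp: homogeneous_tricoeff)
  finally show "tricoeff F i j l = tricoeff ?G i j l" by simp
qed

lemma homogeneous_mult:
  assumes "homogeneous d F" "homogeneous e G"
  shows "homogeneous (d + e) (F * G)"
proof -
  have *: "(tconst k * var_z0 ^ i * var_z1 ^ j * var_z2 ^ l) * (tconst k' * var_z0 ^ i' * var_z1 ^ j' * var_z2 ^ l') =
    tconst (k * k') * var_z0 ^ (i + i') * var_z1 ^ (j + j') * var_z2 ^ (l + l')"
    for k k' :: 'a and i j l i' j' l'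
    by (simp add: rhomD(4)[OF rhom_tconst] power_add algebra_simps)
  show ?thesis
    by (subst homogeneous_expand[OF assms(1)], subst homogeneous_expand[OF assms(2)])
      (auto simp: sum_product * intro!: homogeneous_sum homogeneous_trimonom)
qed

lemma homogeneous_basic:
  "homogeneous 0 (tconst k)" "homogeneous 1 var_z0" "homogeneous 1 var_z1" "homogeneous 1 var_z2"
  using homogeneous_trimonom[of 0 0 0 0 k] homogeneous_trimonom[of 1 0 0 1 1]
    homogeneous_trimonom[of 0 1 0 1 1] homogeneous_trimonom[of 0 0 1 1 1]
  by (simp_all add: rhomD[OF rhom_tconst])

lemma homogeneous_const_mult: "homogeneous e F \<Longrightarrow> homogeneous e (tconst k * F)"
  using homogeneous_mult[OF homogeneous_basic(1)] by fastforce

lemma homogeneous_diff: "homogeneous e F \<Longrightarrow> homogeneous e G \<Longrightarrow> homogeneous e (F - G)"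
  using homogeneous_add[of e F "tconst (-1) * G"] homogeneous_const_mult[of e G "-1"]
  by (simp add: rhomD[OF rhom_tconst])

lemma homogeneous_minus: "homogeneous e F \<Longrightarrow> homogeneous e (- F)"
  using homogeneous_diff[OF homogeneous_0] by fastforce

lemma homogeneous_power: "homogeneous e F \<Longrightarrow> homogeneous (n * e) (F ^ n)"
proof (induction n)
  case 0
  then show ?case using homogeneous_basic(1)[of 1] by (simp add: rhomD[OF rhom_tconst])
qed (auto intro: homogeneous_mult)

lemma homogeneous_vectors:
  assumes "all3 (homogeneous d) a" "all3 (homogeneous e) b"
  shows "homogeneous (d + e) (dot3 a b)" "all3 (homogeneous (d + e)) (cross3 a b)"
  using assms
  by (cases a; cases b; auto simp: v3_defs intro!: homogeneous_add homogeneous_diff homogeneous_mult)+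

lemma tev_homogeneous_scale:
  assumes h: "rhom h" and F: "homogeneous e F"
  shows "tev h (s * x) (s * y) (s * z) F = s ^ e * tev h x y z F"
proof -
  note simps = rhomD[OF rhom_tev[OF h]] tev_vars[OF h]
  have "s ^ e = s ^ i * s ^ j * s ^ (e - i - j)" if "i \<le> e" "j \<le> e - i" for i j
    using that by (simp flip: power_add)
  then show ?thesis
    by (subst (1 2) homogeneous_expand[OF F])
      (auto simp: simps sum_distrib_left power_mult_distrib algebra_simps intro!: sum.cong)
qed

lemma eval_with_nonzero:
  fixes h :: "'a::zero \<Rightarrow> 'k::field"
  assumes inf: "infinite (UNIV :: 'k set)" and h: "h 0 = 0" and p: "h (lead_coeff p) \<noteq> 0"
  shows "\<exists>r. eval_with h p r \<noteq> 0"
proof -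
  have "map_poly h p \<noteq> 0" using p h by (metis coeff_0 coeff_map_poly)
  then have "finite {r. poly (map_poly h p) r = 0}" by (rule poly_roots_finite)
  from ex_new_if_finite[OF inf this] show ?thesis by (auto simp: eval_with_def)
qed

text \<open>The variables are specialized one at a time, each outside the finitely many roots of a
  leading coefficient.\<close>

lemma tev_nonzero:
  fixes F :: "'k::field tripoly"
  assumes inf: "infinite (UNIV :: 'k set)" and F: "F \<noteq> 0"
  shows "\<exists>x y z. tev (\<lambda>c. c) x y z F \<noteq> 0"
proof -
  have "lead_coeff (lead_coeff (lead_coeff F)) \<noteq> 0" using F by simp
  then obtain x where "eval_with (\<lambda>c. c) (lead_coeff (lead_coeff F)) x \<noteq> 0"
    using eval_with_nonzero[OF inf, of "\<lambda>c. c" "lead_coeff (lead_coeff F)"] by auto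
  then obtain y where "eval_with (\<lambda>H. eval_with (\<lambda>c. c) H x) (lead_coeff F) y \<noteq> 0"
    using eval_with_nonzero[OF inf, of "\<lambda>H. eval_with (\<lambda>c. c) H x" "lead_coeff F"] by auto
  then obtain z where "eval_with (\<lambda>G. eval_with (\<lambda>H. eval_with (\<lambda>c. c) H x) G y) F z \<noteq> 0"
    using eval_with_nonzero[OF inf, of "\<lambda>G. eval_with (\<lambda>H. eval_with (\<lambda>c. c) H x) G y" F] by auto
  then show ?thesis unfolding tev_def by blast
qed

lemma eval_with_cong_mod:
  fixes d :: "'r::comm_ring_1"
  assumes "h 0 = 0" "h' 0 = 0" "\<And>a. d dvd h a - h' a" "d dvd r - r'"
  shows "d dvd eval_with h p r - eval_with h' p r'"
proof (induction p)
  case (pCons a p)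
  have "eval_with h (pCons a p) r - eval_with h' (pCons a p) r'
      = (h a - h' a) + (r * (eval_with h p r - eval_with h' p r') + (r - r') * eval_with h' p r')"
    by (simp add: eval_with_pCons assms algebra_simps)
  then show ?case using assms(3,4) pCons by (simp add: dvd_add)
qed simp

lemma tev_cong_mod:
  assumes "h 0 = 0" "d dvd x - x'" "d dvd y - y'" "d dvd z - z'"
  shows "d dvd tev h x y z F - tev h x' y' z' F"
  unfolding tev_def using assms by (intro eval_with_cong_mod) auto

definition ev3 :: "('k::field \<Rightarrow> 'r::comm_ring_1) \<Rightarrow> 'r v3 \<Rightarrow> 'k tripoly \<Rightarrow> 'r" where
  "ev3 h = (\<lambda>(x, y, z). tev h x y z)"

definition zvec :: "'k::field tripoly v3" where
  "zvec = (var_z0, var_z1, var_z2)"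

lemma rhom_ev3: "rhom h \<Longrightarrow> rhom (ev3 h v)"
  by (cases v) (simp add: ev3_def rhom_tev)

lemma ev3_zvec: "rhom h \<Longrightarrow> map3 (ev3 h v) zvec = v" "rhom h \<Longrightarrow> ev3 h v (tconst c) = h c"
  by (cases v; simp add: ev3_def zvec_def map3_def tev_vars)+

lemma ev3_comp:
  assumes "rhom \<phi>" "rhom h"
  shows "\<phi> (ev3 h v F) = ev3 (\<lambda>c. \<phi> (h c)) (map3 \<phi> v) F"
  by (cases v) (simp add: ev3_def map3_def tev_comp[OF assms])

lemma ev3_scale: "rhom h \<Longrightarrow> homogeneous e F \<Longrightarrow> ev3 h (smul3 s v) F = s ^ e * ev3 h v F"
  by (cases v) (simp add: ev3_def smul3_def tev_homogeneous_scale)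

lemma ev3_nonzero:
  fixes F :: "'k::field tripoly"
  shows "infinite (UNIV :: 'k set) \<Longrightarrow> F \<noteq> 0 \<Longrightarrow> \<exists>v. ev3 (\<lambda>c. c) v F \<noteq> 0"
  using tev_nonzero[of F] by (force simp: ev3_def)

lemma ev3_const_poly: "ev3 (\<lambda>c. [:c:]) (map3 (\<lambda>c. [:c:]) v) F = [:ev3 (\<lambda>c. c) v F:]"
proof -
  have "rhom (\<lambda>c :: 'a. c)" by (simp add: rhom_def)
  from ev3_comp[OF rhom_const_poly this] show ?thesis by simp
qed

lemma ev3_linear_form:
  assumes "rhom h"
  shows "ev3 h v (dot3 (map3 tconst a) zvec) = dot3 (map3 h a) v"
  using map3_rhom(1)[OF rhom_ev3[OF assms], of v "map3 tconst a" zvec]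
  by (simp add: ev3_zvec assms map3_compose)

lemma ev3_cong_mod: "h 0 = 0 \<Longrightarrow> d dvd ev3 h (v + smul3 d w) F - ev3 h v F"
  by (cases v; cases w) (auto simp: ev3_def smul3_def intro!: tev_cong_mod)

lemma homogeneous_zvec: "all3 (homogeneous 1) zvec"
  using homogeneous_basic(2-4) by (simp add: all3_def zvec_def)

lemma homogeneous_linear_form: "homogeneous 1 (dot3 (map3 tconst a) zvec)"
proof -
  have "all3 (homogeneous 0) (map3 tconst a)" by (cases a) (simp add: v3_defs homogeneous_basic)
  from homogeneous_vectors(1)[OF this homogeneous_zvec] show ?thesis by simp
qed

lemma linear_form_nonzero: "a \<noteq> 0 \<Longrightarrow> dot3 (map3 tconst a) zvec \<noteq> (0 :: 'k::field tripoly)"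
proof
  assume "a \<noteq> 0" and 0: "dot3 (map3 tconst a) zvec = 0"
  have i: "rhom (\<lambda>c :: 'k. c)" by (simp add: rhom_def)
  obtain n where "dot3 n a \<noteq> 0" using dot3_nonzero[OF \<open>a \<noteq> 0\<close>] by blast
  moreover have "ev3 (\<lambda>c. c) n (dot3 (map3 tconst a) zvec) = dot3 a n"
    using ev3_linear_form[OF i] by (simp add: map3_id)
  ultimately show False using 0 rhomD(1)[OF rhom_ev3[OF i]] by (simp add: dot3_commute)
qed

lemma same_proj_scale:
  assumes "s \<noteq> 0" "\<exists>r\<in>set rs. r \<noteq> 0"
  shows "same_proj (map ((*) s) rs) rs"
  using assms by (auto simp: same_proj_def)


section \<open>The degree of g and the inverse map\<close>

context base
begin

lemma m_le_1_of_inverse: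
  assumes inf: "infinite (UNIV :: 'k set)"
    and q: "homogeneous d q0" "homogeneous d q1"
    and nz: "q0 \<noteq> 0 \<or> q1 \<noteq> 0"
    and eq: "ev3 bconst f q0 * var_v = ev3 bconst f q1 * var_u"
  shows "m \<le> 1"
proof -
  \<comment> \<open>\<open>dot3 G z\<close> is the coefficient of t^m in g \<bullet> z. A point
    where neither it nor \<open>Q\<close> vanishes keeps the degree of g \<bullet> z equal to m and
    the pair (q0(z), q1(z)) nonzero.\<close>
  define G where "G = map3 (\<lambda>p. coeff p m) g"
  define Q where "Q = (if q0 \<noteq> 0 then q0 else q1)"
  have ih: "rhom (\<lambda>c :: 'k. c)" by (simp add: rhom_def)
  have "Q * dot3 (map3 tconst G) zvec \<noteq> 0"
    using nz linear_form_nonzero[of G] top_g by (auto simp: Q_def G_def)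
  then obtain z where "ev3 (\<lambda>c. c) z (Q * dot3 (map3 tconst G) zvec) \<noteq> 0"
    using ev3_nonzero[OF inf] by blast
  then have z: "ev3 (\<lambda>c. c) z q0 \<noteq> 0 \<or> ev3 (\<lambda>c. c) z q1 \<noteq> 0" "dot3 G z \<noteq> 0"
    using ev3_linear_form[OF ih, of z G]
    by (auto simp: rhomD(4)[OF rhom_ev3[OF ih]] map3_id Q_def split: if_splits)
  define Z where "Z = map3 (\<lambda>c. [:c:]) z"
  define z' where "z' = Z - smul3 (dot3 g Z) w"
  have gz': "dot3 z' g = 0"
    unfolding z'_def dot3_linear wg by (simp add: dot3_commute)
  \<comment> \<open>Cramer's rule yields a preimage (\<open>X'\<close> : \<open>Y'\<close>) of
    \<open>z'\<close> in the fibre over t. The identity between \<open>q0\<close> and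
    \<open>q1\<close> is restricted to it, and the power of \<Lambda> cancels.\<close>
  obtain n3 where n3: "dot3 n3 (cross3 a b) \<noteq> 0" using dot3_nonzero[OF cross_ab_nz] by blast
  define \<Lambda> where "\<Lambda> = dot3 n3 (cross3 a b)"
  define X' where "X' = dot3 n3 (cross3 z' b)"
  define Y' where "Y' = dot3 n3 (cross3 a z')"
  have ch: "rhom (\<lambda>c :: 'k. [:c:])" by (rule rhom_const_poly)
  have "smul3 \<Lambda> z' = smul3 X' a + smul3 Y' b"
    using cramer3[of n3 a b z'] gz'
    by (simp add: \<Lambda>_def X'_def Y'_def cross_ab dot3_linear smul3_linear)
  then have evf: "map3 (ev X' Y') f = smul3 \<Lambda> z'" using ev_form1[OF deg_ab] by simp
  have evq: "ev X' Y' (ev3 bconst f q) = \<Lambda> ^ d * ev3 (\<lambda>c. [:c:]) z' q" if "homogeneous d q" for q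
    using ev3_comp[OF rhom_ev rhom_bconst, of X' Y' f q] ev3_scale[OF ch that]
    by (simp add: ev_vars evf)
  have "ev X' Y' (ev3 bconst f q0) * V = ev X' Y' (ev3 bconst f q1) * U"
    using arg_cong[OF eq, of "ev X' Y'"] by (simp only: ev_simps ev_vars)
  then have "\<Lambda> ^ d * (ev3 (\<lambda>c. [:c:]) z' q0 * V) = \<Lambda> ^ d * (ev3 (\<lambda>c. [:c:]) z' q1 * U)"
    by (simp only: evq q mult.assoc)
  then have qz: "ev3 (\<lambda>c. [:c:]) z' q0 * V = ev3 (\<lambda>c. [:c:]) z' q1 * U"
    using n3 by (simp add: \<Lambda>_def)
  have "Z = z' + smul3 (dot3 g Z) w" by (simp add: z'_def)
  then have cong: "dot3 g Z dvd ev3 (\<lambda>c. [:c:]) Z q - ev3 (\<lambda>c. [:c:]) z' q" for q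
    using ev3_cong_mod[of "\<lambda>c. [:c:]" "dot3 g Z" z' w q] by simp
  define s0 where "s0 = ev3 (\<lambda>c. c) z q0"
  define s1 where "s1 = ev3 (\<lambda>c. c) z q1"
  have ez: "ev3 (\<lambda>c. [:c:]) Z q0 = [:s0:]" "ev3 (\<lambda>c. [:c:]) Z q1 = [:s1:]"
    unfolding Z_def ev3_const_poly s0_def s1_def by simp_all
  have "dot3 g Z dvd ([:s0:] - ev3 (\<lambda>c. [:c:]) z' q0) * V - ([:s1:] - ev3 (\<lambda>c. [:c:]) z' q1) * U"
    by (rule dvd_diff[OF dvd_mult2[OF cong[of q0, unfolded ez]] dvd_mult2[OF cong[of q1, unfolded ez]]])
  also have "\<dots> = smult s0 V - smult s1 U"
    using qz by (simp add: left_diff_distrib)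
  finally have dvd: "dot3 g Z dvd smult s0 V - smult s1 U" .
  \<comment> \<open>\<open>U\<close> and \<open>V\<close> are linearly independent over
    \<open>k\<close>, by the determinant condition on the coordinates.\<close>
  have "smult s0 V - smult s1 U \<noteq> 0"
  proof
    assume "smult s0 V - smult s1 U = 0"
    then have 0: "s0 * \<delta> = s1 * \<beta>" "s0 * \<gamma> = s1 * \<alpha>" by (simp_all add: U_def V_def)
    have "s0 = s0 * (\<alpha> * \<delta> - \<beta> * \<gamma>)" using det by simp
    also have "\<dots> = \<alpha> * (s0 * \<delta>) - \<beta> * (s0 * \<gamma>)" by (simp add: algebra_simps)
    also have "\<dots> = 0" unfolding 0 by simp
    finally have "s0 = 0" .
    have "s1 = s1 * (\<alpha> * \<delta> - \<beta> * \<gamma>)" using det by simp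
    also have "\<dots> = \<delta> * (s1 * \<alpha>) - \<gamma> * (s1 * \<beta>)" by (simp add: algebra_simps)
    also have "\<dots> = 0" unfolding 0[symmetric] by simp
    finally have "s1 = 0" .
    note \<open>s0 = 0\<close> \<open>s1 = 0\<close>
    then show False using z(1) by (simp add: s0_def s1_def)
  qed
  with dvd have "degree (dot3 g Z) \<le> degree (smult s0 V - smult s1 U)" by (rule dvd_imp_degree_le)
  also have "\<dots> \<le> 1" by (simp add: U_def V_def degree_diff_le)
  finally have le: "degree (dot3 g Z) \<le> 1" .
  have "vdeg 0 Z" "map3 (\<lambda>p. coeff p 0) Z = z" by (cases z; simp add: Z_def vdeg_def v3_defs)+
  then have "coeff (dot3 g Z) m = dot3 G z" using dot3_top[OF vdeg_g, of 0 Z] by (simp add: G_def)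
  with z(2) have "m \<le> degree (dot3 g Z)" by (intro le_degree) simp
  with le show "m \<le> 1" by simp
qed

text \<open>If \<open>m = 0\<close>, then \<open>g\<close> is a linear relation between the three forms.\<close>

lemma m_pos_of_dominant:
  assumes dom: "\<And>d F. homogeneous d F \<Longrightarrow> ev3 bconst f F = 0 \<Longrightarrow> F = 0"
  shows "m \<noteq> 0"
proof
  assume m: "m = 0"
  define G where "G = map3 (\<lambda>p. coeff p m) g"
  have g: "vdeg 0 g" "hmg3 0 g = map3 bconst G"
    using vdeg_g m by (cases g; auto simp: G_def vdeg_def v3_defs hmg_def)+
  have "dot3 (map3 bconst G) f = 0"
    unfolding g(2)[symmetric] form1_def
    by (simp only: dot3_linear hmg3_mult(2)[OF g(1) deg_ab(1)] hmg3_mult(2)[OF g(1) deg_ab(2)] dot_g hmg_linear)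
      simp
  then have "ev3 bconst f (dot3 (map3 tconst G) zvec) = 0" by (simp add: ev3_linear_form rhom_bconst)
  then have "dot3 (map3 tconst G) zvec = 0" using dom homogeneous_linear_form by blast
  then show False using linear_form_nonzero top_g unfolding G_def by blast
qed

lemma inverse_exists:
  assumes m: "m = 1"
  shows "\<exists>p0 p1 q0 q1 s t \<Lambda>. homogeneous 3 p0 \<and> homogeneous 3 p1 \<and> homogeneous 1 q0 \<and> homogeneous 1 q1 \<and>
     s \<noteq> 0 \<and> t \<noteq> 0 \<and> \<Lambda> \<noteq> 0 \<and>
     ev3 bconst f p0 = s * var_x \<and> ev3 bconst f p1 = s * var_y \<and>
     ev3 bconst f q0 = t * var_u \<and> ev3 bconst f q1 = t * var_v \<and>
     map3 (bsubst p0 p1 q0 q1) f = smul3 \<Lambda> zvec"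
proof -
  define G0 where "G0 = map3 (\<lambda>p. coeff p 0) g"
  define G1 where "G1 = map3 (\<lambda>p. coeff p 1) g"
  have vg: "vdeg 1 g" using vdeg_g m by simp
  define c3 where "c3 = map3 (\<lambda>c :: 'k. [:c:])"
  have c3: "vdeg 0 (c3 v)" for v by (cases v) (simp add: c3_def vdeg_def v3_defs)
  have g: "g = c3 G0 + smul3 [:0, 1:] (c3 G1)"
  proof -
    have "p = [:coeff p 0:] + [:0, 1:] * [:coeff p 1:]" if "degree p \<le> 1" for p :: "'k poly"
      using that by (intro poly_eqI) (auto simp: coeff_pCons split: nat.splits intro!: coeff_eq_0)
    then show ?thesis using vg by (cases g) (auto simp: G0_def G1_def c3_def v3_defs vdeg_def)
  qed
  have G1nz: "G1 \<noteq> 0" using top_g m by (simp add: G1_def)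
  \<comment> \<open>Homogenized, g \<bullet> z = 0 reads lam (G0 \<bullet> z) + mu (G1 \<bullet> z)
    = 0, with the solution (mu : lam) = (\<open>M\<close> : \<open>L\<close>); \<open>q0\<close> and
    \<open>q1\<close> translate it back to u and v.\<close>
  define L where "L = dot3 (map3 tconst G1) zvec"
  define M where "M = - dot3 (map3 tconst G0) zvec"
  have LM: "homogeneous 1 L" "homogeneous 1 M"
    unfolding L_def M_def by (intro homogeneous_minus homogeneous_linear_form)+
  define q0 where "q0 = tconst \<alpha> * M + tconst \<beta> * L"
  define q1 where "q1 = tconst \<gamma> * M + tconst \<delta> * L"
  have hq: "homogeneous 1 q0" "homogeneous 1 q1"
    unfolding q0_def q1_def by (intro homogeneous_add homogeneous_const_mult LM)+
  define hz where "hz d P = (\<Sum>i\<le>d. tconst (coeff P i) * M ^ i * L ^ (d - i))" for d and P :: "'k poly"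
  note tc = rhomD[OF rhom_tconst]
  have td: "tconst \<alpha> * tconst \<delta> - tconst \<beta> * tconst \<gamma> = 1"
    using det by (metis tc(2) tc(4) tc(6))
  have bev_hmg: "bev tconst p0 p1 q0 q1 (hmg d P) = hz d P" for p0 p1 d P
  proof -
    note bs = rhomD[OF rhom_bev[OF rhom_tconst]] bev_vars[OF rhom_tconst]
    have "bev tconst p0 p1 q0 q1 mu = (tconst \<alpha> * tconst \<delta> - tconst \<beta> * tconst \<gamma>) * M"
      by (simp add: mu_def bs q0_def q1_def algebra_simps)
    moreover have "bev tconst p0 p1 q0 q1 lam = (tconst \<alpha> * tconst \<delta> - tconst \<beta> * tconst \<gamma>) * L"
      by (simp add: lam_def bs q0_def q1_def algebra_simps)
    ultimately show ?thesis by (simp add: hmg_def hz_def bs td)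
  qed
  define A where "A = map3 (hz 2) a"
  define B where "B = map3 (hz 2) b"
  have bevAB: "map3 (bev tconst p0 p1 q0 q1) f = smul3 p0 A + smul3 p1 B" for p0 p1
    unfolding form1_def A_def B_def
    by (cases a; cases b) (simp add: v3_defs rhomD[OF rhom_bev[OF rhom_tconst]] bev_vars[OF rhom_tconst] bev_hmg)
  have AB: "cross3 A B = map3 (hz 4) (smul3 D g)"
  proof -
    have h: "map3 (hz d) v = map3 (bev tconst 0 0 q0 q1) (hmg3 d v)" for d v
      by (simp add: map3_compose bev_hmg)
    have "cross3 (hmg3 2 a) (hmg3 2 b) = hmg3 4 (smul3 D g)"
      using hmg3_mult(3)[OF deg_ab] by (simp add: cross_ab)
    then show ?thesis unfolding A_def B_def h map3_rhom(2)[OF rhom_bev[OF rhom_tconst]] by simp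
  qed
  have zg: "dot3 zvec (map3 (hz 1) g) = 0"
  proof -
    have "map3 (hz 1) g = smul3 L (map3 tconst G0) + smul3 M (map3 tconst G1)"
      by (cases g) (simp add: hz_def v3_defs G0_def G1_def algebra_simps)
    then have "dot3 zvec (map3 (hz 1) g) = L * dot3 (map3 tconst G0) zvec + M * dot3 (map3 tconst G1) zvec"
      by (simp add: dot3_linear dot3_commute[of zvec])
    also have "\<dots> = 0" unfolding L_def M_def by simp
    finally show ?thesis .
  qed
  have zAB: "dot3 zvec (cross3 A B) = 0"
  proof -
    have "map3 (hz 4) (smul3 D g) = smul3 (hz n D) (map3 (hz 1) g)"
    proof -
      have "hmg3 4 (smul3 D g) = smul3 (hmg n D) (hmg3 1 g)"
      proof -
        have "n + 1 = 4" using n_le m by simp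
        then show ?thesis using hmg3_mult(1)[OF vg order.refl, of D] by simp
      qed
      then have "map3 (bev tconst 0 0 q0 q1) (hmg3 4 (smul3 D g))
          = map3 (bev tconst 0 0 q0 q1) (smul3 (hmg n D) (hmg3 1 g))" by simp
      then show ?thesis
        by (simp add: map3_rhom(3)[OF rhom_bev[OF rhom_tconst], symmetric] bev_hmg map3_compose)
    qed
    then show ?thesis by (simp only: AB dot3_linear zg mult_zero_right)
  qed
  obtain n3 where "n3 \<in> {(1,0,0), (0,1,0), (0,0,1)}" and n3: "dot3 n3 (cross3 a b) \<noteq> 0"
    using dot3_nonzero[OF cross_ab_nz] by blast
  then obtain k3 where k3: "n3 = c3 k3"
    by (auto simp: c3_def map3_def one_pCons intro: that[of "(1,0,0)"] that[of "(0,1,0)"] that[of "(0,0,1)"])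
  define N where "N = map3 tconst k3"
  \<comment> \<open>The coordinates of z with respect to \<open>A\<close> and \<open>B\<close> by
    Cramer's rule. The degrees 0 + 1 + 2 add up to 3.\<close>
  define p0 where "p0 = dot3 N (cross3 zvec B)"
  define p1 where "p1 = dot3 N (cross3 A zvec)"
  define \<Lambda> where "\<Lambda> = dot3 N (cross3 A B)"
  have hhz: "homogeneous d (hz d P)" for d P
    unfolding hz_def
  proof (rule homogeneous_sum)
    fix i assume "i \<in> {..d}"
    then show "homogeneous d (tconst (coeff P i) * M ^ i * L ^ (d - i))"
      using homogeneous_mult[OF homogeneous_const_mult[OF homogeneous_power[OF LM(2), of i]]
          homogeneous_power[OF LM(1), of "d - i"]] by simp
  qed
  have hAB: "all3 (homogeneous 2) A" "all3 (homogeneous 2) B"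
    unfolding A_def B_def by (cases a; cases b; simp add: all3_def map3_def hhz)+
  have hN: "all3 (homogeneous 0) N"
    unfolding N_def by (cases k3) (simp add: all3_def map3_def homogeneous_basic)
  have hp: "homogeneous 3 p0" "homogeneous 3 p1"
    using homogeneous_vectors(1)[OF hN homogeneous_vectors(2)[OF homogeneous_zvec hAB(2)]]
      homogeneous_vectors(1)[OF hN homogeneous_vectors(2)[OF hAB(1) homogeneous_zvec]]
    by (simp_all add: p0_def p1_def numeral_3_eq_3)
  have "map3 (bsubst p0 p1 q0 q1) f = smul3 \<Lambda> zvec"
    unfolding bsubst_bev bevAB p0_def p1_def \<Lambda>_def
    using cramer3[of N A B zvec] zAB by (simp add: smul3_linear)
  moreover
  define \<psi> where "\<psi> = ev3 bconst f"
  have \<psi>: "rhom \<psi>" unfolding \<psi>_def by (intro rhom_ev3 rhom_bconst)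
  note \<psi>s = rhomD[OF \<psi>]
  have \<psi>c: "\<psi> (tconst c) = bconst c" for c unfolding \<psi>_def by (simp add: ev3_zvec rhom_bconst)
  have \<psi>z: "map3 \<psi> zvec = f" unfolding \<psi>_def by (simp add: ev3_zvec rhom_bconst)
  have rel: "dot3 (c3 G0) v = - ([:0, 1:] * dot3 (c3 G1) v)" if "dot3 g v = 0" for v
  proof -
    have "dot3 (c3 G0) v + [:0, 1:] * dot3 (c3 G1) v = dot3 g v" by (subst g) (simp only: dot3_linear)
    then show ?thesis by (simp only: that eq_neg_iff_add_eq_0)
  qed
  \<comment> \<open>For v orthogonal to \<open>g\<close>, the polynomial t (G1 \<bullet> v) is - G0
    \<bullet> v, of degree at most 2, so one degree is gained. As a form, G1 \<bullet> f is
    therefore divisible by \<open>lam\<close>, with quotient \<sigma>.\<close>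
  have d1: "degree (dot3 (c3 G1) v) \<le> 1" if "dot3 g v = 0" "vdeg 2 v" for v
  proof -
    have "degree ([:0, 1:] * dot3 (c3 G1) v) \<le> 2"
      using rel[OF that(1)] degree_dot3[OF c3 that(2), of G0] by (metis add_0 degree_minus)
    then show ?thesis by (cases "dot3 (c3 G1) v = 0") (auto simp: degree_mult_eq)
  qed
  define Pa where "Pa = dot3 (c3 G1) a"
  define Pb where "Pb = dot3 (c3 G1) b"
  have Pd: "degree Pa \<le> 1" "degree Pb \<le> 1"
    unfolding Pa_def Pb_def using d1 dot_g deg_ab by blast+
  define \<sigma> where "\<sigma> = var_x * hmg 1 Pa + var_y * hmg 1 Pb"
  have hc: "hmg3 0 (c3 v) = map3 bconst v" for v
    by (cases v) (simp add: c3_def v3_defs hmg_def)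
  have dotc: "dot3 (map3 bconst v) f = var_x * hmg 2 (dot3 (c3 v) a) + var_y * hmg 2 (dot3 (c3 v) b)" for v
    unfolding hc[symmetric] form1_def dot3_linear hmg3_mult(2)[OF c3 deg_ab(1)] hmg3_mult(2)[OF c3 deg_ab(2)]
    by (simp only: add_0)
  have \<psi>L: "\<psi> L = \<sigma> * lam"
  proof -
    have "\<psi> L = dot3 (map3 bconst G1) f"
      unfolding \<psi>_def L_def by (rule ev3_linear_form[OF rhom_bconst])
    also have "\<dots> = var_x * hmg 2 Pa + var_y * hmg 2 Pb" unfolding dotc Pa_def Pb_def ..
    also have "\<dots> = \<sigma> * lam"
      using hmg_raise[OF Pd(1), of 1] hmg_raise[OF Pd(2), of 1]
      by (simp add: \<sigma>_def numeral_2_eq_2 algebra_simps)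
    finally show ?thesis .
  qed
  have \<psi>M: "\<psi> M = \<sigma> * mu"
  proof -
    have t: "hmg 1 [:0, 1:] = mu" by (simp add: hmg_def bconst_simps)
    have "\<psi> M = - dot3 (map3 bconst G0) f"
      unfolding M_def \<psi>s(5) unfolding \<psi>_def by (simp only: ev3_linear_form[OF rhom_bconst])
    also have "\<dots> = var_x * hmg 2 ([:0, 1:] * Pa) + var_y * hmg 2 ([:0, 1:] * Pb)"
      unfolding dotc rel[OF dot_g(1)] rel[OF dot_g(2)] Pa_def Pb_def hmg_linear by simp
    also have "\<dots> = \<sigma> * mu"
      using hmg_mult[of "[:0, 1:]" 1 Pa 1] hmg_mult[of "[:0, 1:]" 1 Pb 1] Pd t
      by (simp add: \<sigma>_def numeral_2_eq_2 algebra_simps)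
    finally show ?thesis .
  qed
  have \<psi>hz: "\<psi> (hz d P) = \<sigma> ^ d * hmg d P" for d P
  proof -
    have "\<sigma> ^ d = \<sigma> ^ i * \<sigma> ^ (d - i)" if "i \<le> d" for i using that by (simp flip: power_add)
    then show ?thesis
      by (auto simp: hz_def hmg_def \<psi>s \<psi>c \<psi>L \<psi>M sum_distrib_left power_mult_distrib algebra_simps intro!: sum.cong)
  qed
  \<comment> \<open>Otherwise the constant vector \<open>G1\<close> would be orthogonal to
    \<open>a\<close> and \<open>b\<close>, thus a nonzero multiple of \<open>g\<close>, which has
    degree exactly 1.\<close>
  have \<sigma>nz: "\<sigma> \<noteq> 0"
  proof
    assume "\<sigma> = 0"
    then have "ev 1 0 \<sigma> = 0" "ev 0 1 \<sigma> = 0" by (simp_all add: ev_simps)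
    then have "Pa = 0" "Pb = 0" using Pd by (simp_all add: \<sigma>_def ev_simps ev_vars ev_hmg)
    then have *: "c3 G1 = smul3 (dot3 w (c3 G1)) g" unfolding Pa_def Pb_def by (rule common_syzygy)
    have "dot3 w (c3 G1) \<noteq> 0"
    proof
      assume "dot3 w (c3 G1) = 0"
      with * have "c3 G1 = 0" by (simp add: smul3_linear)
      then show False using G1nz by (cases G1) (simp add: c3_def v3_defs zero_prod_def)
    qed
    then have "vdeg (0 - degree (dot3 w (c3 G1))) g" using vdeg_cancel(2)[of 0 "dot3 w (c3 G1)" g] c3[of G1] * by simp
    then have "m \<le> 0" unfolding diff_0_eq_0 by (rule m_le)
    with m show False by simp
  qed
  have H4: "hmg 4 (dot3 n3 (cross3 a b)) \<noteq> 0"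
    using n3 degree_dot3[OF c3 vdeg_cross3[OF deg_ab], of k3] by (simp add: hmg_eq_0_iff k3)
  have \<psi>N: "map3 \<psi> N = hmg3 0 n3" unfolding N_def k3 hc by (simp add: map3_compose \<psi>c)
  have \<psi>A: "map3 \<psi> (map3 (hz d) v) = smul3 (\<sigma> ^ d) (hmg3 d v)" for d v
    by (cases v) (simp add: v3_defs \<psi>hz)
  have N4: "dot3 (hmg3 0 n3) (hmg3 4 (cross3 a b)) = hmg 4 (dot3 n3 (cross3 a b))"
    using hmg3_mult(2)[OF c3[of k3] vdeg_cross3[OF deg_ab]] by (simp add: k3)
  have c4: "cross3 (hmg3 2 a) (hmg3 2 b) = hmg3 4 (cross3 a b)" using hmg3_mult(3)[OF deg_ab] by simp
  have \<psi>dot: "\<psi> (dot3 N (cross3 v v')) = dot3 (hmg3 0 n3) (cross3 (map3 \<psi> v) (map3 \<psi> v'))" for v v'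
    by (simp only: map3_rhom[OF \<psi>, symmetric] \<psi>N)
  have "\<psi> p0 = (\<sigma> ^ 2 * hmg 4 (dot3 n3 (cross3 a b))) * var_x"
    unfolding p0_def \<psi>dot \<psi>z B_def \<psi>A unfolding form1_def
    by (simp add: cross3_linear cross3_self smul3_linear c4 dot3_linear N4 mult_ac)
  moreover have "\<psi> p1 = (\<sigma> ^ 2 * hmg 4 (dot3 n3 (cross3 a b))) * var_y"
    unfolding p1_def \<psi>dot \<psi>z A_def \<psi>A unfolding form1_def
    by (simp add: cross3_linear cross3_self smul3_linear c4 dot3_linear N4 mult_ac)
  moreover have "\<psi> \<Lambda> = \<sigma> ^ 4 * hmg 4 (dot3 n3 (cross3 a b))"
    unfolding \<Lambda>_def AB map3_rhom(1)[OF \<psi>, symmetric] \<psi>N \<psi>A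
    by (simp add: dot3_linear N4 flip: cross_ab)
  then have "\<Lambda> \<noteq> 0" using \<sigma>nz H4 \<psi>s(1) by auto
  moreover have "\<psi> q0 = \<sigma> * var_u" "\<psi> q1 = \<sigma> * var_v"
    unfolding q0_def q1_def u_v[symmetric] by (simp_all add: \<psi>s \<psi>c \<psi>L \<psi>M algebra_simps)
  moreover have "\<sigma> ^ 2 * hmg 4 (dot3 n3 (cross3 a b)) \<noteq> 0" using \<sigma>nz H4 by simp
  ultimately show ?thesis using hp hq \<sigma>nz unfolding \<psi>_def by blast
qed

end

section \<open>Comparison with the defined invariants, and conclusion\<close>

lemma deg0_loc_chart_mult:
  assumes "x \<in> deg0_loc (chart i) (idl f)"
  shows "x \<in> deg0_loc (chart i * chart j) (idl f)"
proof -
  obtain A k where A: "x = Fract A (chart i ^ k)" "A \<in> idl f" "bihomogeneous (k * 1) (k * 1) A"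
    using assms by (rule deg0_locE[OF _ bihomogeneous_chart chart_nz])
  have "x = Fract (A * chart j ^ k) ((chart i * chart j) ^ k)"
    by (simp add: A(1) eq_fract chart_nz power_mult_distrib algebra_simps)
  moreover have "bihomogeneous (k * 1 + k * 1) (k * 1 + k * 1) (A * chart j ^ k)"
    by (rule bihomogeneous_mult[OF A(3) bihomogeneous_power[OF bihomogeneous_chart]])
  then have "bihomogeneous (k * 2) (k * 2) (A * chart j ^ k)" by (simp add: mult_2_right)
  ultimately show ?thesis using deg0_locI[OF idl_closed(4)[OF A(2)] _ bihomogeneous_chart2] by metis
qed

text \<open>Elements of the ideal on two charts differ by an element of the ideal on the overlap, so
  intersecting with \<open>sections\<close> loses nothing in
  \<open>base_null_sections\<close>.\<close>

lemma nulls_sections: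
  fixes s :: "bool \<times> bool \<Rightarrow> 'k::field bipoly fract"
  assumes "\<And>i. s i \<in> deg0_loc (chart i) (idl f)"
  shows "s \<in> sections (idl f)"
  unfolding sections_def
proof (intro CollectI conjI allI)
  fix i j
  show "s i \<in> deg0_loc (chart i) UNIV" using assms[of i] unfolding deg0_loc_def by blast
  have nz: "chart i * chart j \<noteq> (0 :: 'k bipoly)" by (simp add: chart_nz)
  have "Fract (bconst (-1)) 1 * s j \<in> deg0_loc (chart i * chart j) (idl f)"
    using deg0_loc_chart_mult[OF assms[of j], of i] unfolding mult.commute[of "chart j"]
    by (rule deg0_loc_scale[OF _ bihomogeneous_chart2 nz]) (rule idl_closed(3))
  then have "s i + Fract (bconst (-1)) 1 * s j \<in> deg0_loc (chart i * chart j) (idl f)"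
    by (rule deg0_loc_add[OF deg0_loc_chart_mult[OF assms] _ bihomogeneous_chart2 nz])
      (rule idl_closed(2,3); assumption)+
  moreover have "Fract (bconst (-1)) 1 = (-1 :: 'k bipoly fract)"
    by (simp add: bconst_simps flip: minus_fract One_fract_def)
  ultimately show "s i - s j \<in> deg0_loc (chart i * chart j) (idl f)" by simp
qed

lemma (in base) base_degree_eq:
  assumes "f = (f0, f1, f2)"
  shows "base_degree f0 f1 f2 = n"
proof -
  have "base_sections f0 f1 f2 = sections (idl f)"
    unfolding base_sections_def sections_def assms idl_ideal3 ..
  moreover have "base_null_sections f0 f1 f2 = sections (idl f) \<inter> nulls"
    using nulls_sections unfolding base_null_sections_def nulls_def idl_ideal3[symmetric] assms[symmetric]
    by blast
  ultimately show ?thesis by (simp add: base_degree_def quotient_dim_sections)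
qed

lemma (in base) syz_dims:
  assumes "f = (f0, f1, f2)"
  shows "syz_dim f0 f1 f2 0 1 = 2 - m" "syz_dim f0 f1 f2 1 1 = n"
  unfolding syz_dim_def syz_part_syzp assms[symmetric] by (rule syz_01_dim, rule syz_11_dim)

lemma same_proj2D:
  assumes "same_proj [p, q] [p', q']"
  shows "p * q' = q * p'" "p \<noteq> 0 \<or> q \<noteq> 0"
proof -
  have "\<forall>i<length [p, q]. \<forall>j<length [p, q]. [p, q] ! i * [p', q'] ! j = [p, q] ! j * [p', q'] ! i"
    using assms unfolding same_proj_def by blast
  from this[rule_format, of 0 1] show "p * q' = q * p'" by simp
  show "p \<noteq> 0 \<or> q \<noteq> 0" using assms unfolding same_proj_def by auto
qed

text \<open>An inverse bounds m by 1, and dominance excludes m = 0, where the image lies on a line.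
  Conversely the composites are the identity up to the nonzero factors \<open>s\<close>,
  \<open>t\<close> and \<Lambda>.\<close>

lemma (in base) birational_iff:
  assumes f: "f = (f0, f1, f2)" and inf: "infinite (UNIV :: 'k set)" and dom: "dominant_map f0 f1 f2"
  shows "birational_map f0 f1 f2 \<longleftrightarrow> m = 1"
proof
  have sub: "tsubst f0 f1 f2 = ev3 bconst f" by (simp add: f ev3_def tsubst_tev)
  have e0: "ev3 bconst f 0 = 0" by (rule rhomD(1)[OF rhom_ev3[OF rhom_bconst]])
  {
    assume "birational_map f0 f1 f2"
    then obtain d q0 q1 where q: "homogeneous d q0" "homogeneous d q1"
      "same_proj [ev3 bconst f q0, ev3 bconst f q1] [var_u, var_v]"
      unfolding birational_map_def sub by blast
    have "ev3 bconst f q0 * var_v = ev3 bconst f q1 * var_u" "q0 \<noteq> 0 \<or> q1 \<noteq> 0"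
      using same_proj2D[OF q(3)] e0 by (blast, metis)
    then have "m \<le> 1" using m_le_1_of_inverse[OF inf q(1,2)] by blast
    moreover have "m \<noteq> 0"
      by (rule m_pos_of_dominant) (use dom in \<open>auto simp: dominant_map_def sub\<close>)
    ultimately show "m = 1" by simp
  }
  assume "m = 1"
  then obtain p0 p1 q0 q1 s t \<Lambda> where *: "homogeneous 3 p0" "homogeneous 3 p1" "homogeneous 1 q0" "homogeneous 1 q1"
    "s \<noteq> 0" "t \<noteq> 0" "\<Lambda> \<noteq> 0" "ev3 bconst f p0 = s * var_x" "ev3 bconst f p1 = s * var_y"
    "ev3 bconst f q0 = t * var_u" "ev3 bconst f q1 = t * var_v"
    "map3 (bsubst p0 p1 q0 q1) f = smul3 \<Lambda> zvec" using inverse_exists by metis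
  have "bsubst p0 p1 q0 q1 f0 = \<Lambda> * var_z0" "bsubst p0 p1 q0 q1 f1 = \<Lambda> * var_z1" "bsubst p0 p1 q0 q1 f2 = \<Lambda> * var_z2"
    using *(12) unfolding f by (simp_all add: v3_defs zvec_def)
  moreover have "var_z0 \<noteq> (0 :: 'k tripoly)" by (simp add: var_z0_def)
  ultimately have
    "same_proj [tsubst f0 f1 f2 p0, tsubst f0 f1 f2 p1] [var_x, var_y]"
    "same_proj [tsubst f0 f1 f2 q0, tsubst f0 f1 f2 q1] [var_u, var_v]"
    "same_proj [bsubst p0 p1 q0 q1 f0, bsubst p0 p1 q0 q1 f1, bsubst p0 p1 q0 q1 f2] [var_z0, var_z1, var_z2]"
    using same_proj_scale[OF *(5), of "[var_x, var_y]"] same_proj_scale[OF *(6), of "[var_u, var_v]"]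
      same_proj_scale[OF *(7), of "[var_z0, var_z1, var_z2]"] *(8-11)
    unfolding sub by simp_all
  with *(1-4) show "birational_map f0 f1 f2" unfolding birational_map_def by blast
qed

text \<open>A good \<zeta> yields two generators wherever its \<open>lam\<close> is invertible. A
  prime containing \<zeta> v - u for two values of \<zeta> contains u and v, so of two good values
  at least one serves a given base point.\<close>

lemma generically_ci_form12:
  fixes f :: "'k::field bipoly v3"
  assumes inf: "infinite (UNIV :: 'k set)" and hom: "all3 (bihomogeneous 1 2) f" and cop: "coprime3 f"
    and f: "f = (f0, f1, f2)"
  shows "generically_ci f0 f1 f2"
  unfolding generically_ci_def
proof (intro allI impI)
  fix P assume "base_point f0 f1 f2 P"
  then have P: "prime_ideal P" "\<not> {var_u, var_v} \<subseteq> P" unfolding base_point_def by blast+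
  have add: "\<And>s t. s \<in> P \<Longrightarrow> t \<in> P \<Longrightarrow> s + t \<in> P" and mul: "\<And>s t. t \<in> P \<Longrightarrow> s * t \<in> P"
    using P(1) unfolding prime_ideal_def by blast+
  define good where "good = (\<lambda>\<zeta>. \<exists>a b g w C D r \<xi>. base \<zeta> (-1) 1 0 a b g w C D r \<xi> \<and> f = coords.form1 \<zeta> (-1) 1 0 2 a b)"
  have fin: "finite {\<zeta>. \<not> good \<zeta>}" unfolding good_def by (rule finite_bad_coords[OF inf hom cop])
  obtain \<zeta>1 where 1: "good \<zeta>1" using ex_new_if_finite[OF inf fin] by blast
  obtain \<zeta>2 where 2: "good \<zeta>2" "\<zeta>2 \<noteq> \<zeta>1"
    using ex_new_if_finite[OF inf, of "insert \<zeta>1 {\<zeta>. \<not> good \<zeta>}"] fin by auto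
  have "\<exists>\<zeta>. good \<zeta> \<and> bconst \<zeta> * var_v - var_u \<notin> P"
  proof (rule ccontr)
    assume "\<not> ?thesis"
    then have l: "bconst \<zeta>1 * var_v - var_u \<in> P" "bconst \<zeta>2 * var_v - var_u \<in> P" using 1 2 by blast+
    have "bconst (inverse (\<zeta>2 - \<zeta>1)) * ((bconst \<zeta>2 * var_v - var_u) + (-1) * (bconst \<zeta>1 * var_v - var_u))
      = bconst (inverse (\<zeta>2 - \<zeta>1) * (\<zeta>2 - \<zeta>1)) * var_v"
      unfolding bconst_simps by (simp add: algebra_simps)
    also have "\<dots> = var_v" using 2(2) by (simp add: bconst_1)
    finally have v: "var_v \<in> P" using l add mul by metis
    have "var_u = bconst \<zeta>1 * var_v + (-1) * (bconst \<zeta>1 * var_v - var_u)" by simp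
    then have "var_u \<in> P" using v l add mul by metis
    with v P(2) show False by blast
  qed
  then obtain \<zeta> a b g w C D r \<xi> where b: "base \<zeta> (-1) 1 0 a b g w C D r \<xi>" "f = coords.form1 \<zeta> (-1) 1 0 2 a b"
    and lam: "bconst \<zeta> * var_v - var_u \<notin> P" unfolding good_def by blast
  interpret base \<zeta> "-1" 1 0 a b g w C D r \<xi> by (rule b(1))
  have "lam = bconst \<zeta> * var_v - var_u" by (simp add: lam_def bconst_1)
  then show "\<exists>g h. g \<in> localize (- P) UNIV \<and> h \<in> localize (- P) UNIV \<and>
           localize (- P) (ideal3 f0 f1 f2) =
             {r * g + s * h | r s. r \<in> localize (- P) UNIV \<and> s \<in> localize (- P) UNIV}"
    using localize_two_generators[OF P(1)] lam unfolding b(2)[symmetric] f idl_ideal3 by simp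
qed

theorem theorem9:
  fixes f0 f1 f2 :: "'k::field bipoly"
  assumes "infinite (UNIV :: 'k set)"
    and "bihomogeneous 1 2 f0" and "bihomogeneous 1 2 f1" and "bihomogeneous 1 2 f2"
    and "\<And>d. d dvd f0 \<Longrightarrow> d dvd f1 \<Longrightarrow> d dvd f2 \<Longrightarrow> d \<in> range bconst"
    and "dominant_map f0 f1 f2"
  shows "(birational_map f0 f1 f2 \<longleftrightarrow> base_degree f0 f1 f2 = 3)
    \<and> (base_degree f0 f1 f2 = 3 \<longleftrightarrow> syz_dim f0 f1 f2 0 1 = 1)
    \<and> (syz_dim f0 f1 f2 0 1 = 1 \<longleftrightarrow> syz_dim f0 f1 f2 1 1 = 3)
    \<and> (base_degree f0 f1 f2 = 3 \<longrightarrow> generically_ci f0 f1 f2)"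
proof -
  define f where "f = (f0, f1, f2)"
  have hom: "all3 (bihomogeneous 1 2) f" using assms(2-4) by (simp add: f_def all3_def)
  have cop: "coprime3 f"
    unfolding coprime3_def f_def using assms(5) by (auto simp: smul3_def split: prod.splits)
  obtain \<zeta> a b g w C D r \<xi> where b: "base \<zeta> (-1) 1 0 a b g w C D r \<xi>" "f = coords.form1 \<zeta> (-1) 1 0 2 a b"
    using ex_new_if_finite[OF assms(1) finite_bad_coords[OF assms(1) hom cop]] by blast
  interpret base \<zeta> "-1" 1 0 a b g w C D r \<xi> by (rule b(1))
  have f: "form12 a b = (f0, f1, f2)" using b(2) f_def by simp
  \<comment> \<open>Since m is 4 - \<open>degree D\<close> and \<open>degree D\<close> is at most 4,
    the conditions m = 1 and 2 - m = 1 both mean \<open>degree D = 3\<close>.\<close>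
  have "birational_map f0 f1 f2 \<longleftrightarrow> degree D = 3"
    using birational_iff[OF f assms(1,6)] n_le by auto
  moreover have "syz_dim f0 f1 f2 0 1 = 1 \<longleftrightarrow> degree D = 3"
    using syz_dims(1)[OF f] n_le by auto
  ultimately show ?thesis
    using base_degree_eq[OF f] syz_dims(2)[OF f] generically_ci_form12[OF assms(1) hom cop f_def] by simp
qed

end
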